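(* Let $T$ be the $(4,d_1)$-semiregular tree with $d_1\geq 4$, and let $G\leq\mathrm{Aut}(T)^+$ be the group constructed in the context. Then $G$ belongs to $\mathcal{H}_T^+$, i.e. $G$ is a closed subgroup of $\mathrm{Aut}(T)$ contained in $\mathrm{Aut}(T)^+$ and acting $2$-transitively on the set of ends $\partial T$.
   Context: The $(4,d_1)$-semiregular tree $T$ is the tree with bipartition $V(T)=V_0(T)\sqcup V_1(T)$ such that every edge joins $V_0(T)$ to $V_1(T)$, vertices in $V_0(T)$ have degree $4$ and vertices in $V_1(T)$ have degree $d_1$. $\mathrm{Aut}(T)$ has the topology of pointwise convergence; $\mathrm{Aut}(T)^+$ is the subgroup preserving $V_0(T)$ and $V_1(T)$. $S(v,r)$, $B(v,r)$ denote the sphere and ball of radius $r$ around a vertex $v$. Rooted trees. For $e\geq 3$ let $T_{4,e,2}$ be the rooted tree of depth $2$ whose root has $4$ children, each having $e-1$ children. A legal coloring $j$ of $T_{4,e,2}$ assigns to the root and to the vertices at distance $2$ from the root colors in $\{1,\dots,e\}$, and to the children of the root colors in $\{1,\dots,4\}$, such that $j$ restricted to $S(\text{root},1)$ is a bijection onto $\{1,\dots,4\}$ and, for each child $x$ of the root, $j$ restricted to $S(x,1)$ is a bijection onto $\{1,\dots,e\}$. For $g\in\mathrm{Aut}(T_{4,e,2})$ and $x$ not a leaf, $\sigma_{(j)}(g,x)=j|_{S(g(x),1)}\circ g\circ j|_{S(x,1)}^{-1}$. Construction of $G$. Let $\tilde T_0=T_{4,3,2}$ with root $v_0$. Fix a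 bijection $\psi$ from $(\mathbf{F}_3)^2\setminus\{(0,0)\}$ to the eight vertices of $\tilde T_0$ at distance $2$ from $v_0$, such that two such vertices $x,y$ have the same parent if and only if $\psi^{-1}(x)$ and $\psi^{-1}(y)$ are multiples of one another. Via $\psi$ the natural action of $\mathrm{SL}(2,\mathbf{F}_3)$ on $(\mathbf{F}_3)^2\setminus\{(0,0)\}$ induces an action on $\tilde T_0$; let $\tilde G_0\leq\mathrm{Aut}(\tilde T_0)$ be its image. Let $\tilde T=T_{4,d_1,2}$ with root $v$. Fix legal colorings $\tilde j$ of $\tilde T$ and $\tilde j_0$ of $\tilde T_0$ with $\tilde j_0(v_0)=\tilde j(v)$ and let $\alpha\colon B(v,1)\to B(v_0,1)$ be the bijection preserving the colorings (and sending $v$ to $v_0$). Define $f\colon\mathrm{Aut}(\tilde T)\to\mathrm{Aut}(\tilde T_0)$: $f(g)$ is the unique automorphism of $\tilde T_0$ such that $f(g)(\alpha(x))=\alpha(g(x))$ for each $x\in B(v,1)$ and $\sigma_{(\tilde j_0)}(f(g),\alpha(x))$ has the same parity as $\sigma_{(\tilde j)}(g,x)$ for each $x\in S(v,1)$. Let $\tilde G=f^{-1}(\tilde G_0)\leq\mathrm{Aut}(\tilde T)$. For each $x\in V_0(T)$ fix an isomorphism of rooted trees $J_x\colon B(x,2)\to\tilde T$ (sending $x$ to $v$), and for $g\in\mathrm{Aut}(T)^+$ put $\Sigma_{(J)}(g,x)=J_{g(x)}\circ g\circ J_x^{-1}\in\mathrm{Aut}(\tilde T)$. Then $$G:=\{g\in\mathrm{Aut}(T)^+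 : \Sigma_{(J)}(g,x)\in\tilde G\text{ for each }x\in V_0(T)\}.$$ *)

theory Defs
  imports "HOL-Analysis.Analysis" "HOL-Combinatorics.Permutations" "HOL-Algebra.Group"
begin

section \<open>Graphs and trees\<close>

record 'v ugraph =
  verts :: "'v set"
  edges :: "('v \<times> 'v) set"

definition simple_graph :: "'v ugraph \<Rightarrow> bool" where
  "simple_graph T \<longleftrightarrow>
     edges T \<subseteq> verts T \<times> verts T \<and> sym (edges T) \<and> irrefl (edges T)"

definition graph_cycle :: "'v ugraph \<Rightarrow> 'v list \<Rightarrow> bool" where
  "graph_cycle T c \<longleftrightarrow> 3 \<le> length c \<and> distinct c \<and>
     successively (\<lambda>x y. (x, y) \<in> edges T) c \<and> (last c, hd c) \<in> edges T"

definition tree_graph :: "'v ugraph \<Rightarrow> bool" where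
  "tree_graph T \<longleftrightarrow> simple_graph T \<and> verts T \<noteq> {} \<and>
     (\<forall>x\<in>verts T. \<forall>y\<in>verts T. (x, y) \<in> (edges T)\<^sup>*) \<and> (\<nexists>c. graph_cycle T c)"

text \<open>The value is meaningful only for vertices joined by a walk; below it is used in trees only.\<close>

definition gdist :: "'v ugraph \<Rightarrow> 'v \<Rightarrow> 'v \<Rightarrow> nat" where
  "gdist T x y = (LEAST n. (x, y) \<in> edges T ^^ n)"

definition gsphere :: "'v ugraph \<Rightarrow> 'v \<Rightarrow> nat \<Rightarrow> 'v set" where
  "gsphere T x r = {y \<in> verts T. gdist T x y = r}"

definition gball :: "'v ugraph \<Rightarrow> 'v \<Rightarrow> nat \<Rightarrow> 'v set" where
  "gball T x r = {y \<in> verts T. gdist T x y \<le> r}"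

definition induced :: "'v ugraph \<Rightarrow> 'v set \<Rightarrow> 'v ugraph" where
  "induced T A = \<lparr>verts = A, edges = edges T \<inter> (A \<times> A)\<rparr>"

definition semiregular_tree :: "'v ugraph \<Rightarrow> 'v set \<Rightarrow> 'v set \<Rightarrow> nat \<Rightarrow> nat \<Rightarrow> bool" where
  "semiregular_tree T V\<^sub>0 V\<^sub>1 d\<^sub>0 d\<^sub>1 \<longleftrightarrow> tree_graph T \<and>
     V\<^sub>0 \<union> V\<^sub>1 = verts T \<and> V\<^sub>0 \<inter> V\<^sub>1 = {} \<and>
     edges T \<subseteq> V\<^sub>0 \<times> V\<^sub>1 \<union> V\<^sub>1 \<times> V\<^sub>0 \<and>
     (\<forall>x\<in>V\<^sub>0. finite (gsphere T x 1) \<and> card (gsphere T x 1) = d\<^sub>0) \<and>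
     (\<forall>x\<in>V\<^sub>1. finite (gsphere T x 1) \<and> card (gsphere T x 1) = d\<^sub>1)"

section \<open>Automorphism groups\<close>

text \<open>Automorphisms are extended by the identity outside the vertex set, so that they are
  permutations of the whole vertex type and form a group under composition.\<close>

definition graph_aut :: "'v ugraph \<Rightarrow> ('v \<Rightarrow> 'v) set" where
  "graph_aut T = {g. g permutes verts T \<and>
     (\<forall>x\<in>verts T. \<forall>y\<in>verts T. (g x, g y) \<in> edges T \<longleftrightarrow> (x, y) \<in> edges T)}"

definition aut_group :: "'v ugraph \<Rightarrow> ('v \<Rightarrow> 'v) monoid" where
  "aut_group T = \<lparr>carrier = graph_aut T, mult = (\<circ>), one = id\<rparr>"

definition aut_plus :: "'v ugraph \<Rightarrow> 'v set \<Rightarrow> 'v set \<Rightarrow> ('v \<Rightarrow> 'v) set" where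
  "aut_plus T V\<^sub>0 V\<^sub>1 = {g \<in> graph_aut T. g ` V\<^sub>0 = V\<^sub>0 \<and> g ` V\<^sub>1 = V\<^sub>1}"

text \<open>Pointwise convergence, the set of vertices being discrete.\<close>

definition aut_topology :: "'v ugraph \<Rightarrow> ('v \<Rightarrow> 'v) topology" where
  "aut_topology T =
     subtopology (product_topology (\<lambda>_. discrete_topology UNIV) UNIV) (graph_aut T)"

section \<open>Ends\<close>

text \<open>In a tree the geodesic rays are exactly the infinite paths without repeated vertices.\<close>

definition rays :: "'v ugraph \<Rightarrow> (nat \<Rightarrow> 'v) set" where
  "rays T = {\<rho>. inj \<rho> \<and> (\<forall>n. (\<rho> n, \<rho> (Suc n)) \<in> edges T)}"

definition cofinal_rays :: "'v ugraph \<Rightarrow> ((nat \<Rightarrow> 'v) \<times> (nat \<Rightarrow> 'v)) set" where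
  "cofinal_rays T = {(\<rho>, \<tau>). \<rho> \<in> rays T \<and> \<tau> \<in> rays T \<and>
     (\<exists>m n. \<forall>k. \<rho> (m + k) = \<tau> (n + k))}"

definition ends :: "'v ugraph \<Rightarrow> (nat \<Rightarrow> 'v) set set" where
  "ends T = rays T // cofinal_rays T"

definition move_end :: "('v \<Rightarrow> 'v) \<Rightarrow> (nat \<Rightarrow> 'v) set \<Rightarrow> (nat \<Rightarrow> 'v) set" where
  "move_end g \<epsilon> = (\<lambda>\<rho>. g \<circ> \<rho>) ` \<epsilon>"

definition two_transitive_on :: "'x set \<Rightarrow> 'g set \<Rightarrow> ('g \<Rightarrow> 'x \<Rightarrow> 'x) \<Rightarrow> bool" where
  "two_transitive_on X H act \<longleftrightarrow>
     (\<forall>a\<in>X. \<forall>b\<in>X. \<forall>c\<in>X. \<forall>d\<in>X. a \<noteq> b \<and> c \<noteq> d \<longrightarrow>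
        (\<exists>g\<in>H. act g a = c \<and> act g b = d))"

definition H_plus :: "'v ugraph \<Rightarrow> 'v set \<Rightarrow> 'v set \<Rightarrow> ('v \<Rightarrow> 'v) set set" where
  "H_plus T V\<^sub>0 V\<^sub>1 = {H. subgroup H (aut_group T) \<and> closedin (aut_topology T) H \<and>
     H \<subseteq> aut_plus T V\<^sub>0 V\<^sub>1 \<and> two_transitive_on (ends T) H move_end}"

section \<open>Rooted trees of depth 2 and their colorings\<close>

definition rooted_tree_4_2 :: "'a ugraph \<Rightarrow> 'a \<Rightarrow> nat \<Rightarrow> bool" where
  "rooted_tree_4_2 T r e \<longleftrightarrow> tree_graph T \<and> r \<in> verts T \<and> gball T r 2 = verts T \<and>
     finite (gsphere T r 1) \<and> card (gsphere T r 1) = 4 \<and>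
     (\<forall>x\<in>gsphere T r 1. finite (gsphere T x 1 - {r}) \<and> card (gsphere T x 1 - {r}) = e - 1)"

definition rooted_aut :: "'a ugraph \<Rightarrow> 'a \<Rightarrow> ('a \<Rightarrow> 'a) set" where
  "rooted_aut T r = {g \<in> graph_aut T. g r = r}"

definition rooted_iso :: "('a \<Rightarrow> 'b) \<Rightarrow> 'a ugraph \<Rightarrow> 'a \<Rightarrow> 'b ugraph \<Rightarrow> 'b \<Rightarrow> bool" where
  "rooted_iso \<phi> A a B b \<longleftrightarrow> bij_betw \<phi> (verts A) (verts B) \<and> \<phi> a = b \<and>
     (\<forall>x\<in>verts A. \<forall>y\<in>verts A. (\<phi> x, \<phi> y) \<in> edges B \<longleftrightarrow> (x, y) \<in> edges A)"

definition legal_coloring :: "'a ugraph \<Rightarrow> 'a \<Rightarrow> nat \<Rightarrow> ('a \<Rightarrow> nat) \<Rightarrow> bool" where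
  "legal_coloring T r e j \<longleftrightarrow>
     j r \<in> {1..e} \<and> (\<forall>x\<in>gsphere T r 2. j x \<in> {1..e}) \<and>
     bij_betw j (gsphere T r 1) {1..4} \<and>
     (\<forall>x\<in>gsphere T r 1. bij_betw j (gsphere T x 1) {1..e})"

text \<open>\<open>j|\<^bsub>S(g x,1)\<^esub> \<circ> g \<circ> j|\<^bsub>S(x,1)\<^esub>\<^sup>-\<^sup>1\<close>, a permutation of the finite
  set of colors of the sphere, extended by the identity to all of \<open>nat\<close> (this does not
  affect its parity).\<close>

definition local_perm ::
  "'a ugraph \<Rightarrow> ('a \<Rightarrow> nat) \<Rightarrow> ('a \<Rightarrow> 'a) \<Rightarrow> 'a \<Rightarrow> nat \<Rightarrow> nat" where
  "local_perm T j g x =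
     restrict_id (j \<circ> g \<circ> inv_into (gsphere T x 1) j) (j ` gsphere T x 1)"

section \<open>The group \<open>G\<close>\<close>

text \<open>The type \<open>3\<close> is the ring of integers modulo 3.  The map \<open>\<psi>\<close> is only considered on
  nonzero vectors.\<close>

definition vector_labelling :: "'b ugraph \<Rightarrow> 'b \<Rightarrow> (3^2 \<Rightarrow> 'b) \<Rightarrow> bool" where
  "vector_labelling T r \<psi> \<longleftrightarrow> bij_betw \<psi> {w. w \<noteq> 0} (gsphere T r 2) \<and>
     (\<forall>u w. u \<noteq> 0 \<longrightarrow> w \<noteq> 0 \<longrightarrow>
        (\<exists>p\<in>gsphere T r 1. (p, \<psi> u) \<in> edges T \<and> (p, \<psi> w) \<in> edges T) \<longleftrightarrow>
        (\<exists>c. u = c *s w) \<and> (\<exists>c. w = c *s u))"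

definition SL23_image :: "'b ugraph \<Rightarrow> 'b \<Rightarrow> (3^2 \<Rightarrow> 'b) \<Rightarrow> ('b \<Rightarrow> 'b) set" where
  "SL23_image T r \<psi> = {h \<in> rooted_aut T r.
     \<exists>A :: 3^2^2. det A = 1 \<and> (\<forall>w. w \<noteq> 0 \<longrightarrow> h (\<psi> w) = \<psi> (A *v w))}"

definition color_map ::
  "'a ugraph \<Rightarrow> 'a \<Rightarrow> ('a \<Rightarrow> nat) \<Rightarrow> 'b ugraph \<Rightarrow> 'b \<Rightarrow> ('b \<Rightarrow> nat) \<Rightarrow> ('a \<Rightarrow> 'b) \<Rightarrow> bool" where
  "color_map T r j T\<^sub>0 r\<^sub>0 j\<^sub>0 \<alpha> \<longleftrightarrow> bij_betw \<alpha> (gball T r 1) (gball T\<^sub>0 r\<^sub>0 1) \<and> \<alpha> r = r\<^sub>0 \<and>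
     (\<forall>x\<in>gball T r 1. j\<^sub>0 (\<alpha> x) = j x)"

text \<open>The automorphism described exists and is unique when \<open>T\<^sub>0\<close> has \<open>e = 3\<close>: each child
  of its root then has two children, so the parity decides between the two possible
  bijections.\<close>

definition parity_map ::
  "'a ugraph \<Rightarrow> 'a \<Rightarrow> ('a \<Rightarrow> nat) \<Rightarrow> 'b ugraph \<Rightarrow> 'b \<Rightarrow> ('b \<Rightarrow> nat) \<Rightarrow> ('a \<Rightarrow> 'b) \<Rightarrow>
     ('a \<Rightarrow> 'a) \<Rightarrow> 'b \<Rightarrow> 'b" where
  "parity_map T r j T\<^sub>0 r\<^sub>0 j\<^sub>0 \<alpha> g = (THE h. h \<in> rooted_aut T\<^sub>0 r\<^sub>0 \<and>
     (\<forall>x\<in>gball T r 1. h (\<alpha> x) = \<alpha> (g x)) \<and>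
     (\<forall>x\<in>gsphere T r 1.
        evenperm (local_perm T\<^sub>0 j\<^sub>0 h (\<alpha> x)) \<longleftrightarrow> evenperm (local_perm T j g x)))"

definition parity_preimage ::
  "'a ugraph \<Rightarrow> 'a \<Rightarrow> ('a \<Rightarrow> nat) \<Rightarrow> 'b ugraph \<Rightarrow> 'b \<Rightarrow> ('b \<Rightarrow> nat) \<Rightarrow> ('a \<Rightarrow> 'b) \<Rightarrow>
     ('b \<Rightarrow> 'b) set \<Rightarrow> ('a \<Rightarrow> 'a) set" where
  "parity_preimage T r j T\<^sub>0 r\<^sub>0 j\<^sub>0 \<alpha> H\<^sub>0 =
     {g \<in> rooted_aut T r. parity_map T r j T\<^sub>0 r\<^sub>0 j\<^sub>0 \<alpha> g \<in> H\<^sub>0}"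

text \<open>\<open>J\<^bsub>g(x)\<^esub> \<circ> g \<circ> J\<^bsub>x\<^esub>\<^sup>-\<^sup>1\<close>, extended by the identity outside the vertex set
  of the model tree.\<close>

definition local_action ::
  "'v ugraph \<Rightarrow> 'a ugraph \<Rightarrow> ('v \<Rightarrow> 'v \<Rightarrow> 'a) \<Rightarrow> ('v \<Rightarrow> 'v) \<Rightarrow> 'v \<Rightarrow> 'a \<Rightarrow> 'a" where
  "local_action T T' J g x =
     restrict_id (J (g x) \<circ> g \<circ> inv_into (gball T x 2) (J x)) (verts T')"

definition group_G ::
  "'v ugraph \<Rightarrow> 'v set \<Rightarrow> 'v set \<Rightarrow> 'a ugraph \<Rightarrow> ('v \<Rightarrow> 'v \<Rightarrow> 'a) \<Rightarrow> ('a \<Rightarrow> 'a) set \<Rightarrow>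
     ('v \<Rightarrow> 'v) set" where
  "group_G T V\<^sub>0 V\<^sub>1 T' J H =
     {g \<in> aut_plus T V\<^sub>0 V\<^sub>1. \<forall>x\<in>V\<^sub>0. local_action T T' J g x \<in> H}"

end

theory Submission
  imports Defs
begin

text \<open>An automorphism is determined by its local actions on the balls \<open>B(x, 2)\<close> around the vertices
  \<open>x\<close> of \<open>V\<^sub>0\<close>, and the local actions at neighbouring balls only have to agree on the common sphere
  \<open>S(y, 1)\<close>. Membership of a local action in the model group depends on the permutation of \<open>S(x, 1)\<close>
  and on the four parities at its elements. The group \<open>PSL(2, 3)\<close> is 2-transitive on the projective
  line and \<open>-1\<close> flips all four parities, so one may prescribe the images of two neighbours of \<open>x\<close>, the
  whole action on the sphere around the first one and, because \<open>d\<^sub>1 \<ge> 4\<close> leaves two free vertices to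
  adjust the parity, the image of one further vertex next to the second one. Starting at a vertex of a
  line and moving outwards, any map from a line to a line respecting \<open>V\<^sub>0\<close> therefore extends to an
  element of \<open>G\<close>; the maps obtained on the balls fit together to a locally bijective endomorphism of the
  tree, which is an automorphism. Any two distinct ends are the ends of a line, whence
  2-transitivity.\<close>

section \<open>Trees\<close>

text \<open>In \<open>T\<^sub>0\<close> every child of the root carries just two leaves, so an
  automorphism with given action on the children amounts to four signs; this makes the parity map
  well defined. The obstacle is that the signs of a matrix are not free. \<open>SL(2,3)\<close> has
  order 24 and acts faithfully, while permutations of four children with arbitrary signs number 24 *
  16. Since \<open>PSL(2,3)\<close> is sharply 2-transitive on the four lines, prescribing two
  images leaves a matrix and its negative: one parity can still be chosen, the other three are then
  forced. The choice is spent on the neighbour through which a ball meets its predecessor, because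
  there the whole sphere is already prescribed. At the other neighbours the forced parity is met by
  moving vertices that carry no prescription. A ball of radius 2 advances a line by two edges, so
  lines are cut at vertices of \<open>V\<^sub>0\<close> and three consecutive vertices are tracked
  per ball. Balls whose centres are at distance 2 meet exactly in the ball of radius 1 around the
  midpoint. Hence a recursion on the distance from the starting vertex meets a single consistency
  condition at each centre, agreement with its grandparent.\<close>

definition nbrs :: "'v ugraph \<Rightarrow> 'v \<Rightarrow> 'v set" where
  "nbrs T x = {y. (x, y) \<in> edges T}"

lemma in_nbrs [simp]: "y \<in> nbrs T x \<longleftrightarrow> (x, y) \<in> edges T"
  by (simp add: nbrs_def)

text \<open>Walks without backtracking, as functions rather than lists, so that repetitions are
  located by index arithmetic. Only the values at indices up to \<open>n\<close> matter.\<close>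

definition nb_walk :: "'v ugraph \<Rightarrow> (nat \<Rightarrow> 'v) \<Rightarrow> nat \<Rightarrow> bool" where
  "nb_walk T f n \<longleftrightarrow> (\<forall>i<n. (f i, f (Suc i)) \<in> edges T) \<and> (\<forall>i. Suc (Suc i) \<le> n \<longrightarrow> f i \<noteq> f (Suc (Suc i)))"

context
  fixes T :: "'v ugraph"
  assumes tree: "tree_graph T"
begin

lemma edge_sym: "(x, y) \<in> edges T \<Longrightarrow> (y, x) \<in> edges T"
  using tree by (auto simp: tree_graph_def simple_graph_def dest: symD)

lemma edge_verts: "(x, y) \<in> edges T \<Longrightarrow> x \<in> verts T" "(x, y) \<in> edges T \<Longrightarrow> y \<in> verts T"
  using tree by (auto simp: tree_graph_def simple_graph_def)

lemma edge_neq: "(x, y) \<in> edges T \<Longrightarrow> x \<noteq> y"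
  using tree by (auto simp: tree_graph_def simple_graph_def irrefl_def)

lemma connected: "x \<in> verts T \<Longrightarrow> y \<in> verts T \<Longrightarrow> (x, y) \<in> (edges T)\<^sup>*"
  using tree by (auto simp: tree_graph_def)

lemma connected_pow: "x \<in> verts T \<Longrightarrow> y \<in> verts T \<Longrightarrow> \<exists>n. (x, y) \<in> edges T ^^ n"
  using connected by (auto simp: rtrancl_is_UN_relpow)

lemma no_cycle: "\<not> graph_cycle T c"
  using tree by (auto simp: tree_graph_def)

lemma gdist_pow:
  assumes "x \<in> verts T" "y \<in> verts T"
  shows "(x, y) \<in> edges T ^^ gdist T x y"
  unfolding gdist_def by (rule LeastI_ex) (rule connected_pow[OF assms])

lemma gdist_le: "(x, y) \<in> edges T ^^ n \<Longrightarrow> gdist T x y \<le> n"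
  unfolding gdist_def by (rule Least_le)

lemma gdist_self [simp]: "gdist T x x = 0"
  using gdist_le[of x x 0] by simp

lemma gdist_eq_0: "x \<in> verts T \<Longrightarrow> y \<in> verts T \<Longrightarrow> gdist T x y = 0 \<longleftrightarrow> x = y"
  using gdist_pow[of x y] by auto

lemma gdist_eq_1:
  assumes "x \<in> verts T" "y \<in> verts T"
  shows "gdist T x y = 1 \<longleftrightarrow> (x, y) \<in> edges T"
proof
  assume "gdist T x y = 1" with gdist_pow[OF assms] show "(x, y) \<in> edges T" by simp
next
  assume e: "(x, y) \<in> edges T"
  with gdist_le[of x y 1] have "gdist T x y \<le> 1" by simp
  moreover have "gdist T x y \<noteq> 0" using gdist_eq_0[OF assms] edge_neq[OF e] by simp
  ultimately show "gdist T x y = 1" by simp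
qed

lemma gsphere_1: "x \<in> verts T \<Longrightarrow> gsphere T x 1 = nbrs T x"
  using gdist_eq_1 edge_verts by (auto simp: gsphere_def)

lemma no_triangle: "(x, y) \<in> edges T \<Longrightarrow> (y, z) \<in> edges T \<Longrightarrow> (x, z) \<notin> edges T"
  using no_cycle[of "[x, y, z]"] edge_neq[of x y] edge_neq[of y z] edge_neq[of x z] edge_sym[of x z]
  by (auto simp: graph_cycle_def)

lemma no_square:
  "(x, y) \<in> edges T \<Longrightarrow> (y, z) \<in> edges T \<Longrightarrow> x \<noteq> z \<Longrightarrow> (x, t) \<in> edges T \<Longrightarrow> (t, z) \<in> edges T \<Longrightarrow> t = y"
  using no_cycle[of "[x, y, z, t]"] edge_neq edge_sym
  by (auto simp: graph_cycle_def)

text \<open>Coincidences among the five vertices degenerate to triangles or loops. The lemma later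
  excludes edges between leaves of a rooted tree of depth 2.\<close>

lemma no_pentagon:
  "(x, y) \<in> edges T \<Longrightarrow> (y, z) \<in> edges T \<Longrightarrow> (x, t) \<in> edges T \<Longrightarrow> (t, u) \<in> edges T \<Longrightarrow>
   z \<noteq> x \<Longrightarrow> u \<noteq> x \<Longrightarrow> (z, u) \<notin> edges T"
  using no_cycle[of "[x, y, z, u, t]"] edge_neq[of x y] edge_neq[of y z] edge_neq[of x t] edge_neq[of t u]
    edge_neq[of z u] edge_sym[of x t] edge_sym[of t u] no_triangle[of y z u] no_triangle[of x y z]
    no_triangle[of x t u] edge_sym[of z u]
  by (auto simp: graph_cycle_def)

lemma relpow_2: "(x, y) \<in> edges T ^^ 2 \<longleftrightarrow> (\<exists>z. (x, z) \<in> edges T \<and> (z, y) \<in> edges T)"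
  by (auto simp: numeral_2_eq_2)

text \<open>Trades the minimum over walks in \<open>gdist\<close> for neighbour sets, the form in
  which balls are used from here on.\<close>

lemma gball_2:
  assumes "x \<in> verts T"
  shows "gball T x 2 = insert x (nbrs T x \<union> (\<Union>y\<in>nbrs T x. nbrs T y))"
proof
  show "gball T x 2 \<subseteq> insert x (nbrs T x \<union> (\<Union>y\<in>nbrs T x. nbrs T y))"
  proof
    fix y assume y: "y \<in> gball T x 2"
    then have yv: "y \<in> verts T" and "gdist T x y \<le> 2" by (auto simp: gball_def)
    then consider "gdist T x y = 0" | "gdist T x y = 1" | "gdist T x y = 2" by linarith
    then show "y \<in> insert x (nbrs T x \<union> (\<Union>y\<in>nbrs T x. nbrs T y))"
      using gdist_pow[OF assms yv] by cases (auto simp: relpow_2)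
  qed
next
  show "insert x (nbrs T x \<union> (\<Union>y\<in>nbrs T x. nbrs T y)) \<subseteq> gball T x 2"
    using assms edge_verts gdist_le[of x _ 1] gdist_le[of x _ 2, unfolded relpow_2]
    by (force simp: gball_def)
qed

text \<open>Without triangles a neighbour of a neighbour is never a neighbour, so only the centre
  has to be removed.\<close>

lemma gsphere_2:
  assumes "x \<in> verts T"
  shows "gsphere T x 2 = (\<Union>y\<in>nbrs T x. nbrs T y) - {x}"
proof -
  have "gsphere T x 2 = gball T x 2 - insert x (nbrs T x)"
    using gdist_eq_1[OF assms] gdist_eq_0[OF assms] assms
    by (force simp: gball_def gsphere_def le_less numeral_2_eq_2 edge_verts)
  also have "\<dots> = (\<Union>y\<in>nbrs T x. nbrs T y) - {x}"
    unfolding gball_2[OF assms] using no_triangle by auto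
  finally show ?thesis .
qed

section \<open>Walks without backtracking and coverings of trees\<close>

text \<open>A repetition at minimal distance along the walk would close up to a cycle.\<close>

lemma nb_walk_inj:
  assumes "nb_walk T f n"
  shows "inj_on f {..n}"
proof (rule ccontr)
  assume "\<not> inj_on f {..n}"
  then have "\<exists>d i. 0 < d \<and> i + d \<le> n \<and> f i = f (i + d)"
    unfolding inj_on_def
    by (metis atMost_iff le_add_diff_inverse linorder_neqE_nat nat_less_le zero_less_diff)
  then obtain d where "\<exists>i. 0 < d \<and> i + d \<le> n \<and> f i = f (i + d)"
    and min: "\<And>d'. d' < d \<Longrightarrow> \<not> (\<exists>i. 0 < d' \<and> i + d' \<le> n \<and> f i = f (i + d'))"
    using exists_least_iff[of "\<lambda>d. \<exists>i. 0 < d \<and> i + d \<le> n \<and> f i = f (i + d)"] by blast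
  then obtain i where i: "0 < d" "i + d \<le> n" "f i = f (i + d)" by blast
  have e: "(f k, f (Suc k)) \<in> edges T" if "k < n" for k using assms that by (auto simp: nb_walk_def)
  have "d \<noteq> 1" using e[of i] edge_neq[of "f i" "f (Suc i)"] i by auto
  moreover have "d \<noteq> 2" using assms i by (auto simp: nb_walk_def)
  ultimately have d3: "3 \<le> d" using i by linarith
  define c where "c = map f [i..<i+d]"
  have "inj_on f {i..<i+d}"
  proof (rule linorder_inj_onI)
    fix x y assume "x < y" "x \<in> {i..<i+d}" "y \<in> {i..<i+d}"
    then have "y - x < d" "0 < y - x" "x + (y - x) \<le> n" "x + (y - x) = y" using i by auto
    then show "f x \<noteq> f y" using min[of "y - x"] by metis
  qed auto
  then have "distinct c" by (simp add: c_def distinct_map)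
  moreover have "successively (\<lambda>x y. (x, y) \<in> edges T) c"
    using e i by (auto simp: c_def successively_conv_nth)
  moreover have "last c = f (i + d - 1)" "hd c = f i" using i d3
    by (simp_all add: c_def last_conv_nth hd_conv_nth)
  moreover have "(f (i + d - 1), f i) \<in> edges T" using e[of "i+d-1"] i by simp
  ultimately have "graph_cycle T c" using d3 by (simp add: graph_cycle_def c_def)
  then show False using no_cycle by blast
qed

text \<open>A shortest walk cannot backtrack: cutting out a step forth and back would shorten it by
  two.\<close>

lemma nb_walk_ex:
  assumes "x \<in> verts T" "y \<in> verts T"
  obtains f where "nb_walk T f (gdist T x y)" "f 0 = x" "f (gdist T x y) = y"
proof -
  let ?n = "gdist T x y"
  obtain f where f: "f 0 = x" "f ?n = y" "\<And>i. i < ?n \<Longrightarrow> (f i, f (Suc i)) \<in> edges T"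
    using gdist_pow[OF assms] by (auto simp: relpow_fun_conv)
  have "f i \<noteq> f (Suc (Suc i))" if i: "Suc (Suc i) \<le> ?n" for i
  proof
    assume eq: "f i = f (Suc (Suc i))"
    have "(x, f i) \<in> edges T ^^ i"
      unfolding relpow_fun_conv using f i by (intro exI[of _ f]) auto
    moreover have "(f i, y) \<in> edges T ^^ (?n - Suc (Suc i))"
      unfolding relpow_fun_conv eq
    proof (intro exI[of _ "\<lambda>k. f (k + Suc (Suc i))"] conjI allI impI)
      fix k assume "k < ?n - Suc (Suc i)"
      then show "(f (k + Suc (Suc i)), f (Suc k + Suc (Suc i))) \<in> edges T" using f(3)[of "k + Suc (Suc i)"] by simp
    qed (use f(2) i in \<open>simp_all del: add_Suc_right\<close>)
    ultimately have "(x, y) \<in> edges T ^^ (i + (?n - Suc (Suc i)))"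
      unfolding relpow_add by (rule relcompI)
    then show False using gdist_le[of x y "i + (?n - Suc (Suc i))"] i by simp
  qed
  with f that show ?thesis by (auto simp: nb_walk_def)
qed

text \<open>A locally bijective endomorphism of a tree is a covering, hence an automorphism: it lifts
  paths, and it maps walks without backtracking to walks without backtracking.\<close>

lemma locally_bij_aut:
  assumes verts: "\<And>x. x \<in> verts T \<Longrightarrow> f x \<in> verts T"
    and bij: "\<And>x. x \<in> verts T \<Longrightarrow> bij_betw f (nbrs T x) (nbrs T (f x))"
    and outside: "\<And>x. x \<notin> verts T \<Longrightarrow> f x = x"
  shows "f \<in> graph_aut T"
proof -
  have hom: "(f x, f y) \<in> edges T" if "(x, y) \<in> edges T" for x y
    using bij_betwE[OF bij[of x]] that edge_verts by auto
  have inj: "inj_on f (verts T)"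
  proof
    fix x y assume xy: "x \<in> verts T" "y \<in> verts T" "f x = f y"
    obtain w where w: "nb_walk T w (gdist T x y)" "w 0 = x" "w (gdist T x y) = y"
      using nb_walk_ex[OF xy(1,2)] .
    have "nb_walk T (f \<circ> w) (gdist T x y)"
      unfolding nb_walk_def o_def
    proof (intro conjI allI impI)
      fix i assume "i < gdist T x y"
      then show "(f (w i), f (w (Suc i))) \<in> edges T" using w hom by (auto simp: nb_walk_def)
    next
      fix i assume i: "Suc (Suc i) \<le> gdist T x y"
      then have "(w (Suc i), w i) \<in> edges T" "(w (Suc i), w (Suc (Suc i))) \<in> edges T" "w i \<noteq> w (Suc (Suc i))"
        using w edge_sym by (auto simp: nb_walk_def)
      then show "f (w i) \<noteq> f (w (Suc (Suc i)))"
        using bij_betw_imp_inj_on[OF bij[of "w (Suc i)"]] edge_verts by (auto simp: inj_on_def)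
    qed
    then have "inj_on (f \<circ> w) {..gdist T x y}" by (rule nb_walk_inj)
    moreover have "(f \<circ> w) 0 = (f \<circ> w) (gdist T x y)" using w xy by simp
    ultimately have "gdist T x y = 0" by (force simp: inj_on_def)
    then show "x = y" using gdist_eq_0 xy by simp
  qed
  have "y \<in> f ` verts T" if "y \<in> verts T" for y
  proof -
    have "(f y, y) \<in> (edges T)\<^sup>*" using connected verts that by blast
    then show ?thesis
    proof (induction rule: rtrancl_induct)
      case base then show ?case using that by blast
    next
      case (step y z)
      then obtain x where x: "x \<in> verts T" "y = f x" by blast
      have "z \<in> nbrs T (f x)" using step(2) x by simp
      then obtain x' where "x' \<in> nbrs T x" "z = f x'"
        using bij_betw_imp_surj_on[OF bij[OF x(1)]] by blast
      then show ?case using edge_verts by auto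
    qed
  qed
  then have "bij_betw f (verts T) (verts T)" using inj verts by (auto simp: bij_betw_def)
  then have "f permutes verts T" using outside by (rule bij_imp_permutes)
  moreover have "(f x, f y) \<in> edges T \<longleftrightarrow> (x, y) \<in> edges T" if "x \<in> verts T" "y \<in> verts T" for x y
  proof
    assume "(f x, f y) \<in> edges T"
    then have "f y \<in> f ` nbrs T x"
      using bij_betw_imp_surj_on[OF bij[OF that(1)]] by simp
    then obtain z where "(x, z) \<in> edges T" "f z = f y" by auto
    then show "(x, y) \<in> edges T" using inj that edge_verts by (auto simp: inj_on_def)
  qed (rule hom)
  ultimately show ?thesis by (simp add: graph_aut_def)
qed

end

context
  fixes T :: "'v ugraph" and x0 :: 'v
  assumes tree: "tree_graph T" and x0: "x0 \<in> verts T"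
begin

text \<open>Otherwise the two geodesics from \<open>x0\<close> through \<open>y\<close> and \<open>y'\<close> would form a closed walk
  without backtracking.\<close>

lemma gdist_parent_unique:
  assumes e: "(x, y) \<in> edges T" "(x, y') \<in> edges T"
    and d: "gdist T x0 x = Suc m" "gdist T x0 y = m" "gdist T x0 y' = m"
  shows "y = y'"
proof (rule ccontr)
  assume ne: "y \<noteq> y'"
  have y: "y \<in> verts T" "y' \<in> verts T" using edge_verts[OF tree] e by auto
  obtain f where f: "nb_walk T f m" "f 0 = x0" "f m = y" using nb_walk_ex[OF tree x0 y(1)] d by metis
  obtain f' where f': "nb_walk T f' m" "f' 0 = x0" "f' m = y'" using nb_walk_ex[OF tree x0 y(2)] d by metis
  \<comment> \<open>Vertices on either geodesic are at distance at most \<open>m\<close> from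
    \<open>x0\<close>, hence differ from \<open>x\<close>, which is at distance
    \<open>m + 1\<close>.\<close>
  have le: "gdist T x0 (h i) \<le> i" if "nb_walk T h m" "h 0 = x0" "i \<le> m" for h i
  proof (rule gdist_le[OF tree])
    show "(x0, h i) \<in> edges T ^^ i"
      unfolding relpow_fun_conv using that by (intro exI[of _ h]) (auto simp: nb_walk_def)
  qed
  \<comment> \<open>Out along \<open>f\<close> to \<open>y\<close>, over \<open>x\<close> at index
    \<open>m + 1\<close>, and back from \<open>y'\<close> along the reversed \<open>f'\<close>;
    index \<open>2 * m + 2\<close> is \<open>x0\<close> again.\<close>
  define w where "w i = (if i \<le> m then f i else if i = Suc m then x else f' (2 * m + 2 - i))" for i
  have "nb_walk T w (2 * m + 2)"
    unfolding nb_walk_def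
  proof (intro conjI allI impI)
    fix i assume "i < 2 * m + 2"
    then consider "i < m" | "i = m" | "i = Suc m" | "Suc m < i" "i < 2 * m + 2" by linarith
    then show "(w i, w (Suc i)) \<in> edges T"
    proof cases
      case 1 then show ?thesis using f by (auto simp: w_def nb_walk_def)
    next
      case 2 then show ?thesis using f e edge_sym[OF tree] by (auto simp: w_def)
    next
      case 3 then show ?thesis using f' e by (auto simp: w_def)
    next
      case 4
      then have k: "2 * m + 1 - i < m" "2 * m + 2 - i = Suc (2 * m + 1 - i)" by auto
      have "(f' (2 * m + 1 - i), f' (Suc (2 * m + 1 - i))) \<in> edges T" using f' k(1) by (auto simp: nb_walk_def)
      then show ?thesis using 4 k edge_sym[OF tree] by (auto simp: w_def)
    qed
  next
    fix i assume "Suc (Suc i) \<le> 2 * m + 2"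
    then consider "Suc (Suc i) \<le> m" | "Suc i = m" | "i = m" | "i = Suc m" "1 \<le> m" | "Suc m < i" "i \<le> 2 * m" by linarith
    then show "w i \<noteq> w (Suc (Suc i))"
    proof cases
      case 1 then show ?thesis using f by (auto simp: w_def nb_walk_def)
    next
      case 2
      then have "f i \<noteq> x" using le[OF f(1,2), of i] d by auto
      with 2 show ?thesis by (auto simp: w_def)
    next
      case 3 then show ?thesis using f f' ne by (auto simp: w_def)
    next
      case 4
      have "f' (m - 1) \<noteq> x" using le[OF f'(1,2), of "m - 1"] d by auto
      moreover have "2 * m + 2 - Suc (Suc i) = m - 1" using 4 by simp
      ultimately show ?thesis using 4 by (auto simp: w_def)
    next
      case 5
      then have k: "Suc (Suc (2 * m - i)) \<le> m" "2 * m + 2 - i = Suc (Suc (2 * m - i))" by auto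
      have "f' (2 * m - i) \<noteq> f' (Suc (Suc (2 * m - i)))" using f' k(1) by (auto simp: nb_walk_def)
      then show ?thesis using 5 k by (auto simp: w_def)
    qed
  qed
  then have "inj_on w {..2 * m + 2}" by (rule nb_walk_inj[OF tree])
  moreover have "w 0 = w (2 * m + 2)" using f f' by (simp add: w_def)
  ultimately show False by (force simp: inj_on_def)
qed

end

section \<open>Parity of recolored bijections\<close>

text \<open>\<open>local_perm\<close> for an arbitrary set and an arbitrary map, so that a bijection
  of spheres has a parity before it is part of an automorphism.\<close>

definition recolor :: "('a \<Rightarrow> nat) \<Rightarrow> 'a set \<Rightarrow> ('a \<Rightarrow> 'a) \<Rightarrow> nat \<Rightarrow> nat" where
  "recolor j S \<beta> = restrict_id (j \<circ> \<beta> \<circ> inv_into S j) (j ` S)"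

lemma local_perm_recolor: "local_perm T j g x = recolor j (gsphere T x 1) g"
  by (simp add: local_perm_def recolor_def)

lemma recolor_cong: "(\<And>x. x \<in> S \<Longrightarrow> \<beta> x = \<beta>' x) \<Longrightarrow> recolor j S \<beta> = recolor j S \<beta>'"
  by (auto simp: recolor_def restrict_id_def inv_into_into fun_eq_iff)

lemma recolor_apply: "inj_on j S \<Longrightarrow> x \<in> S \<Longrightarrow> recolor j S \<beta> (j x) = j (\<beta> x)"
  by (simp add: recolor_def)

lemma recolor_outside: "c \<notin> j ` S \<Longrightarrow> recolor j S \<beta> c = c"
  by (simp add: recolor_def)

lemma recolor_permutes:
  assumes "bij_betw j S C" "bij_betw \<beta> S S'" "bij_betw j S' C"
  shows "recolor j S \<beta> permutes C"
proof -
  have "bij_betw (j \<circ> \<beta> \<circ> inv_into S j) C C"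
    using assms by (meson bij_betw_inv_into bij_betw_trans)
  then have "bij_betw (recolor j S \<beta>) C C"
    using assms(1) by (subst bij_betw_cong[where g = "j \<circ> \<beta> \<circ> inv_into S j"]) (auto simp: recolor_def bij_betw_def)
  then show ?thesis
    by (rule bij_imp_permutes) (use assms(1) recolor_outside in \<open>auto simp: bij_betw_def\<close>)
qed

lemma recolor_comp:
  assumes "bij_betw j S C" "bij_betw \<beta> S S'" "bij_betw j S' C"
  shows "recolor j S (\<beta>' \<circ> \<beta>) = recolor j S' \<beta>' \<circ> recolor j S \<beta>"
proof
  fix c
  show "recolor j S (\<beta>' \<circ> \<beta>) c = (recolor j S' \<beta>' \<circ> recolor j S \<beta>) c"
  proof (cases "c \<in> C")
    case True
    then obtain x where x: "x \<in> S" "c = j x" using assms(1) by (auto simp: bij_betw_def)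
    have "\<beta> x \<in> S'" using x assms(2) by (auto simp: bij_betw_def)
    then show ?thesis using x assms by (simp add: recolor_apply bij_betw_def)
  next
    case False
    then show ?thesis using assms by (simp add: recolor_outside bij_betw_def)
  qed
qed

lemma recolor_id: "inj_on j S \<Longrightarrow> recolor j S id = id"
  by (auto simp: recolor_def restrict_id_def fun_eq_iff)

text \<open>Parity is a cocycle: the colors of the intermediate set \<open>S'\<close> cancel, and
  the second factor is evaluated there rather than on \<open>S\<close>.\<close>

lemma evenperm_recolor_comp:
  assumes "bij_betw j S C" "bij_betw \<beta> S S'" "bij_betw j S' C" "bij_betw \<beta>' S' S''" "bij_betw j S'' C" "finite C"
  shows "evenperm (recolor j S (\<beta>' \<circ> \<beta>)) \<longleftrightarrow> (evenperm (recolor j S \<beta>) \<longleftrightarrow> evenperm (recolor j S' \<beta>'))"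
proof -
  have "permutation (recolor j S \<beta>)" "permutation (recolor j S' \<beta>')"
    using recolor_permutes assms by (metis permutation_permutes)+
  then show ?thesis
    unfolding recolor_comp[OF assms(1-3)] by (simp add: evenperm_comp eq_commute)
qed

lemma recolor_transpose:
  assumes "bij_betw j S C" "a \<in> S" "b \<in> S"
  shows "recolor j S (Transposition.transpose a b) = Transposition.transpose (j a) (j b)"
proof
  fix c
  have inj: "inj_on j S" and C: "j ` S = C" using assms by (auto simp: bij_betw_def)
  show "recolor j S (Transposition.transpose a b) c = Transposition.transpose (j a) (j b) c"
  proof (cases "c \<in> C")
    case True
    then obtain x where x: "x \<in> S" "c = j x" using C by blast
    have "j x = j a \<longleftrightarrow> x = a" "j x = j b \<longleftrightarrow> x = b" using inj x assms by (auto simp: inj_on_def)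
    then show ?thesis using x by (auto simp: recolor_apply[OF inj] transpose_def)
  next
    case False
    then have "c \<noteq> j a" "c \<noteq> j b" using C assms by auto
    then show ?thesis using C False by (auto simp: recolor_outside transpose_def)
  qed
qed

text \<open>Precomposing with the transposition of \<open>a\<close> and \<open>b\<close> flips the
  sign and changes no other value.\<close>

lemma bij_with_parity:
  assumes "bij_betw j S C" "bij_betw \<beta> S S'" "bij_betw j S' C" "finite C" "a \<in> S" "b \<in> S" "a \<noteq> b"
  obtains \<beta>' where "bij_betw \<beta>' S S'" "\<And>x. x \<noteq> a \<Longrightarrow> x \<noteq> b \<Longrightarrow> \<beta>' x = \<beta> x"
    "evenperm (recolor j S \<beta>') \<longleftrightarrow> e"
proof (cases "evenperm (recolor j S \<beta>) \<longleftrightarrow> e")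
  case True
  then show ?thesis using that assms by blast
next
  case False
  have t: "bij_betw (Transposition.transpose a b) S S" using assms by (simp add: permutes_imp_bij permutes_swap_id)
  have "j a \<noteq> j b" using assms by (auto simp: bij_betw_def inj_on_def)
  then have "\<not> evenperm (recolor j S (Transposition.transpose a b))"
    using recolor_transpose[OF assms(1,5,6)] by (simp add: evenperm_swap)
  then have "evenperm (recolor j S (\<beta> \<circ> Transposition.transpose a b)) \<longleftrightarrow> e"
    using False evenperm_recolor_comp[OF assms(1) t assms(1,2,3,4)] by blast
  moreover have "bij_betw (\<beta> \<circ> Transposition.transpose a b) S S'" using t assms(2) by (rule bij_betw_trans)
  ultimately show ?thesis by (intro that[of "\<beta> \<circ> Transposition.transpose a b"]) (auto simp: transpose_def)
qed

text \<open>An arbitrary bijection is corrected by two transpositions of the target. The second one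
  does not move \<open>r'\<close>, as it exchanges two elements different from
  \<open>r'\<close>.\<close>

lemma bij_with_values:
  assumes "finite S" "finite S'" "card S = card S'" "r \<in> S" "u \<in> S" "r \<noteq> u" "r' \<in> S'" "u' \<in> S'" "r' \<noteq> u'"
  obtains \<beta> where "bij_betw \<beta> S S'" "\<beta> r = r'" "\<beta> u = u'"
proof -
  obtain \<beta> where b: "bij_betw \<beta> S S'" using assms finite_same_card_bij by blast
  define \<beta>1 where "\<beta>1 = Transposition.transpose (\<beta> r) r' \<circ> \<beta>"
  have "\<beta> r \<in> S'" using b assms by (auto simp: bij_betw_def)
  then have b1: "bij_betw \<beta>1 S S'"
    unfolding \<beta>1_def using assms by (intro bij_betw_trans[OF b]) (simp add: permutes_imp_bij permutes_swap_id)
  have r1: "\<beta>1 r = r'" by (simp add: \<beta>1_def)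
  define \<beta>2 where "\<beta>2 = Transposition.transpose (\<beta>1 u) u' \<circ> \<beta>1"
  have u1: "\<beta>1 u \<in> S'" using b1 assms by (auto simp: bij_betw_def)
  then have b2: "bij_betw \<beta>2 S S'"
    unfolding \<beta>2_def using assms by (intro bij_betw_trans[OF b1]) (simp add: permutes_imp_bij permutes_swap_id)
  have "\<beta>1 u \<noteq> r'" using b1 r1 assms by (auto simp: bij_betw_def inj_on_def)
  then have "\<beta>2 r = r'" "\<beta>2 u = u'" using r1 assms by (auto simp: \<beta>2_def transpose_def)
  with b2 that show ?thesis by blast
qed

text \<open>A permutation of three colors with a fixed color is the identity or a transposition, so
  a single further color reveals its sign.\<close>

lemma evenperm_recolor_3:
  assumes "bij_betw j S {1..3}" "bij_betw \<beta> S S'" "bij_betw j S' {1..3}"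
    and "r \<in> S" "j (\<beta> r) = j r" "w \<in> S" "w \<noteq> r"
  shows "evenperm (recolor j S \<beta>) \<longleftrightarrow> j (\<beta> w) = j w"
proof -
  let ?p = "recolor j S \<beta>"
  have inj: "inj_on j S" using assms by (auto simp: bij_betw_def)
  have p: "?p permutes {1..3}" using recolor_permutes assms by blast
  then have injp: "inj ?p" by (rule permutes_inj)
  have C: "j r \<in> {1..3}" "j w \<in> {1..3}" "j r \<noteq> j w"
    using bij_betwE[OF assms(1)] inj_onD[OF inj, of r w] assms(4,6,7) by metis+
  have pr: "?p (j r) = j r" and pw: "?p (j w) = j (\<beta> w)"
    using recolor_apply[OF inj] assms(4,5,6) by metis+
  have pin: "?p x \<in> {1..3}" if "x \<in> {1..3}" for x using permutes_in_image[OF p] that by blast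
  have "card ({1..3} - {j r, j w}) = 1" using C by (subst card_Diff_subset) auto
  then obtain c where c: "{1..3} - {j r, j w} = {c}" by (auto simp: card_1_singleton_iff)
  have full: "x = j r \<or> x = j w \<or> x = c" if "x \<in> {1..3}" for x using c that by blast
  have cC: "c \<in> {1..3}" "c \<noteq> j r" "c \<noteq> j w" using c by blast+
  have out: "?p x = x" if "x \<notin> {1..3}" for x using p that by (rule permutes_not_in)
  have "?p c \<noteq> j r" "?p (j w) \<noteq> j r" using injp pr cC C by (metis injD)+
  then have pc: "?p c = j w \<or> ?p c = c" and pw': "?p (j w) = j w \<or> ?p (j w) = c"
    using full pin cC C by blast+
  have ne: "?p c \<noteq> ?p (j w)" using injp cC by (metis injD)
  show ?thesis
  proof (cases "j (\<beta> w) = j w")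
    case True
    have "?p c = c" using ne pc pw True by metis
    have "?p x = x" for x
    proof (cases "x \<in> {1..3}")
      case True
      with full \<open>?p c = c\<close> pr pw \<open>j (\<beta> w) = j w\<close> show ?thesis by metis
    qed (rule out)
    then have "?p = id" by auto
    then show ?thesis using True by simp
  next
    case False
    have 1: "?p (j w) = c" using pw pw' False by metis
    then have 2: "?p c = j w" using ne pc by metis
    have "?p x = Transposition.transpose (j w) c x" for x
    proof (cases "x \<in> {1..3}")
      case True
      with full consider "x = j r" | "x = j w" | "x = c" by blast
      then show ?thesis using 1 2 pr C cC by cases (simp_all add: transpose_def)
    next
      case False
      then have "x \<noteq> j w" "x \<noteq> c" using C(2) cC(1) by metis+
      then show ?thesis using out[OF False] by simp
    qed
    then have "?p = Transposition.transpose (j w) c" by auto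
    then show ?thesis using False cC by (simp add: evenperm_swap)
  qed
qed

lemma two_elements:
  assumes "2 \<le> card S"
  obtains a b where "a \<in> S" "b \<in> S" "a \<noteq> b"
proof -
  obtain A where "A \<subseteq> S" "card A = 2" using obtain_subset_with_card_n[OF assms] by metis
  then obtain a b where "A = {a, b}" "a \<noteq> b" by (auto simp: card_2_iff)
  with \<open>A \<subseteq> S\<close> that show ?thesis by blast
qed

lemma bij_with_parity_on:
  assumes "bij_betw j S C" "bij_betw \<beta> S S'" "bij_betw j S' C" "finite C" "2 \<le> card (S - X)"
  obtains \<beta>' where "bij_betw \<beta>' S S'" "\<And>x. x \<in> X \<Longrightarrow> \<beta>' x = \<beta> x"
    "evenperm (recolor j S \<beta>') \<longleftrightarrow> e"
proof -
  obtain a b where ab: "a \<in> S - X" "b \<in> S - X" "a \<noteq> b" using two_elements[OF assms(5)] .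
  then have "a \<in> S" "b \<in> S" by auto
  from bij_with_parity[OF assms(1-4) this ab(3)]
  obtain \<beta>' where "bij_betw \<beta>' S S'" "\<And>x. x \<noteq> a \<Longrightarrow> x \<noteq> b \<Longrightarrow> \<beta>' x = \<beta> x"
    "evenperm (recolor j S \<beta>') \<longleftrightarrow> e" by metis
  with ab that show ?thesis by (metis DiffE)
qed

section \<open>Automorphisms and rooted trees\<close>

lemma graph_aut_verts: "g \<in> graph_aut T \<Longrightarrow> x \<in> verts T \<Longrightarrow> g x \<in> verts T"
  by (simp add: graph_aut_def permutes_in_image)

lemma graph_aut_bij: "g \<in> graph_aut T \<Longrightarrow> bij g"
  by (auto simp: graph_aut_def permutes_bij)

lemma graph_aut_inj: "g \<in> graph_aut T \<Longrightarrow> g x = g y \<longleftrightarrow> x = y"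
  using graph_aut_bij bij_is_inj inj_eq by metis

lemma graph_aut_outside: "g \<in> graph_aut T \<Longrightarrow> x \<notin> verts T \<Longrightarrow> g x = x"
  by (auto simp: graph_aut_def dest: permutes_not_in)

lemma graph_aut_id: "id \<in> graph_aut T"
  by (simp add: graph_aut_def permutes_id)

lemma graph_aut_comp: "g \<in> graph_aut T \<Longrightarrow> h \<in> graph_aut T \<Longrightarrow> g \<circ> h \<in> graph_aut T"
  by (auto simp: graph_aut_def permutes_compose permutes_in_image)

lemma graph_aut_inverse:
  assumes "g \<in> graph_aut T"
  obtains g' where "g' \<in> graph_aut T" "g' \<circ> g = id" "g \<circ> g' = id"
proof
  let ?g = "inv_into UNIV g"
  have p: "g permutes verts T" using assms by (simp add: graph_aut_def)
  show "?g \<circ> g = id" "g \<circ> ?g = id" using permutes_inv_o[OF p] by auto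
  have "(?g x, ?g y) \<in> edges T \<longleftrightarrow> (x, y) \<in> edges T" if "x \<in> verts T" "y \<in> verts T" for x y
  proof -
    have "?g x \<in> verts T" "?g y \<in> verts T" using permutes_in_image[OF permutes_inv[OF p]] that by auto
    moreover have "g (?g x) = x" "g (?g y) = y" using permutes_inverses(1)[OF p] by auto
    ultimately show ?thesis using assms by (force simp: graph_aut_def)
  qed
  then show "?g \<in> graph_aut T" using permutes_inv[OF p] by (simp add: graph_aut_def)
qed

context
  fixes T :: "'v ugraph"
  assumes tree: "tree_graph T"
begin

lemma graph_aut_edge: "g \<in> graph_aut T \<Longrightarrow> (x, y) \<in> edges T \<Longrightarrow> (g x, g y) \<in> edges T"
  using edge_verts[OF tree, of x y] by (auto simp: graph_aut_def)

lemma graph_aut_nbrs: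
  assumes g: "g \<in> graph_aut T" and x: "x \<in> verts T"
  shows "bij_betw g (nbrs T x) (nbrs T (g x))"
proof -
  obtain g' where g': "g' \<in> graph_aut T" "g' \<circ> g = id" "g \<circ> g' = id" using graph_aut_inverse[OF g] .
  have "y \<in> g ` nbrs T x" if "y \<in> nbrs T (g x)" for y
  proof
    show "y = g (g' y)" using g'(3) by (simp add: fun_eq_iff)
    have "(g' (g x), g' y) \<in> edges T" using that graph_aut_edge[OF g'(1)] by simp
    then show "g' y \<in> nbrs T x" using g'(2) by (simp add: fun_eq_iff)
  qed
  moreover have "inj_on g (nbrs T x)" using graph_aut_inj[OF g] by (simp add: inj_on_def)
  ultimately show ?thesis using graph_aut_edge[OF g] by (auto simp: bij_betw_def)
qed

lemma graph_aut_gball: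
  assumes "g \<in> graph_aut T" "x \<in> verts T"
  shows "bij_betw g (gball T x 2) (gball T (g x) 2)"
proof -
  have "g ` gball T x 2 = gball T (g x) 2"
  proof -
    have *: "g ` nbrs T y = nbrs T (g y)" if "y \<in> verts T" for y
      using bij_betw_imp_surj_on[OF graph_aut_nbrs[OF assms(1) that]] .
    have "(\<Union>y\<in>nbrs T x. g ` nbrs T y) = (\<Union>y\<in>nbrs T x. nbrs T (g y))"
      using * edge_verts[OF tree] by (intro SUP_cong) auto
    also have "\<dots> = (\<Union>z\<in>g ` nbrs T x. nbrs T z)" by simp
    finally show ?thesis
      unfolding gball_2[OF tree assms(2)] gball_2[OF tree graph_aut_verts[OF assms]]
      using *[OF assms(2)] by (simp only: image_insert image_Un image_UN)
  qed
  moreover have "inj_on g (gball T x 2)" using graph_aut_inj[OF assms(1)] by (simp add: inj_on_def)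
  ultimately show ?thesis by (simp add: bij_betw_def)
qed

end

lemma rooted_aut_id: "id \<in> rooted_aut T r"
  by (simp add: rooted_aut_def graph_aut_id)

lemma rooted_aut_comp: "g \<in> rooted_aut T r \<Longrightarrow> h \<in> rooted_aut T r \<Longrightarrow> g \<circ> h \<in> rooted_aut T r"
  by (simp add: rooted_aut_def graph_aut_comp)

lemma rooted_aut_inverse:
  assumes "g \<in> rooted_aut T r"
  obtains g' where "g' \<in> rooted_aut T r" "g' \<circ> g = id" "g \<circ> g' = id"
proof -
  have g: "g \<in> graph_aut T" "g r = r" using assms by (simp_all add: rooted_aut_def)
  obtain g' where "g' \<in> graph_aut T" "g' \<circ> g = id" "g \<circ> g' = id" using graph_aut_inverse[OF g(1)] .
  moreover have "g' r = r" using g(2) calculation(2) by (metis comp_apply id_apply)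
  ultimately show ?thesis using that by (simp add: rooted_aut_def)
qed

context
  fixes T :: "'a ugraph" and r :: 'a and e :: nat
  assumes rooted: "rooted_tree_4_2 T r e"
begin

lemma rooted_tree: "tree_graph T" and root_vert: "r \<in> verts T"
  using rooted by (simp_all add: rooted_tree_4_2_def)

lemma root_nbrs: "gsphere T r 1 = nbrs T r"
  using gsphere_1[OF rooted_tree root_vert] .

lemma child_nbrs: "p \<in> nbrs T r \<Longrightarrow> gsphere T p 1 = nbrs T p"
  using gsphere_1[OF rooted_tree] edge_verts[OF rooted_tree] by simp

lemma root_gball_1: "gball T r 1 = insert r (nbrs T r)"
proof -
  have "gball T r 1 = insert r (gsphere T r 1)"
    using gdist_eq_0[OF rooted_tree root_vert] root_vert gdist_self[OF rooted_tree]
    by (auto simp: gball_def gsphere_def le_Suc_eq)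
  then show ?thesis by (simp only: root_nbrs)
qed

lemma rooted_verts: "verts T = insert r (nbrs T r \<union> (\<Union>p\<in>nbrs T r. nbrs T p))"
  using rooted gball_2[OF rooted_tree root_vert] by (simp add: rooted_tree_4_2_def)

lemma rooted_vert_cases [consumes 1, case_names root child leaf]:
  assumes "x \<in> verts T"
  obtains "x = r" | "x \<in> nbrs T r" | p where "p \<in> nbrs T r" "x \<in> nbrs T p" "x \<noteq> r"
proof -
  have "x \<in> insert r (nbrs T r \<union> (\<Union>p\<in>nbrs T r. nbrs T p))"
    using assms by (simp only: rooted_verts)
  then show ?thesis using that by blast
qed

lemma finite_card_root_nbrs: "finite (nbrs T r)" "card (nbrs T r) = 4"
  using rooted root_nbrs by (simp_all add: rooted_tree_4_2_def)

lemma root_in_child_nbrs: "p \<in> nbrs T r \<Longrightarrow> r \<in> nbrs T p"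
  using edge_sym[OF rooted_tree] by simp

lemma finite_child_nbrs: "p \<in> nbrs T r \<Longrightarrow> finite (nbrs T p)"
  using rooted root_nbrs child_nbrs unfolding rooted_tree_4_2_def by (metis finite_Diff2 finite.emptyI finite_insert)

lemma card_child_nbrs: "p \<in> nbrs T r \<Longrightarrow> card (nbrs T p) = Suc (e - 1)"
  using rooted card_Suc_Diff1[OF finite_child_nbrs root_in_child_nbrs, of p]
  unfolding rooted_tree_4_2_def root_nbrs by (metis child_nbrs)

lemma finite_rooted_verts: "finite (verts T)"
  unfolding rooted_verts using finite_card_root_nbrs finite_child_nbrs by blast

lemma parent_unique: "p \<in> nbrs T r \<Longrightarrow> q \<in> nbrs T r \<Longrightarrow> w \<in> nbrs T p \<Longrightarrow> w \<in> nbrs T q \<Longrightarrow> w \<noteq> r \<Longrightarrow> p = q"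
  using no_square[OF rooted_tree, of r q w p] by auto

lemma leaf_not_child: "p \<in> nbrs T r \<Longrightarrow> w \<in> nbrs T p \<Longrightarrow> w \<notin> nbrs T r"
  using no_triangle[OF rooted_tree, of r p w] by auto

text \<open>The depth bound enters here: every vertex is the root, a child or a leaf, and in each
  case a neighbour of \<open>w\<close> other than \<open>p\<close> would close a triangle, a square
  or a (possibly degenerate) pentagon.\<close>

lemma leaf_nbrs:
  assumes "p \<in> nbrs T r" "w \<in> nbrs T p" "w \<noteq> r"
  shows "nbrs T w = {p}"
proof (intro equalityI subsetI)
  fix z assume z: "z \<in> nbrs T w"
  then have "z \<in> verts T" using edge_verts[OF rooted_tree] by auto
  then show "z \<in> {p}"
  proof (cases rule: rooted_vert_cases)
    case root
    then show ?thesis using z leaf_not_child[OF assms(1,2)] edge_sym[OF rooted_tree] by auto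
  next
    case child
    then show ?thesis using parent_unique[OF assms(1) child assms(2) _ assms(3)] z edge_sym[OF rooted_tree, of w z] by auto
  next
    case (leaf q)
    then show ?thesis using no_pentagon[OF rooted_tree, of r p w q z] assms z by auto
  qed
next
  fix z assume "z \<in> {p}" then show "z \<in> nbrs T w" using assms edge_sym[OF rooted_tree] by auto
qed

lemma gsphere_root_2: "gsphere T r 2 = (\<Union>p\<in>nbrs T r. nbrs T p) - {r}"
  using gsphere_2[OF rooted_tree root_vert] .

text \<open>The permutation of the children and the bijections below them can be chosen
  independently. Each sphere around a child contains the root, which is why every
  \<open>\<beta> p\<close> has to fix it.\<close>

lemma rooted_aut_exists:
  assumes \<pi>: "bij_betw \<pi> (nbrs T r) (nbrs T r)"
    and \<beta>: "\<And>p. p \<in> nbrs T r \<Longrightarrow> bij_betw (\<beta> p) (nbrs T p) (nbrs T (\<pi> p))"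
    and \<beta>r: "\<And>p. p \<in> nbrs T r \<Longrightarrow> \<beta> p r = r"
  obtains h where "h \<in> rooted_aut T r" "\<And>p. p \<in> nbrs T r \<Longrightarrow> h p = \<pi> p"
    "\<And>p w. p \<in> nbrs T r \<Longrightarrow> w \<in> nbrs T p \<Longrightarrow> h w = \<beta> p w"
proof -
  define par where "par w = (THE p. p \<in> nbrs T r \<and> w \<in> nbrs T p)" for w
  have par: "par w = p" if "p \<in> nbrs T r" "w \<in> nbrs T p" "w \<noteq> r" for p w
    unfolding par_def using that parent_unique by (intro the_equality) auto
  define h where "h w = (if w = r then r else if w \<in> nbrs T r then \<pi> w else
    if w \<in> verts T then \<beta> (par w) w else w)" for w
  have rr: "r \<notin> nbrs T r" using edge_neq[OF rooted_tree] by auto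
  have hr: "h r = r" by (simp add: h_def)
  have hp: "h p = \<pi> p" if "p \<in> nbrs T r" for p using that rr by (auto simp: h_def)
  have hw: "h w = \<beta> p w" if "p \<in> nbrs T r" "w \<in> nbrs T p" for p w
  proof (cases "w = r")
    case False
    moreover have "w \<in> verts T" using that rooted_verts by blast
    ultimately show ?thesis using that par[OF that False] leaf_not_child[OF that] by (simp add: h_def)
  qed (use hr \<beta>r that in simp)
  have \<pi>in: "\<pi> p \<in> nbrs T r" if "p \<in> nbrs T r" for p using \<pi> that by (auto simp: bij_betw_def)
  have \<beta>in: "\<beta> p w \<in> nbrs T (\<pi> p)" if "p \<in> nbrs T r" "w \<in> nbrs T p" for p w
    using bij_betwE[OF \<beta>] that by blast
  have \<beta>ne: "\<beta> p w \<noteq> r" if "p \<in> nbrs T r" "w \<in> nbrs T p" "w \<noteq> r" for p w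
    using inj_onD[OF bij_betw_imp_inj_on[OF \<beta>], of p w r] \<beta>r[OF that(1)] that root_in_child_nbrs[OF that(1)] by auto
  have "h \<in> graph_aut T"
  proof (rule locally_bij_aut[OF rooted_tree])
    fix x assume x: "x \<in> verts T"
    then have "h x \<in> verts T \<and> bij_betw h (nbrs T x) (nbrs T (h x))"
    proof (cases rule: rooted_vert_cases)
      case root
      have "bij_betw h (nbrs T r) (nbrs T r) \<longleftrightarrow> bij_betw \<pi> (nbrs T r) (nbrs T r)"
        using hp by (intro bij_betw_cong) auto
      with \<pi> hr root x show ?thesis by simp
    next
      case child
      have "bij_betw h (nbrs T x) (nbrs T (\<pi> x)) \<longleftrightarrow> bij_betw (\<beta> x) (nbrs T x) (nbrs T (\<pi> x))"
        using hw[OF child] by (intro bij_betw_cong) auto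
      then show ?thesis using \<beta>[OF child] hp[OF child] \<pi>in[OF child] rooted_verts by auto
    next
      case (leaf p)
      have "nbrs T (h x) = {\<pi> p}"
        using leaf_nbrs[OF \<pi>in \<beta>in \<beta>ne] leaf hw by auto
      moreover have "nbrs T x = {p}" using leaf_nbrs leaf by blast
      moreover have "h x \<in> verts T" using hw[OF leaf(1,2)] \<beta>in[OF leaf(1,2)] \<pi>in[OF leaf(1)] rooted_verts by auto
      ultimately show ?thesis using hp[OF leaf(1)] by (simp add: bij_betw_def)
    qed
    then show "h x \<in> verts T" "bij_betw h (nbrs T x) (nbrs T (h x))" by auto
  qed (use root_vert rooted_verts in \<open>auto simp: h_def\<close>)
  then show ?thesis using hr hp hw that by (simp add: rooted_aut_def)
qed

lemma rooted_aut_eqI: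
  assumes "h \<in> rooted_aut T r" "h' \<in> rooted_aut T r"
    and "\<And>p. p \<in> nbrs T r \<Longrightarrow> h p = h' p"
    and "\<And>p w. p \<in> nbrs T r \<Longrightarrow> w \<in> nbrs T p \<Longrightarrow> w \<noteq> r \<Longrightarrow> h w = h' w"
  shows "h = h'"
proof
  fix x
  have "h r = h' r" using assms by (simp add: rooted_aut_def)
  moreover have "h x = h' x" if "x \<notin> verts T"
    using assms(1,2) that graph_aut_outside[of h T x] graph_aut_outside[of h' T x] by (simp add: rooted_aut_def)
  moreover have "h x = h' x" if "x \<in> verts T"
    using that calculation(1) assms(3,4) by (cases rule: rooted_vert_cases) auto
  ultimately show "h x = h' x" by blast
qed

lemma rooted_aut_root: "h \<in> rooted_aut T r \<Longrightarrow> h r = r"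
  by (simp add: rooted_aut_def)

lemma rooted_aut_root_nbrs: "h \<in> rooted_aut T r \<Longrightarrow> bij_betw h (nbrs T r) (nbrs T r)"
  using graph_aut_nbrs[OF rooted_tree _ root_vert, of h] by (simp add: rooted_aut_def)

lemma rooted_aut_child: "h \<in> rooted_aut T r \<Longrightarrow> p \<in> nbrs T r \<Longrightarrow> h p \<in> nbrs T r"
  using bij_betwE[OF rooted_aut_root_nbrs] by blast

lemma rooted_aut_child_nbrs: "h \<in> rooted_aut T r \<Longrightarrow> p \<in> nbrs T r \<Longrightarrow> bij_betw h (nbrs T p) (nbrs T (h p))"
  using graph_aut_nbrs[OF rooted_tree] rooted_verts by (auto simp: rooted_aut_def)

lemma rooted_aut_leaf:
  "h \<in> rooted_aut T r \<Longrightarrow> p \<in> nbrs T r \<Longrightarrow> w \<in> nbrs T p \<Longrightarrow> h w \<in> nbrs T (h p)"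
  using bij_betwE[OF rooted_aut_child_nbrs] by blast

lemma rooted_aut_neq_root: "h \<in> rooted_aut T r \<Longrightarrow> w \<noteq> r \<Longrightarrow> h w \<noteq> r"
  using graph_aut_inj[of h T w r] by (auto simp: rooted_aut_def)

end

section \<open>Two-transitivity of \<open>SL(2,3)\<close> on lines\<close>

lemma three_cases: "(x :: 3) = 0 \<or> x = 1 \<or> x = -1"
proof -
  have "(0::3) \<noteq> 1" "(0::3) \<noteq> -1" "(1::3) \<noteq> -1" by simp_all
  then have "card {0, 1, -1 :: 3} = 3" by simp
  then have "card {0, 1, -1 :: 3} = card (UNIV :: 3 set)" by simp
  then have "{0, 1, -1 :: 3} = UNIV" by (intro card_subset_eq) auto
  then show ?thesis by blast
qed

text \<open>Every nonzero element is its own inverse; this replaces division in all computations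
  below.\<close>

lemma three_square: "(x :: 3) \<noteq> 0 \<Longrightarrow> x * x = 1"
  using three_cases[of x] by auto

text \<open>The determinant of the matrix with columns \<open>u\<close> and
  \<open>w\<close>.\<close>

definition vdet :: "3^2 \<Rightarrow> 3^2 \<Rightarrow> 3" where
  "vdet u w = u $ 1 * w $ 2 - u $ 2 * w $ 1"

text \<open>The symmetric form used in \<open>vector_labelling\<close>; for nonzero vectors it says
  that both span the same line.\<close>

definition proportional :: "3^2 \<Rightarrow> 3^2 \<Rightarrow> bool" where
  "proportional u w \<longleftrightarrow> (\<exists>c. u = c *s w) \<and> (\<exists>c. w = c *s u)"

text \<open>The factor is the quotient of \<open>w\<close> by \<open>u\<close> at a coordinate where
  \<open>u\<close> does not vanish, written as a product because that coordinate is its own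
  inverse.\<close>

lemma vdet_0_scale:
  assumes "vdet u w = 0" "u \<noteq> 0"
  shows "\<exists>c. w = c *s u"
proof -
  have eq: "u $ 1 * w $ 2 = u $ 2 * w $ 1" using assms by (simp add: vdet_def)
  consider "u $ 1 \<noteq> 0" | "u $ 2 \<noteq> 0" using assms(2) by (auto simp: vec_eq_iff forall_2)
  then show ?thesis
  proof cases
    case 1
    have "w $ 2 = (u $ 1 * u $ 1) * w $ 2" using three_square[OF 1] by simp
    also have "\<dots> = u $ 1 * (u $ 1 * w $ 2)" by (simp only: mult.assoc)
    also have "\<dots> = (w $ 1 * u $ 1) * u $ 2" unfolding eq by (simp only: mult_ac)
    finally have "w = (w $ 1 * u $ 1) *s u"
      using three_square[OF 1] by (simp add: vec_eq_iff forall_2 mult.assoc)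
    then show ?thesis by blast
  next
    case 2
    have "w $ 1 = (u $ 2 * u $ 2) * w $ 1" using three_square[OF 2] by simp
    also have "\<dots> = u $ 2 * (u $ 2 * w $ 1)" by (simp only: mult.assoc)
    also have "\<dots> = (w $ 2 * u $ 2) * u $ 1" unfolding eq[symmetric] by (simp only: mult_ac)
    finally have "w = (w $ 2 * u $ 2) *s u"
      using three_square[OF 2] by (simp add: vec_eq_iff forall_2 mult.assoc)
    then show ?thesis by blast
  qed
qed

lemma vdet_neq_0:
  assumes "u \<noteq> 0" "w \<noteq> 0" "\<not> proportional u w"
  shows "vdet u w \<noteq> 0"
proof
  assume "vdet u w = 0"
  moreover have "vdet w u = - vdet u w" by (simp add: vdet_def)
  ultimately show False using assms vdet_0_scale[of u w] vdet_0_scale[of w u] by (auto simp: proportional_def)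
qed

lemma scale_neq_0: "c \<noteq> 0 \<Longrightarrow> (w :: 3^2) \<noteq> 0 \<Longrightarrow> c *s w \<noteq> 0"
  using three_square[of c] by (metis vector_smult_assoc vector_smult_lid vector_smult_rzero)

lemma proportional_scale: "c \<noteq> 0 \<Longrightarrow> proportional (c *s w) w"
  using three_square[of c] unfolding proportional_def by (metis vector_smult_assoc vector_smult_lid)

lemma matrix_vector_mult_smult:
  fixes A :: "'a::comm_semiring_1 ^ 'm ^ 'n"
  shows "A *v (c *s x) = c *s (A *v x)"
  by (simp add: vector_scalar_mult_def matrix_vector_mult_def mult_ac sum_distrib_left)

lemma proportional_mult:
  assumes "proportional u w"
  shows "proportional (A *v u) (A *v w)"
proof -
  obtain c c' where "u = c *s w" "w = c' *s u" using assms unfolding proportional_def by blast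
  then have "A *v u = c *s (A *v w)" "A *v w = c' *s (A *v u)"
    using matrix_vector_mult_smult by metis+
  then show ?thesis unfolding proportional_def by blast
qed

text \<open>The inverse is the adjugate matrix, as the determinant is \<open>1\<close>.\<close>

lemma SL23_inverse:
  fixes A :: "3^2^2"
  assumes "det A = 1"
  obtains B :: "3^2^2" where "det B = 1" "\<And>w. B *v (A *v w) = w" "\<And>w. A *v (B *v w) = w"
proof
  define B :: "3^2^2" where "B = vector [vector [A$2$2, - A$1$2], vector [- A$2$1, A$1$1]]"
  have d: "A$1$1 * A$2$2 - A$1$2 * A$2$1 = 1" using assms by (simp add: det_2)
  show "det B = 1" using d by (simp add: B_def det_2 mult_ac)
  have e: "A$1$1 * A$2$2 = 1 + A$1$2 * A$2$1" using d by (simp add: algebra_simps)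
  have "B ** A = mat 1" "A ** B = mat 1"
    using e by (simp_all add: B_def matrix_matrix_mult_def mat_def vec_eq_iff forall_2 sum_2 algebra_simps)
  then show "B *v (A *v w) = w" "A *v (B *v w) = w" for w
    by (simp_all add: matrix_vector_mul_assoc)
qed

lemma SL23_neq_0: "det A = 1 \<Longrightarrow> w \<noteq> 0 \<Longrightarrow> A *v w \<noteq> (0 :: 3^2)"
  by (metis SL23_inverse matrix_vector_mult_0_right)

text \<open>\<open>A\<close> is the product of the matrix with columns \<open>u'\<close>, \<open>c w'\<close> and the inverse of the
  matrix with columns \<open>u\<close>, \<open>w\<close>; the unit \<open>c\<close> makes its determinant \<open>1\<close>.\<close>

lemma SL23_two_points:
  assumes "vdet u w \<noteq> 0" "vdet u' w' \<noteq> 0"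
  obtains A :: "3^2^2" and c where "det A = 1" "A *v u = u'" "A *v w = c *s w'" "c \<noteq> 0"
proof
  define d d' where "d = vdet u w" and "d' = vdet u' w'"
  \<comment> \<open>The determinant of the product is \<open>c * d'\<close> divided by
    \<open>d\<close>. It equals \<open>1\<close> for \<open>c = d * d'\<close>, both factors being
    their own inverses.\<close>
  define c where "c = d * d'"
  have dd: "d * d = 1" "d' * d' = 1" using assms three_square by (simp_all add: d_def d'_def)
  then have cd: "c * d' = d" "c * d = d'" unfolding c_def by (metis mult.assoc mult.commute mult_1)+
  define A :: "3^2^2" where "A = vector [
    vector [d * (u'$1 * w$2 - c * w'$1 * u$2), d * (c * w'$1 * u$1 - u'$1 * w$1)],
    vector [d * (u'$2 * w$2 - c * w'$2 * u$2), d * (c * w'$2 * u$1 - u'$2 * w$1)]]"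
  have "det A = (d * d) * (c * vdet u' w' * vdet u w)"
    by (simp add: A_def det_2 vdet_def algebra_simps)
  also have "\<dots> = 1" using cd dd by (simp add: d_def[symmetric] d'_def[symmetric])
  finally show "det A = 1" .
  have "(A *v u) $ i = d * vdet u w * u' $ i" for i
    using exhaust_2[of i] by (auto simp: A_def matrix_vector_mult_def sum_2 vdet_def algebra_simps)
  then show "A *v u = u'" using dd by (simp add: d_def[symmetric] vec_eq_iff)
  have "(A *v w) $ i = d * vdet u w * (c * w' $ i)" for i
    using exhaust_2[of i] by (auto simp: A_def matrix_vector_mult_def sum_2 vdet_def algebra_simps)
  then show "A *v w = c *s w'" using dd by (simp add: d_def[symmetric] vec_eq_iff)
  show "c \<noteq> 0" using cd dd by (metis mult_zero_left zero_neq_one)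
qed

section \<open>The model group\<close>

locale parity_setup =
  fixes d\<^sub>1 :: nat and T' :: "'a ugraph" and v :: 'a and j :: "'a \<Rightarrow> nat"
    and T\<^sub>0 :: "'b ugraph" and v\<^sub>0 :: 'b and j\<^sub>0 :: "'b \<Rightarrow> nat"
    and \<psi> :: "3^2 \<Rightarrow> 'b" and \<alpha> :: "'a \<Rightarrow> 'b"
  assumes d1: "4 \<le> d\<^sub>1"
    and rooted0: "rooted_tree_4_2 T\<^sub>0 v\<^sub>0 3"
    and labelling: "vector_labelling T\<^sub>0 v\<^sub>0 \<psi>"
    and rooted: "rooted_tree_4_2 T' v d\<^sub>1"
    and coloring: "legal_coloring T' v d\<^sub>1 j"
    and coloring0: "legal_coloring T\<^sub>0 v\<^sub>0 3 j\<^sub>0"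
    and root_color: "j\<^sub>0 v\<^sub>0 = j v"
    and alpha: "color_map T' v j T\<^sub>0 v\<^sub>0 j\<^sub>0 \<alpha>"
begin

lemma bij_alpha: "bij_betw \<alpha> (nbrs T' v) (nbrs T\<^sub>0 v\<^sub>0)"
proof -
  have "v \<notin> nbrs T' v" "v\<^sub>0 \<notin> nbrs T\<^sub>0 v\<^sub>0"
    using edge_neq[OF rooted_tree[OF rooted]] edge_neq[OF rooted_tree[OF rooted0]] by auto
  moreover have "bij_betw \<alpha> (insert v (nbrs T' v)) (insert v\<^sub>0 (nbrs T\<^sub>0 v\<^sub>0))" "\<alpha> v = v\<^sub>0"
    using alpha root_gball_1[OF rooted] root_gball_1[OF rooted0] by (auto simp: color_map_def)
  ultimately show ?thesis using bij_betw_DiffI[of \<alpha> _ _ "{v}" "{v\<^sub>0}"] by fastforce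
qed

lemma alpha_in: "p \<in> nbrs T' v \<Longrightarrow> \<alpha> p \<in> nbrs T\<^sub>0 v\<^sub>0"
  using bij_betwE[OF bij_alpha] by blast

lemma coloring_child: "p \<in> nbrs T' v \<Longrightarrow> bij_betw j (nbrs T' p) {1..d\<^sub>1}"
  using coloring root_nbrs[OF rooted] child_nbrs[OF rooted] unfolding legal_coloring_def by metis

lemma coloring0_child: "q \<in> nbrs T\<^sub>0 v\<^sub>0 \<Longrightarrow> bij_betw j\<^sub>0 (nbrs T\<^sub>0 q) {1..3}"
  using coloring0 root_nbrs[OF rooted0] child_nbrs[OF rooted0] unfolding legal_coloring_def by metis

definition even_at :: "('a \<Rightarrow> 'a) \<Rightarrow> 'a \<Rightarrow> bool" where
  "even_at g p \<longleftrightarrow> evenperm (recolor j (nbrs T' p) g)"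

definition even_at0 :: "('b \<Rightarrow> 'b) \<Rightarrow> 'b \<Rightarrow> bool" where
  "even_at0 h q \<longleftrightarrow> evenperm (recolor j\<^sub>0 (nbrs T\<^sub>0 q) h)"

text \<open>The graph of the parity map as a relation: homomorphism laws can be checked on witnesses
  without touching the definite description.\<close>

definition parity_related :: "('a \<Rightarrow> 'a) \<Rightarrow> ('b \<Rightarrow> 'b) \<Rightarrow> bool" where
  "parity_related g h \<longleftrightarrow> h \<in> rooted_aut T\<^sub>0 v\<^sub>0 \<and>
     (\<forall>p\<in>nbrs T' v. h (\<alpha> p) = \<alpha> (g p) \<and> even_at0 h (\<alpha> p) = even_at g p)"

lemma even_at_comp:
  assumes "g \<in> rooted_aut T' v" "h \<in> rooted_aut T' v" "p \<in> nbrs T' v"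
  shows "even_at (h \<circ> g) p \<longleftrightarrow> (even_at g p \<longleftrightarrow> even_at h (g p))"
  unfolding even_at_def
  using rooted_aut_child[OF rooted] rooted_aut_child_nbrs[OF rooted] assms coloring_child
  by (intro evenperm_recolor_comp[where C = "{1..d\<^sub>1}"]) auto

lemma even_at0_comp:
  assumes "g \<in> rooted_aut T\<^sub>0 v\<^sub>0" "h \<in> rooted_aut T\<^sub>0 v\<^sub>0" "p \<in> nbrs T\<^sub>0 v\<^sub>0"
  shows "even_at0 (h \<circ> g) p \<longleftrightarrow> (even_at0 g p \<longleftrightarrow> even_at0 h (g p))"
  unfolding even_at0_def
  using rooted_aut_child[OF rooted0] rooted_aut_child_nbrs[OF rooted0] assms coloring0_child
  by (intro evenperm_recolor_comp[where C = "{1..3}"]) auto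

lemma even_at_id: "p \<in> nbrs T' v \<Longrightarrow> even_at id p"
  using coloring_child by (simp add: even_at_def recolor_id bij_betw_def)

lemma even_at0_id: "p \<in> nbrs T\<^sub>0 v\<^sub>0 \<Longrightarrow> even_at0 id p"
  using coloring0_child by (simp add: even_at0_def recolor_id bij_betw_def)

text \<open>The local permutation of the three colors around \<open>q\<close> fixes the color of the
  root, so its sign is read off at one leaf.\<close>

lemma even_at0_iff:
  assumes "h \<in> rooted_aut T\<^sub>0 v\<^sub>0" "q \<in> nbrs T\<^sub>0 v\<^sub>0" "w \<in> nbrs T\<^sub>0 q" "w \<noteq> v\<^sub>0"
  shows "even_at0 h q \<longleftrightarrow> j\<^sub>0 (h w) = j\<^sub>0 w"
  unfolding even_at0_def
proof (rule evenperm_recolor_3)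
  show "bij_betw h (nbrs T\<^sub>0 q) (nbrs T\<^sub>0 (h q))" using rooted_aut_child_nbrs[OF rooted0] assms by blast
  show "bij_betw j\<^sub>0 (nbrs T\<^sub>0 (h q)) {1..3}" using rooted_aut_child[OF rooted0] assms coloring0_child by blast
  show "v\<^sub>0 \<in> nbrs T\<^sub>0 q" using root_in_child_nbrs[OF rooted0 assms(2)] .
  show "j\<^sub>0 (h v\<^sub>0) = j\<^sub>0 v\<^sub>0" using rooted_aut_root[OF rooted0 assms(1)] by simp
qed (use assms coloring0_child in auto)

text \<open>The action on the children is given through \<open>\<alpha>\<close>, and below each
  child the parity tells which of the two leaves is hit.\<close>

lemma parity_related_unique:
  assumes "parity_related g h" "parity_related g h'"
  shows "h = h'"
proof (rule rooted_aut_eqI[OF rooted0])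
  show h: "h \<in> rooted_aut T\<^sub>0 v\<^sub>0" and h': "h' \<in> rooted_aut T\<^sub>0 v\<^sub>0" using assms by (simp_all add: parity_related_def)
  fix q assume q: "q \<in> nbrs T\<^sub>0 v\<^sub>0"
  then obtain p where p: "p \<in> nbrs T' v" "q = \<alpha> p" using bij_betw_imp_surj_on[OF bij_alpha] by blast
  then show hq: "h q = h' q" using assms by (simp add: parity_related_def)
  have e: "even_at0 h q \<longleftrightarrow> even_at0 h' q" using p assms by (simp add: parity_related_def)
  fix w assume w: "w \<in> nbrs T\<^sub>0 q" "w \<noteq> v\<^sub>0"
  have hw: "h w \<in> nbrs T\<^sub>0 (h q)" "h' w \<in> nbrs T\<^sub>0 (h q)"
    using rooted_aut_leaf[OF rooted0] h h' q w hq by metis+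
  have hw': "h w \<noteq> v\<^sub>0" "h' w \<noteq> v\<^sub>0" using rooted_aut_neq_root[OF rooted0] h h' w by metis+
  have hqv: "h q \<in> nbrs T\<^sub>0 v\<^sub>0" using rooted_aut_child[OF rooted0] h q by blast
  have inj: "inj_on j\<^sub>0 (nbrs T\<^sub>0 (h q))" using coloring0_child[OF hqv] by (simp add: bij_betw_def)
  have ne: "j\<^sub>0 (h w) \<noteq> j\<^sub>0 v\<^sub>0" "j\<^sub>0 (h' w) \<noteq> j\<^sub>0 v\<^sub>0"
    using inj_onD[OF inj] hw hw' root_in_child_nbrs[OF rooted0 hqv] by metis+
  have ne': "j\<^sub>0 w \<noteq> j\<^sub>0 v\<^sub>0"
    using inj_onD[OF bij_betw_imp_inj_on[OF coloring0_child[OF q]]] w root_in_child_nbrs[OF rooted0 q] by metis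
  have in3: "j\<^sub>0 (h w) \<in> {1..3}" "j\<^sub>0 (h' w) \<in> {1..3}" "j\<^sub>0 w \<in> {1..3}" "j\<^sub>0 v\<^sub>0 \<in> {1..3}"
    using bij_betwE[OF coloring0_child[OF hqv]] bij_betwE[OF coloring0_child[OF q]] hw w
      root_in_child_nbrs[OF rooted0 q] by metis+
  have iff: "j\<^sub>0 (h w) = j\<^sub>0 w \<longleftrightarrow> j\<^sub>0 (h' w) = j\<^sub>0 w"
    using even_at0_iff h h' q w e by blast
  \<comment> \<open>Of three colors, \<open>a\<close> belongs to the root and is excluded. The two
    left over are told apart by being equal to \<open>b\<close> or not.\<close>
  have third: "x = y" if "x \<in> {1..3}" "y \<in> {1..3}" "a \<in> {1..3}" "b \<in> {1..3}" "x \<noteq> a" "y \<noteq> a" "b \<noteq> a"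
    "x = b \<longleftrightarrow> y = b" for x y a b :: nat
    using that unfolding atLeastAtMost_iff by presburger
  have "j\<^sub>0 (h w) = j\<^sub>0 (h' w)" using third[OF in3(1,2,4,3) ne ne' iff] .
  then show "h w = h' w" using inj_onD[OF inj] hw by blast
qed

lemma card_child_nbrs_ge: "p \<in> nbrs T' v \<Longrightarrow> card (nbrs T' p) = d\<^sub>1"
  using card_child_nbrs[OF rooted] d1 by simp

lemma card_child_nbrs0: "q \<in> nbrs T\<^sub>0 v\<^sub>0 \<Longrightarrow> card (nbrs T\<^sub>0 q) = 3"
  using card_child_nbrs[OF rooted0] by simp

text \<open>The two leaves below a child can be exchanged while the root stays fixed, so each of the
  four parities can be realised.\<close>

lemma parity_related_exists:
  assumes g: "g \<in> rooted_aut T' v"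
  shows "\<exists>h. parity_related g h"
proof -
  define \<alpha>' where "\<alpha>' = inv_into (nbrs T' v) \<alpha>"
  have \<alpha>': "bij_betw \<alpha>' (nbrs T\<^sub>0 v\<^sub>0) (nbrs T' v)" unfolding \<alpha>'_def using bij_betw_inv_into[OF bij_alpha] .
  have \<alpha>'\<alpha>: "\<alpha>' (\<alpha> p) = p" if "p \<in> nbrs T' v" for p
    using that bij_alpha by (simp add: \<alpha>'_def bij_betw_inv_into_left)
  define \<pi> where "\<pi> = \<alpha> \<circ> (g \<circ> \<alpha>')"
  have \<pi>: "bij_betw \<pi> (nbrs T\<^sub>0 v\<^sub>0) (nbrs T\<^sub>0 v\<^sub>0)"
    unfolding \<pi>_def using \<alpha>' rooted_aut_root_nbrs[OF rooted g] bij_alpha by (intro bij_betw_trans)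
  have "\<exists>\<beta>. bij_betw \<beta> (nbrs T\<^sub>0 q) (nbrs T\<^sub>0 (\<pi> q)) \<and> \<beta> v\<^sub>0 = v\<^sub>0 \<and>
      evenperm (recolor j\<^sub>0 (nbrs T\<^sub>0 q) \<beta>) = even_at g (\<alpha>' q)" if q: "q \<in> nbrs T\<^sub>0 v\<^sub>0" for q
  proof -
    have \<pi>q: "\<pi> q \<in> nbrs T\<^sub>0 v\<^sub>0" using bij_betwE[OF \<pi>] q by blast
    note fin = finite_child_nbrs[OF rooted0 q] finite_child_nbrs[OF rooted0 \<pi>q]
    note card = card_child_nbrs0[OF q] card_child_nbrs0[OF \<pi>q]
    note root = root_in_child_nbrs[OF rooted0 q] root_in_child_nbrs[OF rooted0 \<pi>q]
    have c2: "2 \<le> card (nbrs T\<^sub>0 q - {v\<^sub>0})" "2 \<le> card (nbrs T\<^sub>0 (\<pi> q) - {v\<^sub>0})" using fin card root by simp_all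
    obtain u u' where u: "u \<in> nbrs T\<^sub>0 q - {v\<^sub>0}" "u' \<in> nbrs T\<^sub>0 (\<pi> q) - {v\<^sub>0}"
      using two_elements[OF c2(1)] two_elements[OF c2(2)] by metis
    obtain \<beta> where \<beta>: "bij_betw \<beta> (nbrs T\<^sub>0 q) (nbrs T\<^sub>0 (\<pi> q))" "\<beta> v\<^sub>0 = v\<^sub>0"
      using bij_with_values[OF fin _ root(1) _ _ root(2)] u card by (metis DiffE singletonI)
    show ?thesis
      using bij_with_parity_on[OF coloring0_child[OF q] \<beta>(1) coloring0_child[OF \<pi>q] _ c2(1), of "even_at g (\<alpha>' q)"] \<beta>(2)
      by (metis finite_atLeastAtMost singletonI)
  qed
  then obtain \<beta> where \<beta>: "\<And>q. q \<in> nbrs T\<^sub>0 v\<^sub>0 \<Longrightarrow> bij_betw (\<beta> q) (nbrs T\<^sub>0 q) (nbrs T\<^sub>0 (\<pi> q)) \<and> \<beta> q v\<^sub>0 = v\<^sub>0 \<and>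
      evenperm (recolor j\<^sub>0 (nbrs T\<^sub>0 q) (\<beta> q)) = even_at g (\<alpha>' q)" by metis
  from rooted_aut_exists[OF rooted0 \<pi>, of \<beta>] \<beta> obtain h where h: "h \<in> rooted_aut T\<^sub>0 v\<^sub>0"
    "\<And>p. p \<in> nbrs T\<^sub>0 v\<^sub>0 \<Longrightarrow> h p = \<pi> p" "\<And>p w. p \<in> nbrs T\<^sub>0 v\<^sub>0 \<Longrightarrow> w \<in> nbrs T\<^sub>0 p \<Longrightarrow> h w = \<beta> p w" by metis
  have "h (\<alpha> p) = \<alpha> (g p) \<and> even_at0 h (\<alpha> p) = even_at g p" if p: "p \<in> nbrs T' v" for p
  proof
    note q = alpha_in[OF p]
    show "h (\<alpha> p) = \<alpha> (g p)" using h(2)[OF q] \<alpha>'\<alpha>[OF p] by (simp add: \<pi>_def)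
    have "recolor j\<^sub>0 (nbrs T\<^sub>0 (\<alpha> p)) h = recolor j\<^sub>0 (nbrs T\<^sub>0 (\<alpha> p)) (\<beta> (\<alpha> p))"
      using h(3)[OF q] by (intro recolor_cong) auto
    then show "even_at0 h (\<alpha> p) = even_at g p" using \<beta>[OF q] \<alpha>'\<alpha>[OF p] by (simp add: even_at0_def)
  qed
  then show ?thesis using h(1) unfolding parity_related_def by blast
qed

lemma parity_map_eq:
  assumes g: "g \<in> rooted_aut T' v"
  shows "parity_map T' v j T\<^sub>0 v\<^sub>0 j\<^sub>0 \<alpha> g = (THE h. parity_related g h)"
proof -
  have "(h \<in> rooted_aut T\<^sub>0 v\<^sub>0 \<and> (\<forall>x\<in>gball T' v 1. h (\<alpha> x) = \<alpha> (g x)) \<and>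
     (\<forall>x\<in>gsphere T' v 1. evenperm (local_perm T\<^sub>0 j\<^sub>0 h (\<alpha> x)) \<longleftrightarrow> evenperm (local_perm T' j g x)))
    \<longleftrightarrow> parity_related g h" for h
  proof -
    have "\<alpha> v = v\<^sub>0" using alpha by (simp add: color_map_def)
    moreover have "local_perm T\<^sub>0 j\<^sub>0 h (\<alpha> x) = recolor j\<^sub>0 (nbrs T\<^sub>0 (\<alpha> x)) h"
      "local_perm T' j g x = recolor j (nbrs T' x) g" if "x \<in> nbrs T' v" for x
      unfolding local_perm_recolor child_nbrs[OF rooted that] child_nbrs[OF rooted0 alpha_in[OF that]] by simp_all
    ultimately show ?thesis
      unfolding root_nbrs[OF rooted] root_gball_1[OF rooted] parity_related_def even_at_def even_at0_def
      using rooted_aut_root[OF rooted g] rooted_aut_root[OF rooted0] by auto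
  qed
  then show ?thesis unfolding parity_map_def by presburger
qed

definition model_group :: "('a \<Rightarrow> 'a) set" where
  "model_group = parity_preimage T' v j T\<^sub>0 v\<^sub>0 j\<^sub>0 \<alpha> (SL23_image T\<^sub>0 v\<^sub>0 \<psi>)"

text \<open>Existence and uniqueness turn the definite description into an existential statement,
  the only form in which membership is used below.\<close>

lemma mem_model_group:
  "g \<in> model_group \<longleftrightarrow> g \<in> rooted_aut T' v \<and> (\<exists>h\<in>SL23_image T\<^sub>0 v\<^sub>0 \<psi>. parity_related g h)"
proof (cases "g \<in> rooted_aut T' v")
  case True
  then obtain h where "parity_related g h" using parity_related_exists by blast
  then have "parity_related g h' \<longleftrightarrow> h' = h" for h' using parity_related_unique by blast
  then show ?thesis using True parity_map_eq[OF True] by (simp add: model_group_def parity_preimage_def)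
qed (simp add: model_group_def parity_preimage_def)

section \<open>The action of \<open>SL(2,3)\<close> on the leaves of the small tree\<close>

abbreviation leaves0 :: "'b set" where
  "leaves0 \<equiv> (\<Union>p\<in>nbrs T\<^sub>0 v\<^sub>0. nbrs T\<^sub>0 p) - {v\<^sub>0}"

text \<open>The counterpart of \<open>proportional\<close> in the tree. It is meant for leaves: the
  root is adjacent to all children and has to be excluded separately.\<close>

definition siblings :: "'b \<Rightarrow> 'b \<Rightarrow> bool" where
  "siblings x y \<longleftrightarrow> (\<exists>p\<in>nbrs T\<^sub>0 v\<^sub>0. x \<in> nbrs T\<^sub>0 p \<and> y \<in> nbrs T\<^sub>0 p)"

lemma bij_psi: "bij_betw \<psi> {w. w \<noteq> 0} leaves0"
  using labelling gsphere_root_2[OF rooted0] by (simp add: vector_labelling_def)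

lemma psi_in: "w \<noteq> 0 \<Longrightarrow> \<psi> w \<in> leaves0"
  using bij_betwE[OF bij_psi] by blast

lemma psi_surj: "x \<in> leaves0 \<Longrightarrow> \<exists>w. w \<noteq> 0 \<and> x = \<psi> w"
  using bij_betw_imp_surj_on[OF bij_psi] by (metis (mono_tags, lifting) image_iff mem_Collect_eq)

lemma psi_inj: "u \<noteq> 0 \<Longrightarrow> w \<noteq> 0 \<Longrightarrow> \<psi> u = \<psi> w \<longleftrightarrow> u = w"
  using bij_betw_imp_inj_on[OF bij_psi] by (auto simp: inj_on_def)

lemma siblings_psi: "u \<noteq> 0 \<Longrightarrow> w \<noteq> 0 \<Longrightarrow> siblings (\<psi> u) (\<psi> w) \<longleftrightarrow> proportional u w"
  using labelling root_nbrs[OF rooted0] unfolding vector_labelling_def siblings_def proportional_def by simp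

lemma siblingsD:
  assumes "siblings x y" "q \<in> nbrs T\<^sub>0 v\<^sub>0" "y \<in> nbrs T\<^sub>0 q" "y \<noteq> v\<^sub>0"
  shows "x \<in> nbrs T\<^sub>0 q"
  using assms parent_unique[OF rooted0] unfolding siblings_def by blast

lemma leaf0_exists:
  assumes "q \<in> nbrs T\<^sub>0 v\<^sub>0"
  obtains w where "w \<in> nbrs T\<^sub>0 q" "w \<noteq> v\<^sub>0"
proof -
  have "2 \<le> card (nbrs T\<^sub>0 q - {v\<^sub>0})"
    using card_child_nbrs0[OF assms] root_in_child_nbrs[OF rooted0 assms] by simp
  from two_elements[OF this] that show ?thesis by blast
qed

text \<open>An invertible matrix permutes the nonzero vectors and respects lines. Lines are the
  classes of siblings, so the children of the root are permuted along.\<close>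

lemma SL23_lift:
  assumes A: "det A = 1"
  obtains h where "h \<in> rooted_aut T\<^sub>0 v\<^sub>0" "\<And>w. w \<noteq> 0 \<Longrightarrow> h (\<psi> w) = \<psi> (A *v w)"
proof -
  obtain B where B: "det B = 1" "\<And>w. B *v (A *v w) = w" using SL23_inverse[OF A] by metis
  define H where "H x = \<psi> (A *v inv_into {w. w \<noteq> 0} \<psi> x)" for x
  have H\<psi>: "H (\<psi> w) = \<psi> (A *v w)" if "w \<noteq> 0" for w
    using bij_betw_inv_into_left[OF bij_psi] that by (simp add: H_def)
  have Hin: "H x \<in> leaves0" if "x \<in> leaves0" for x
    using psi_surj[OF that] H\<psi> psi_in SL23_neq_0[OF A] by metis
  have Hsib: "siblings (H x) (H y) \<longleftrightarrow> siblings x y" if xy: "x \<in> leaves0" "y \<in> leaves0" for x y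
  proof -
    obtain u w where uw: "u \<noteq> 0" "x = \<psi> u" "w \<noteq> 0" "y = \<psi> w" using psi_surj[OF xy(1)] psi_surj[OF xy(2)] by blast
    have "proportional (A *v u) (A *v w) \<longleftrightarrow> proportional u w"
      using proportional_mult[of u w A] proportional_mult[of "A *v u" "A *v w" B] unfolding B(2) by blast
    then show ?thesis using uw SL23_neq_0[OF A] H\<psi> siblings_psi by simp
  qed
  have Hinj: "x = y" if xy: "x \<in> leaves0" "y \<in> leaves0" "H x = H y" for x y
  proof -
    obtain u w where uw: "u \<noteq> 0" "x = \<psi> u" "w \<noteq> 0" "y = \<psi> w" using psi_surj[OF xy(1)] psi_surj[OF xy(2)] by blast
    then have "A *v u = A *v w" using H\<psi> psi_inj SL23_neq_0[OF A] xy(3) by simp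
    then show ?thesis using B(2) uw by metis
  qed
  have "\<exists>w. w \<in> nbrs T\<^sub>0 q \<and> w \<noteq> v\<^sub>0" if "q \<in> nbrs T\<^sub>0 v\<^sub>0" for q
    using leaf0_exists[OF that] by blast
  \<comment> \<open>One leaf \<open>c q\<close> below each child \<open>q\<close>; the image of
    \<open>q\<close> will be the parent of the image of this leaf.\<close>
  then obtain c where c: "\<And>q. q \<in> nbrs T\<^sub>0 v\<^sub>0 \<Longrightarrow> c q \<in> nbrs T\<^sub>0 q \<and> c q \<noteq> v\<^sub>0" by metis
  have leaf: "x \<in> leaves0" if "q \<in> nbrs T\<^sub>0 v\<^sub>0" "x \<in> nbrs T\<^sub>0 q" "x \<noteq> v\<^sub>0" for q x using that by blast
  have "\<exists>p. p \<in> nbrs T\<^sub>0 v\<^sub>0 \<and> H (c q) \<in> nbrs T\<^sub>0 p" if "q \<in> nbrs T\<^sub>0 v\<^sub>0" for q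
    using Hin[OF leaf[OF that]] c[OF that] by blast
  then obtain \<pi> where \<pi>: "\<And>q. q \<in> nbrs T\<^sub>0 v\<^sub>0 \<Longrightarrow> \<pi> q \<in> nbrs T\<^sub>0 v\<^sub>0 \<and> H (c q) \<in> nbrs T\<^sub>0 (\<pi> q)" by metis
  have Hne: "H x \<noteq> v\<^sub>0" if "x \<in> leaves0" for x using Hin[OF that] by blast
  have H\<pi>: "H x \<in> nbrs T\<^sub>0 (\<pi> q)" if q: "q \<in> nbrs T\<^sub>0 v\<^sub>0" and x: "x \<in> nbrs T\<^sub>0 q" "x \<noteq> v\<^sub>0" for q x
  proof (rule siblingsD)
    have "siblings x (c q)" using c[OF q] x q unfolding siblings_def by blast
    then show "siblings (H x) (H (c q))" using Hsib leaf[OF q x] leaf[OF q] c[OF q] by blast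
    show "H (c q) \<noteq> v\<^sub>0" using Hne leaf[OF q] c[OF q] by blast
  qed (use \<pi>[OF q] in auto)
  have "inj_on \<pi> (nbrs T\<^sub>0 v\<^sub>0)"
  proof
    fix p q assume pq: "p \<in> nbrs T\<^sub>0 v\<^sub>0" "q \<in> nbrs T\<^sub>0 v\<^sub>0" "\<pi> p = \<pi> q"
    then have "siblings (H (c p)) (H (c q))" unfolding siblings_def using \<pi>[OF pq(1)] \<pi>[OF pq(2)] by auto
    then have "siblings (c p) (c q)" using Hsib leaf[OF pq(1)] leaf[OF pq(2)] c[OF pq(1)] c[OF pq(2)] by blast
    then have "c p \<in> nbrs T\<^sub>0 q" using siblingsD[OF _ pq(2)] c[OF pq(2)] by blast
    then show "p = q" using parent_unique[OF rooted0 pq(1,2)] c[OF pq(1)] by blast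
  qed
  moreover have "\<pi> ` nbrs T\<^sub>0 v\<^sub>0 \<subseteq> nbrs T\<^sub>0 v\<^sub>0" using \<pi> by blast
  ultimately have \<pi>bij: "bij_betw \<pi> (nbrs T\<^sub>0 v\<^sub>0) (nbrs T\<^sub>0 v\<^sub>0)"
    using endo_inj_surj[OF finite_card_root_nbrs(1)[OF rooted0]] by (simp add: bij_betw_def)
  \<comment> \<open>The sphere around a child also contains the root, on which \<open>H\<close> has
    no meaningful value.\<close>
  define \<beta> where "\<beta> w = (if w = v\<^sub>0 then v\<^sub>0 else H w)" for w
  have \<beta>bij: "bij_betw \<beta> (nbrs T\<^sub>0 q) (nbrs T\<^sub>0 (\<pi> q))" if q: "q \<in> nbrs T\<^sub>0 v\<^sub>0" for q
  proof -
    have \<pi>q: "\<pi> q \<in> nbrs T\<^sub>0 v\<^sub>0" using \<pi>[OF q] by blast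
    have "inj_on \<beta> (nbrs T\<^sub>0 q)"
    proof (rule inj_onI)
      fix x y assume xy: "x \<in> nbrs T\<^sub>0 q" "y \<in> nbrs T\<^sub>0 q" "\<beta> x = \<beta> y"
      show "x = y"
      proof (cases "x = v\<^sub>0 \<or> y = v\<^sub>0")
        case True
        then show ?thesis using xy Hne leaf[OF q] unfolding \<beta>_def by metis
      next
        case False
        then show ?thesis using xy Hinj leaf[OF q] unfolding \<beta>_def by metis
      qed
    qed
    moreover have "\<beta> ` nbrs T\<^sub>0 q \<subseteq> nbrs T\<^sub>0 (\<pi> q)"
      using H\<pi>[OF q] root_in_child_nbrs[OF rooted0 \<pi>q] unfolding \<beta>_def by force
    ultimately show ?thesis
      using card_subset_eq[OF finite_child_nbrs[OF rooted0 \<pi>q]] card_image card_child_nbrs0 q \<pi>q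
      unfolding bij_betw_def by metis
  qed
  obtain h where h: "h \<in> rooted_aut T\<^sub>0 v\<^sub>0" "\<And>p w. p \<in> nbrs T\<^sub>0 v\<^sub>0 \<Longrightarrow> w \<in> nbrs T\<^sub>0 p \<Longrightarrow> h w = \<beta> w"
    using rooted_aut_exists[OF rooted0 \<pi>bij, of "\<lambda>_. \<beta>"] \<beta>bij \<beta>_def by metis
  have "h (\<psi> w) = \<psi> (A *v w)" if "w \<noteq> 0" for w
    using psi_in[OF that] h(2) H\<psi>[OF that] unfolding \<beta>_def by auto
  with h(1) that show ?thesis by blast
qed

lemma SL23_imageE:
  assumes "h \<in> SL23_image T\<^sub>0 v\<^sub>0 \<psi>"
  obtains A :: "3^2^2" where "h \<in> rooted_aut T\<^sub>0 v\<^sub>0" "det A = 1" "\<And>w. w \<noteq> 0 \<Longrightarrow> h (\<psi> w) = \<psi> (A *v w)"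
  using assms by (auto simp: SL23_image_def)

lemma SL23_imageI:
  "h \<in> rooted_aut T\<^sub>0 v\<^sub>0 \<Longrightarrow> det A = 1 \<Longrightarrow> (\<And>w. w \<noteq> 0 \<Longrightarrow> h (\<psi> w) = \<psi> (A *v w)) \<Longrightarrow>
    h \<in> SL23_image T\<^sub>0 v\<^sub>0 \<psi>"
  unfolding SL23_image_def by blast

lemma SL23_image_id: "id \<in> SL23_image T\<^sub>0 v\<^sub>0 \<psi>"
  by (rule SL23_imageI[of _ "mat 1"]) (simp_all add: rooted_aut_id)

lemma SL23_image_comp:
  assumes "h \<in> SL23_image T\<^sub>0 v\<^sub>0 \<psi>" "h' \<in> SL23_image T\<^sub>0 v\<^sub>0 \<psi>"
  shows "h' \<circ> h \<in> SL23_image T\<^sub>0 v\<^sub>0 \<psi>"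
proof -
  obtain A :: "3^2^2" where A: "h \<in> rooted_aut T\<^sub>0 v\<^sub>0" "det A = 1" "\<And>w. w \<noteq> 0 \<Longrightarrow> h (\<psi> w) = \<psi> (A *v w)"
    using SL23_imageE[OF assms(1)] by metis
  obtain A' :: "3^2^2" where A': "h' \<in> rooted_aut T\<^sub>0 v\<^sub>0" "det A' = 1" "\<And>w. w \<noteq> 0 \<Longrightarrow> h' (\<psi> w) = \<psi> (A' *v w)"
    using SL23_imageE[OF assms(2)] by metis
  show ?thesis
  proof (rule SL23_imageI)
    show "h' \<circ> h \<in> rooted_aut T\<^sub>0 v\<^sub>0" using A'(1) A(1) by (rule rooted_aut_comp)
    show "det (A' ** A) = 1" using A(2) A'(2) by (simp add: det_mul)
    show "(h' \<circ> h) (\<psi> w) = \<psi> ((A' ** A) *v w)" if "w \<noteq> 0" for w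
      unfolding comp_apply A(3)[OF that] A'(3)[OF SL23_neq_0[OF A(2) that]] matrix_vector_mul_assoc ..
  qed
qed

lemma SL23_image_inverse:
  assumes "h \<in> SL23_image T\<^sub>0 v\<^sub>0 \<psi>" "h' \<in> rooted_aut T\<^sub>0 v\<^sub>0" "h' \<circ> h = id"
  shows "h' \<in> SL23_image T\<^sub>0 v\<^sub>0 \<psi>"
proof -
  obtain A :: "3^2^2" where A: "det A = 1" "\<And>w. w \<noteq> 0 \<Longrightarrow> h (\<psi> w) = \<psi> (A *v w)"
    using SL23_imageE[OF assms(1)] by metis
  obtain B where B: "det B = 1" "\<And>w. A *v (B *v w) = w" using SL23_inverse[OF A(1)] by metis
  have "h' (\<psi> w) = \<psi> (B *v w)" if "w \<noteq> 0" for w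
  proof -
    have "h (\<psi> (B *v w)) = \<psi> w" using A(2)[OF SL23_neq_0[OF B(1) that]] B(2) by simp
    then show ?thesis using assms(3) by (metis comp_apply id_apply)
  qed
  then show ?thesis using SL23_imageI[OF assms(2) B(1)] by blast
qed

section \<open>Group laws and the extension property of the model group\<close>

lemma model_group_rooted_aut: "g \<in> model_group \<Longrightarrow> g \<in> rooted_aut T' v"
  by (simp add: mem_model_group)

lemma model_group_id: "id \<in> model_group"
proof -
  have "parity_related id id"
    using even_at_id even_at0_id alpha_in rooted_aut_id[of T\<^sub>0 v\<^sub>0] by (simp add: parity_related_def)
  then show ?thesis unfolding mem_model_group using SL23_image_id rooted_aut_id by metis
qed

text \<open>The parity map is multiplicative: parities in both trees obey the same cocycle rule, and
  \<open>\<alpha>\<close> intertwines the actions on the children.\<close>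

lemma model_group_comp:
  assumes "g \<in> model_group" "g' \<in> model_group"
  shows "g' \<circ> g \<in> model_group"
proof -
  obtain h h' where g: "g \<in> rooted_aut T' v" "h \<in> SL23_image T\<^sub>0 v\<^sub>0 \<psi>" "parity_related g h"
    and g': "g' \<in> rooted_aut T' v" "h' \<in> SL23_image T\<^sub>0 v\<^sub>0 \<psi>" "parity_related g' h'"
    using assms unfolding mem_model_group by blast
  have "parity_related (g' \<circ> g) (h' \<circ> h)"
    unfolding parity_related_def
  proof (intro conjI ballI)
    fix p assume p: "p \<in> nbrs T' v"
    note gp = rooted_aut_child[OF rooted g(1) p]
    show "(h' \<circ> h) (\<alpha> p) = \<alpha> ((g' \<circ> g) p)" using g(3) g'(3) p gp by (simp add: parity_related_def)
    show "even_at0 (h' \<circ> h) (\<alpha> p) = even_at (g' \<circ> g) p"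
      using even_at_comp[OF g(1) g'(1) p] even_at0_comp[OF _ _ alpha_in[OF p], of h h'] g(3) g'(3) p gp
      by (simp add: parity_related_def)
  next
    show "h' \<circ> h \<in> rooted_aut T\<^sub>0 v\<^sub>0" using g(3) g'(3) unfolding parity_related_def by (metis rooted_aut_comp)
  qed
  then show ?thesis unfolding mem_model_group using SL23_image_comp[OF g(2) g'(2)] rooted_aut_comp[OF g'(1) g(1)] by blast
qed

lemma model_group_inverse:
  assumes "g \<in> model_group" "g' \<in> rooted_aut T' v" "g' \<circ> g = id" "g \<circ> g' = id"
  shows "g' \<in> model_group"
proof -
  obtain h where g: "g \<in> rooted_aut T' v" "h \<in> SL23_image T\<^sub>0 v\<^sub>0 \<psi>" "parity_related g h"
    using assms(1) unfolding mem_model_group by blast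
  have h: "h \<in> rooted_aut T\<^sub>0 v\<^sub>0" using g by (simp add: parity_related_def)
  obtain h' where h': "h' \<in> rooted_aut T\<^sub>0 v\<^sub>0" "h' \<circ> h = id" "h \<circ> h' = id" using rooted_aut_inverse[OF h] .
  have "parity_related g' h'"
    unfolding parity_related_def
  proof (intro conjI ballI)
    fix p assume p: "p \<in> nbrs T' v"
    \<comment> \<open>The cocycle rule at \<open>t\<close> for the trivial product
      \<open>g' \<circ> g\<close> says that \<open>g'\<close> has at \<open>p\<close> the parity
      that \<open>g\<close> has at \<open>t\<close>.\<close>
    define t where "t = g' p"
    have t: "t \<in> nbrs T' v" using rooted_aut_child[OF rooted assms(2) p] by (simp add: t_def)
    have gt: "g t = p" using assms(4) by (simp add: t_def fun_eq_iff)
    have ht: "h (\<alpha> t) = \<alpha> p" using g(3) t gt by (simp add: parity_related_def)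
    then show "h' (\<alpha> p) = \<alpha> (g' p)" using h'(2) t_def by (metis comp_apply id_apply)
    have "even_at g t \<longleftrightarrow> even_at g' p"
      using even_at_comp[OF g(1) assms(2) t] even_at_id[OF t] assms(3) gt by simp
    moreover have "even_at0 h (\<alpha> t) \<longleftrightarrow> even_at0 h' (\<alpha> p)"
      using even_at0_comp[OF h h'(1) alpha_in[OF t]] even_at0_id[OF alpha_in[OF t]] h'(2) ht by simp
    ultimately show "even_at0 h' (\<alpha> p) = even_at g' p" using g(3) t by (simp add: parity_related_def)
  qed (rule h'(1))
  then show ?thesis unfolding mem_model_group using SL23_image_inverse[OF g(2) h'(1,2)] assms(2) by blast
qed

text \<open>A leaf below \<open>p\<close> is sent to one of the two leaves below \<open>q\<close>,
  and which of them decides the parity at \<open>p\<close>; these two leaves carry opposite vectors,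
  so this is the freedom given by \<open>-1\<close>. For \<open>p2\<close> only a line has to be
  hit, and the spare scalar makes the determinant \<open>1\<close>.\<close>

lemma SL23_image_extension:
  assumes "p \<in> nbrs T\<^sub>0 v\<^sub>0" "p2 \<in> nbrs T\<^sub>0 v\<^sub>0" "p \<noteq> p2" "q \<in> nbrs T\<^sub>0 v\<^sub>0" "q2 \<in> nbrs T\<^sub>0 v\<^sub>0" "q \<noteq> q2"
  obtains h where "h \<in> SL23_image T\<^sub>0 v\<^sub>0 \<psi>" "h p = q" "h p2 = q2" "even_at0 h p \<longleftrightarrow> b"
proof -
  have inj: "inj_on j\<^sub>0 (nbrs T\<^sub>0 q)" and im: "j\<^sub>0 ` nbrs T\<^sub>0 q = {1..3}"
    using coloring0_child[OF assms(4)] by (auto simp: bij_betw_def)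
  obtain a where a: "a \<in> nbrs T\<^sub>0 p" "a \<noteq> v\<^sub>0" using leaf0_exists[OF assms(1)] .
  have ja: "j\<^sub>0 a \<noteq> j\<^sub>0 v\<^sub>0" "j\<^sub>0 a \<in> {1..3}" "j\<^sub>0 v\<^sub>0 \<in> {1..3}"
    using coloring0_child[OF assms(1)] a root_in_child_nbrs[OF rooted0 assms(1)]
    by (metis bij_betw_imp_inj_on inj_onD, metis bij_betwE, metis bij_betwE)
  have ex: "\<exists>c\<in>{1..3}. c \<noteq> y \<and> (c = x \<longleftrightarrow> b)" if "x \<in> {1..3}" "y \<in> {1..3}" "x \<noteq> y" for x y :: nat
  proof (cases b)
    case False
    have "card {x, y} \<noteq> card {1..3::nat}" using that by simp
    moreover have "{x, y} \<subseteq> {1..3}" using that by blast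
    ultimately obtain c where "c \<in> {1..3}" "c \<notin> {x, y}" by (metis subset_antisym subsetI)
    then show ?thesis using False by auto
  qed (use that in auto)
  \<comment> \<open>The color wanted for the image of \<open>a\<close>: not that of the root, and
    that of \<open>a\<close> itself exactly if the parity is to be even.\<close>
  then obtain c where c: "c \<in> {1..3}" "c \<noteq> j\<^sub>0 v\<^sub>0" "c = j\<^sub>0 a \<longleftrightarrow> b" using ja by metis
  obtain a' where a': "a' \<in> nbrs T\<^sub>0 q" "j\<^sub>0 a' = c" using c(1) im by (metis imageE)
  have a'v: "a' \<noteq> v\<^sub>0" using a' c by auto
  obtain e where e: "e \<in> nbrs T\<^sub>0 p2" "e \<noteq> v\<^sub>0" using leaf0_exists[OF assms(2)] .
  obtain e' where e': "e' \<in> nbrs T\<^sub>0 q2" "e' \<noteq> v\<^sub>0" using leaf0_exists[OF assms(5)] .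
  have "\<exists>u. u \<noteq> 0 \<and> a = \<psi> u" "\<exists>u. u \<noteq> 0 \<and> a' = \<psi> u" "\<exists>u. u \<noteq> 0 \<and> e = \<psi> u" "\<exists>u. u \<noteq> 0 \<and> e' = \<psi> u"
    using a a' a'v e e' assms psi_surj by blast+
  then obtain u u' w w' where uw: "u \<noteq> 0" "a = \<psi> u" "u' \<noteq> 0" "a' = \<psi> u'" "w \<noteq> 0" "e = \<psi> w" "w' \<noteq> 0" "e' = \<psi> w'"
    by blast
  have "\<not> siblings a e"
    using siblingsD[OF _ assms(2) e] parent_unique[OF rooted0 assms(1,2)] a assms(3) by blast
  then have v1: "vdet u w \<noteq> 0" using vdet_neq_0 siblings_psi uw by metis
  have "\<not> siblings a' e'"
    using siblingsD[OF _ assms(5) e'] parent_unique[OF rooted0 assms(4,5)] a' a'v assms(6) by blast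
  then have v2: "vdet u' w' \<noteq> 0" using vdet_neq_0 siblings_psi uw by metis
  obtain A :: "3^2^2" and k where A: "det A = 1" "A *v u = u'" "A *v w = k *s w'" "k \<noteq> 0"
    using SL23_two_points[OF v1 v2] .
  obtain h where h: "h \<in> rooted_aut T\<^sub>0 v\<^sub>0" "\<And>w. w \<noteq> 0 \<Longrightarrow> h (\<psi> w) = \<psi> (A *v w)" using SL23_lift[OF A(1)] by blast
  have ha: "h a = a'" using h(2) uw A by simp
  \<comment> \<open>The vector \<open>w'\<close> is reached up to the scalar \<open>k\<close> only,
    so \<open>h e\<close> need not be \<open>e'\<close>; being its sibling determines the
    parent.\<close>
  have "h e = \<psi> (k *s w')" using h(2) uw A by simp
  then have "siblings (h e) e'" using siblings_psi uw A(4) proportional_scale scale_neq_0 by simp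
  then have he: "h e \<in> nbrs T\<^sub>0 q2" using siblingsD assms(5) e' by blast
  have "h p = q"
    using parent_unique[OF rooted0 rooted_aut_child[OF rooted0 h(1) assms(1)] assms(4)
        rooted_aut_leaf[OF rooted0 h(1) assms(1) a(1)]] ha a' a'v by blast
  moreover have "h p2 = q2"
    using parent_unique[OF rooted0 rooted_aut_child[OF rooted0 h(1) assms(2)] assms(5)
        rooted_aut_leaf[OF rooted0 h(1) assms(2) e(1)] he] rooted_aut_neq_root[OF rooted0 h(1) e(2)] by blast
  moreover have "even_at0 h p \<longleftrightarrow> b" using even_at0_iff[OF h(1) assms(1) a] ha a' c by simp
  moreover have "h \<in> SL23_image T\<^sub>0 v\<^sub>0 \<psi>" using SL23_imageI[OF h(1) A(1) h(2)] by blast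
  ultimately show ?thesis using that by blast
qed

text \<open>As \<open>PSL(2,3)\<close> is 2-transitive on the projective line, the images of \<open>p\<close> and \<open>p2\<close> can be
  prescribed; the central element \<open>-1\<close> flips all parities, so the parity at \<open>p\<close> can be prescribed
  as well. At the remaining children enough leaves are free to adjust the parity.\<close>

lemma model_group_extension:
  assumes p: "p \<in> nbrs T' v" "p2 \<in> nbrs T' v" "p \<noteq> p2" and q: "q \<in> nbrs T' v" "q2 \<in> nbrs T' v" "q \<noteq> q2"
    and \<phi>: "bij_betw \<phi> (nbrs T' p) (nbrs T' q)" "\<phi> v = v"
    and u: "u \<in> nbrs T' p2" "u \<noteq> v" "u' \<in> nbrs T' q2" "u' \<noteq> v"
  obtains g where "g \<in> model_group" "g p = q" "g p2 = q2" "\<And>w. w \<in> nbrs T' p \<Longrightarrow> g w = \<phi> w" "g u = u'"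
proof -
  have \<alpha>ne: "\<alpha> p \<noteq> \<alpha> p2" "\<alpha> q \<noteq> \<alpha> q2"
    using inj_onD[OF bij_betw_imp_inj_on[OF bij_alpha]] p q by blast+
  \<comment> \<open>The one parity at disposal is adapted to \<open>\<phi>\<close>; the parities of
    \<open>h\<close> at the other children are then forced on \<open>g\<close>.\<close>
  obtain h where h: "h \<in> SL23_image T\<^sub>0 v\<^sub>0 \<psi>" "h (\<alpha> p) = \<alpha> q" "h (\<alpha> p2) = \<alpha> q2"
    "even_at0 h (\<alpha> p) \<longleftrightarrow> evenperm (recolor j (nbrs T' p) \<phi>)"
    using SL23_image_extension[OF alpha_in[OF p(1)] alpha_in[OF p(2)] \<alpha>ne(1) alpha_in[OF q(1)] alpha_in[OF q(2)] \<alpha>ne(2)] .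
  have hr: "h \<in> rooted_aut T\<^sub>0 v\<^sub>0" using h(1) by (simp add: SL23_image_def)
  define \<alpha>' where "\<alpha>' = inv_into (nbrs T' v) \<alpha>"
  have \<alpha>': "bij_betw \<alpha>' (nbrs T\<^sub>0 v\<^sub>0) (nbrs T' v)" unfolding \<alpha>'_def using bij_betw_inv_into[OF bij_alpha] .
  have \<alpha>'\<alpha>: "\<alpha>' (\<alpha> t) = t" if "t \<in> nbrs T' v" for t
    using that bij_alpha by (simp add: \<alpha>'_def bij_betw_inv_into_left)
  have \<alpha>\<alpha>': "\<alpha> (\<alpha>' t) = t" if "t \<in> nbrs T\<^sub>0 v\<^sub>0" for t
    using that bij_alpha by (simp add: \<alpha>'_def bij_betw_inv_into_right)
  define \<pi> where "\<pi> = \<alpha>' \<circ> (h \<circ> \<alpha>)"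
  have \<pi>: "bij_betw \<pi> (nbrs T' v) (nbrs T' v)"
    unfolding \<pi>_def using \<alpha>' rooted_aut_root_nbrs[OF rooted0 hr] bij_alpha by (intro bij_betw_trans)
  have \<pi>p: "\<pi> p = q" "\<pi> p2 = q2" using h \<alpha>'\<alpha> q by (simp_all add: \<pi>_def)
  have "\<exists>\<beta>. bij_betw \<beta> (nbrs T' t) (nbrs T' (\<pi> t)) \<and> \<beta> v = v \<and>
      evenperm (recolor j (nbrs T' t) \<beta>) = even_at0 h (\<alpha> t) \<and>
      (t = p \<longrightarrow> (\<forall>w\<in>nbrs T' p. \<beta> w = \<phi> w)) \<and> (t = p2 \<longrightarrow> \<beta> u = u')" if t: "t \<in> nbrs T' v" for t
  proof (cases "t = p")
    case True
    then show ?thesis using \<phi> h(4) \<pi>p p by blast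
  next
    case False
    have \<pi>t: "\<pi> t \<in> nbrs T' v" using bij_betwE[OF \<pi>] t by blast
    note fin = finite_child_nbrs[OF rooted t] finite_child_nbrs[OF rooted \<pi>t]
    note card = card_child_nbrs_ge[OF t] card_child_nbrs_ge[OF \<pi>t]
    note root = root_in_child_nbrs[OF rooted t] root_in_child_nbrs[OF rooted \<pi>t]
    \<comment> \<open>At a child other than \<open>p2\<close> the pair is arbitrary; it only allows
      both cases to be treated alike.\<close>
    have "\<exists>s s'. s \<in> nbrs T' t \<and> s \<noteq> v \<and> s' \<in> nbrs T' (\<pi> t) \<and> s' \<noteq> v \<and> (t = p2 \<longrightarrow> s = u \<and> s' = u')"
    proof (cases "t = p2")
      case True
      then show ?thesis using u \<pi>p by blast
    next
      case False
      have "2 \<le> card (nbrs T' t - {v})" "2 \<le> card (nbrs T' (\<pi> t) - {v})" using fin card root d1 by simp_all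
      then show ?thesis using False two_elements by (metis DiffE singletonI)
    qed
    then obtain s s' where s: "s \<in> nbrs T' t" "s \<noteq> v" "s' \<in> nbrs T' (\<pi> t)" "s' \<noteq> v" "t = p2 \<longrightarrow> s = u \<and> s' = u'"
      by blast
    obtain \<beta> where \<beta>: "bij_betw \<beta> (nbrs T' t) (nbrs T' (\<pi> t))" "\<beta> v = v" "\<beta> s = s'"
      using bij_with_values[OF fin _ root(1) s(1) s(2)[symmetric] root(2) s(3) s(4)[symmetric]] card by metis
    \<comment> \<open>This is where \<open>4 \<le> d\<^sub>1\<close> is essential: the root and
      \<open>s\<close> are to keep their images, and two further vertices are needed for a
      transposition.\<close>
    have "2 \<le> card (nbrs T' t - {v, s})" using fin card root s d1 by simp
    from bij_with_parity_on[OF coloring_child[OF t] \<beta>(1) coloring_child[OF \<pi>t] _ this, of "even_at0 h (\<alpha> t)"]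
    obtain \<beta>' where "bij_betw \<beta>' (nbrs T' t) (nbrs T' (\<pi> t))" "\<And>x. x \<in> {v, s} \<Longrightarrow> \<beta>' x = \<beta> x"
      "evenperm (recolor j (nbrs T' t) \<beta>') = even_at0 h (\<alpha> t)" by (metis finite_atLeastAtMost)
    then show ?thesis using \<beta> s(5) False by (intro exI[of _ \<beta>']) auto
  qed
  then obtain \<beta> where \<beta>: "\<And>t. t \<in> nbrs T' v \<Longrightarrow> bij_betw (\<beta> t) (nbrs T' t) (nbrs T' (\<pi> t)) \<and> \<beta> t v = v \<and>
      evenperm (recolor j (nbrs T' t) (\<beta> t)) = even_at0 h (\<alpha> t) \<and>
      (t = p \<longrightarrow> (\<forall>w\<in>nbrs T' p. \<beta> t w = \<phi> w)) \<and> (t = p2 \<longrightarrow> \<beta> t u = u')" by metis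
  from rooted_aut_exists[OF rooted \<pi>, of \<beta>] \<beta> obtain g where g: "g \<in> rooted_aut T' v"
    "\<And>t. t \<in> nbrs T' v \<Longrightarrow> g t = \<pi> t" "\<And>t w. t \<in> nbrs T' v \<Longrightarrow> w \<in> nbrs T' t \<Longrightarrow> g w = \<beta> t w" by metis
  have "parity_related g h"
    unfolding parity_related_def
  proof (intro conjI ballI)
    fix t assume t: "t \<in> nbrs T' v"
    have "h (\<alpha> t) \<in> nbrs T\<^sub>0 v\<^sub>0" using rooted_aut_child[OF rooted0 hr alpha_in[OF t]] .
    then show "h (\<alpha> t) = \<alpha> (g t)" using g(2)[OF t] \<alpha>\<alpha>' by (simp add: \<pi>_def)
    have "recolor j (nbrs T' t) g = recolor j (nbrs T' t) (\<beta> t)" using g(3)[OF t] by (rule recolor_cong)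
    then show "even_at0 h (\<alpha> t) = even_at g t" using \<beta>[OF t] by (simp add: even_at_def)
  qed (rule hr)
  then have "g \<in> model_group" using g(1) h(1) unfolding mem_model_group by blast
  moreover have "g w = \<phi> w" if "w \<in> nbrs T' p" for w using g(3)[OF p(1) that] \<beta>[OF p(1)] that by simp
  moreover have "g u = u'" using g(3)[OF p(2) u(1)] \<beta>[OF p(2)] by simp
  ultimately show ?thesis using that g(2) p \<pi>p by simp
qed

end

section \<open>Local actions\<close>

lemma ray_edge: "\<rho> \<in> rays T \<Longrightarrow> (\<rho> n, \<rho> (Suc n)) \<in> edges T"
  by (simp add: rays_def)

lemma ray_inj: "\<rho> \<in> rays T \<Longrightarrow> \<rho> m = \<rho> n \<longleftrightarrow> m = n"
  by (auto simp: rays_def inj_eq)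

lemma bij_betw_left_inverse:
  assumes "bij_betw f A B" "\<And>a. a \<in> A \<Longrightarrow> g (f a) = a"
  shows "bij_betw g B A"
proof (rule bij_betw_byWitness[where f' = f])
  show "\<forall>b\<in>B. f (g b) = b" "g ` B \<subseteq> A"
    using assms bij_betw_imp_surj_on[OF assms(1)] by force+
qed (use assms in \<open>auto simp: bij_betw_def\<close>)

locale semiregular_setup = parity_setup +
  fixes T :: "'v ugraph" and V\<^sub>0 V\<^sub>1 :: "'v set" and J :: "'v \<Rightarrow> 'v \<Rightarrow> 'a"
  assumes semireg: "semiregular_tree T V\<^sub>0 V\<^sub>1 4 d\<^sub>1"
    and J_iso: "\<And>x. x \<in> V\<^sub>0 \<Longrightarrow> rooted_iso (J x) (induced T (gball T x 2)) x T' v"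
begin

lemma tree: "tree_graph T"
  using semireg by (simp add: semiregular_tree_def)

lemma V_verts: "V\<^sub>0 \<union> V\<^sub>1 = verts T"
  using semireg by (simp add: semiregular_tree_def)

lemma V_disjoint: "x \<in> V\<^sub>0 \<Longrightarrow> x \<notin> V\<^sub>1"
  using semireg by (auto simp: semiregular_tree_def)

lemma V0_vert: "x \<in> V\<^sub>0 \<Longrightarrow> x \<in> verts T" and V1_vert: "x \<in> V\<^sub>1 \<Longrightarrow> x \<in> verts T"
  using V_verts by auto

lemma edge_V: "(x, y) \<in> edges T \<Longrightarrow> x \<in> V\<^sub>0 \<longleftrightarrow> y \<in> V\<^sub>1" "(x, y) \<in> edges T \<Longrightarrow> x \<in> V\<^sub>1 \<longleftrightarrow> y \<in> V\<^sub>0"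
  using semireg by (auto simp: semiregular_tree_def)

lemma card_nbrs_V0: "x \<in> V\<^sub>0 \<Longrightarrow> finite (nbrs T x)" "x \<in> V\<^sub>0 \<Longrightarrow> card (nbrs T x) = 4"
  using semireg gsphere_1[OF tree V0_vert] by (auto simp: semiregular_tree_def)

lemma card_nbrs_V1: "x \<in> V\<^sub>1 \<Longrightarrow> finite (nbrs T x)" "x \<in> V\<^sub>1 \<Longrightarrow> card (nbrs T x) = d\<^sub>1"
  using semireg gsphere_1[OF tree V1_vert] by (auto simp: semiregular_tree_def)

abbreviation ball2 :: "'v \<Rightarrow> 'v set" where "ball2 x \<equiv> gball T x 2"

lemma ball2_self: "x \<in> V\<^sub>0 \<Longrightarrow> x \<in> ball2 x"
  using gball_2[OF tree V0_vert] by simp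

lemma ball2_nbrs: "x \<in> V\<^sub>0 \<Longrightarrow> nbrs T x \<subseteq> ball2 x"
  using gball_2[OF tree V0_vert, of x] by auto

lemma ball2_nbrs2: "x \<in> V\<^sub>0 \<Longrightarrow> y \<in> nbrs T x \<Longrightarrow> nbrs T y \<subseteq> ball2 x"
  using gball_2[OF tree V0_vert, of x] by auto

lemma ball2_cases [consumes 2, case_names self nbr nbr2]:
  assumes "x \<in> V\<^sub>0" "a \<in> ball2 x"
  obtains "a = x" | "a \<in> nbrs T x" | y where "y \<in> nbrs T x" "a \<in> nbrs T y"
  using assms(2) unfolding gball_2[OF tree V0_vert[OF assms(1)]] by blast

lemma bij_J: "x \<in> V\<^sub>0 \<Longrightarrow> bij_betw (J x) (ball2 x) (verts T')"
  using J_iso[of x] by (simp add: rooted_iso_def induced_def)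

lemma J_root: "x \<in> V\<^sub>0 \<Longrightarrow> J x x = v"
  using J_iso[of x] by (simp add: rooted_iso_def)

lemma J_edge: "x \<in> V\<^sub>0 \<Longrightarrow> a \<in> ball2 x \<Longrightarrow> b \<in> ball2 x \<Longrightarrow> (J x a, J x b) \<in> edges T' \<longleftrightarrow> (a, b) \<in> edges T"
  using J_iso[of x] by (simp add: rooted_iso_def induced_def)

lemma J_in: "x \<in> V\<^sub>0 \<Longrightarrow> a \<in> ball2 x \<Longrightarrow> J x a \<in> verts T'"
  using bij_betwE[OF bij_J] by blast

definition J_inv :: "'v \<Rightarrow> 'a \<Rightarrow> 'v" where
  "J_inv x = inv_into (ball2 x) (J x)"

lemma J_inv_J [simp]: "x \<in> V\<^sub>0 \<Longrightarrow> a \<in> ball2 x \<Longrightarrow> J_inv x (J x a) = a"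
  unfolding J_inv_def using bij_betw_inv_into_left[OF bij_J] by blast

lemma J_J_inv [simp]: "x \<in> V\<^sub>0 \<Longrightarrow> w \<in> verts T' \<Longrightarrow> J x (J_inv x w) = w"
  unfolding J_inv_def using bij_betw_inv_into_right[OF bij_J] by blast

lemma J_inv_in: "x \<in> V\<^sub>0 \<Longrightarrow> w \<in> verts T' \<Longrightarrow> J_inv x w \<in> ball2 x"
  unfolding J_inv_def using bij_betwE[OF bij_betw_inv_into[OF bij_J]] by blast

text \<open>The ball of radius 2 contains the full neighbour set only for its centre and the
  neighbours of the centre.\<close>

lemma J_nbrs:
  assumes x: "x \<in> V\<^sub>0" and z: "z = x \<or> z \<in> nbrs T x"
  shows "bij_betw (J x) (nbrs T z) (nbrs T' (J x z))"
proof -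
  have sub: "nbrs T z \<subseteq> ball2 x" and zb: "z \<in> ball2 x"
    using z ball2_nbrs[OF x] ball2_nbrs2[OF x] ball2_self[OF x] by blast+
  have "inj_on (J x) (nbrs T z)" using bij_J[OF x] sub by (meson bij_betw_imp_inj_on inj_on_subset)
  moreover have "J x ` nbrs T z = nbrs T' (J x z)"
  proof
    show "J x ` nbrs T z \<subseteq> nbrs T' (J x z)" using J_edge[OF x zb] sub by auto
    show "nbrs T' (J x z) \<subseteq> J x ` nbrs T z"
    proof
      fix w assume w: "w \<in> nbrs T' (J x z)"
      then have wv: "w \<in> verts T'" using edge_verts[OF rooted_tree[OF rooted]] by auto
      have "J_inv x w \<in> nbrs T z" using J_edge[OF x zb J_inv_in[OF x wv]] w x wv by simp
      then show "w \<in> J x ` nbrs T z" using J_J_inv[OF x wv] by (metis imageI)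
    qed
  qed
  ultimately show ?thesis by (simp add: bij_betw_def)
qed

section \<open>Local actions of maps that need not be automorphisms\<close>

abbreviation local_act :: "('v \<Rightarrow> 'v) \<Rightarrow> 'v \<Rightarrow> 'a \<Rightarrow> 'a" where
  "local_act F x \<equiv> local_action T T' J F x"

lemma local_act_J: "x \<in> V\<^sub>0 \<Longrightarrow> a \<in> ball2 x \<Longrightarrow> local_act F x (J x a) = J (F x) (F a)"
  using J_in J_inv_J by (simp add: local_action_def J_inv_def)

lemma local_act_outside: "w \<notin> verts T' \<Longrightarrow> local_act F x w = w"
  by (simp add: local_action_def)

lemma local_act_eqI:
  assumes "x \<in> V\<^sub>0" "\<And>w. w \<notin> verts T' \<Longrightarrow> h w = w" "\<And>a. a \<in> ball2 x \<Longrightarrow> h (J x a) = J (F x) (F a)"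
  shows "local_act F x = h"
proof
  fix w
  show "local_act F x w = h w"
  proof (cases "w \<in> verts T'")
    case True
    then show ?thesis
      using local_act_J[OF assms(1) J_inv_in[OF assms(1) True]] assms(3)[OF J_inv_in[OF assms(1) True]]
        J_J_inv[OF assms(1) True] by simp
  qed (simp add: assms(2) local_act_outside)
qed

lemma local_act_cong:
  assumes "x \<in> V\<^sub>0" "\<And>a. a \<in> ball2 x \<Longrightarrow> F a = F' a"
  shows "local_act F x = local_act F' x"
  using assms(1) local_act_outside
proof (rule local_act_eqI)
  show "local_act F' x (J x a) = J (F x) (F a)" if "a \<in> ball2 x" for a
    using local_act_J[OF assms(1) that, of F'] assms(2)[OF that] assms(2)[OF ball2_self[OF assms(1)]] by simp
qed

text \<open>\<open>F\<close> stands for a partial map on the ball around \<open>x\<close>; its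
  values elsewhere are irrelevant. Mapping the ball into a ball makes it recoverable from its local
  action through \<open>J_inv\<close>.\<close>

definition local_elt :: "'v \<Rightarrow> ('v \<Rightarrow> 'v) \<Rightarrow> bool" where
  "local_elt x F \<longleftrightarrow> F x \<in> V\<^sub>0 \<and> (\<forall>a\<in>ball2 x. F a \<in> ball2 (F x)) \<and> local_act F x \<in> model_group"

lemma local_elt_cong:
  assumes "x \<in> V\<^sub>0" "\<And>a. a \<in> ball2 x \<Longrightarrow> F a = F' a" "local_elt x F"
  shows "local_elt x F'"
  using assms local_act_cong[OF assms(1,2)] ball2_self[OF assms(1)] unfolding local_elt_def by auto

lemma local_elt_nbrs:
  assumes x: "x \<in> V\<^sub>0" and F: "local_elt x F" and z: "z = x \<or> z \<in> nbrs T x"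
  shows "bij_betw F (nbrs T z) (nbrs T (F z))"
proof -
  let ?h = "local_act F x"
  have Fx: "F x \<in> V\<^sub>0" and Fb: "\<And>a. a \<in> ball2 x \<Longrightarrow> F a \<in> ball2 (F x)" and h: "?h \<in> rooted_aut T' v"
    using F model_group_rooted_aut by (auto simp: local_elt_def)
  have eq: "F a = (J_inv (F x) \<circ> (?h \<circ> J x)) a" if "a \<in> ball2 x" for a
    using local_act_J[OF x that, of F] J_inv_J[OF Fx Fb[OF that]] by simp
  \<comment> \<open>The assumption on \<open>F z\<close> is trivial for \<open>z = x\<close>. That
    case yields it for the neighbours of \<open>x\<close>, to which the statement is then applied
    again.\<close>
  have main: "bij_betw F (nbrs T z) (nbrs T (F z))" if z: "z = x \<or> z \<in> nbrs T x" and Fz: "F z = F x \<or> F z \<in> nbrs T (F x)" for z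
  proof -
    have zb: "z \<in> ball2 x" and sub: "nbrs T z \<subseteq> ball2 x"
      using z ball2_self[OF x] ball2_nbrs[OF x] ball2_nbrs2[OF x] by blast+
    have 1: "bij_betw (J x) (nbrs T z) (nbrs T' (J x z))" using J_nbrs[OF x z] .
    have 2: "bij_betw ?h (nbrs T' (J x z)) (nbrs T' (?h (J x z)))"
      using graph_aut_nbrs[OF rooted_tree[OF rooted] _ J_in[OF x zb]] h by (simp add: rooted_aut_def)
    have 3: "bij_betw (J (F x)) (nbrs T (F z)) (nbrs T' (?h (J x z)))"
      using J_nbrs[OF Fx Fz] local_act_J[OF x zb, of F] by simp
    have sub': "nbrs T (F z) \<subseteq> ball2 (F x)" using Fz ball2_nbrs[OF Fx] ball2_nbrs2[OF Fx] by metis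
    have 4: "bij_betw (J_inv (F x)) (nbrs T' (?h (J x z))) (nbrs T (F z))"
      using 3 by (rule bij_betw_left_inverse) (use sub' Fx in auto)
    have "bij_betw (J_inv (F x) \<circ> (?h \<circ> J x)) (nbrs T z) (nbrs T (F z))"
      using bij_betw_trans[OF bij_betw_trans[OF 1 2] 4] .
    then show ?thesis using eq sub by (subst bij_betw_cong[where g = "J_inv (F x) \<circ> (?h \<circ> J x)"]) auto
  qed
  show ?thesis
  proof (cases "z = x")
    case False
    then have "F z \<in> nbrs T (F x)" using bij_betwE[OF main[of x]] z by simp
    then show ?thesis using main z by blast
  qed (use main in simp)
qed

text \<open>The extension property of the model group carried over by \<open>J x\<close> and
  \<open>J x'\<close>. The condition \<open>\<phi> x = x'\<close> becomes the fixing of the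
  root.\<close>

lemma local_extension:
  assumes x: "x \<in> V\<^sub>0" "x' \<in> V\<^sub>0" and y: "y \<in> nbrs T x" "y2 \<in> nbrs T x" "y \<noteq> y2"
    and y': "y' \<in> nbrs T x'" "y2' \<in> nbrs T x'" "y' \<noteq> y2'"
    and \<phi>: "bij_betw \<phi> (nbrs T y) (nbrs T y')" "\<phi> x = x'"
    and u: "u \<in> nbrs T y2" "u \<noteq> x" "u' \<in> nbrs T y2'" "u' \<noteq> x'"
  obtains F where "local_elt x F" "F x = x'" "F y = y'" "F y2 = y2'" "\<And>w. w \<in> nbrs T y \<Longrightarrow> F w = \<phi> w" "F u = u'"
proof -
  have inb: "x \<in> ball2 x" "y \<in> ball2 x" "y2 \<in> ball2 x" "u \<in> ball2 x"
    and inb': "x' \<in> ball2 x'" "y' \<in> ball2 x'" "y2' \<in> ball2 x'" "u' \<in> ball2 x'"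
    using ball2_self ball2_nbrs ball2_nbrs2 x y y' u by blast+
  note sub = ball2_nbrs2[OF x(1) y(1)] and sub' = ball2_nbrs2[OF x(2) y'(1)]
  have injJ: "J t a = J t b \<longleftrightarrow> a = b" if "t \<in> V\<^sub>0" "a \<in> ball2 t" "b \<in> ball2 t" for t a b
    using bij_betw_imp_inj_on[OF bij_J] that by (auto simp: inj_on_def)
  have Jx: "bij_betw (J x) (nbrs T x) (nbrs T' v)" "bij_betw (J x') (nbrs T x') (nbrs T' v)"
    using J_nbrs[OF x(1), of x] J_nbrs[OF x(2), of x'] J_root x by simp_all
  have Jy: "bij_betw (J x) (nbrs T y) (nbrs T' (J x y))" "bij_betw (J x) (nbrs T y2) (nbrs T' (J x y2))"
    "bij_betw (J x') (nbrs T y') (nbrs T' (J x' y'))" "bij_betw (J x') (nbrs T y2') (nbrs T' (J x' y2'))"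
    using J_nbrs x y y' by blast+
  define \<phi>' where "\<phi>' = J x' \<circ> (\<phi> \<circ> inv_into (nbrs T y) (J x))"
  have \<phi>'bij: "bij_betw \<phi>' (nbrs T' (J x y)) (nbrs T' (J x' y'))"
    unfolding \<phi>'_def using bij_betw_inv_into[OF Jy(1)] \<phi>(1) Jy(3) by (intro bij_betw_trans)
  have \<phi>'J: "\<phi>' (J x w) = J x' (\<phi> w)" if "w \<in> nbrs T y" for w
    using bij_betw_inv_into_left[OF Jy(1) that] by (simp add: \<phi>'_def)
  have "x \<in> nbrs T y" using y(1) edge_sym[OF tree] by simp
  then have \<phi>'v: "\<phi>' v = v" using \<phi>'J[of x] \<phi>(2) J_root x by simp
  obtain h where h: "h \<in> model_group" "h (J x y) = J x' y'" "h (J x y2) = J x' y2'"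
    "\<And>w. w \<in> nbrs T' (J x y) \<Longrightarrow> h w = \<phi>' w" "h (J x u) = J x' u'"
  proof (rule model_group_extension[OF _ _ _ _ _ _ \<phi>'bij \<phi>'v, of "J x y2" "J x' y2'" "J x u" "J x' u'"])
    show "J x y \<in> nbrs T' v" "J x y2 \<in> nbrs T' v" using bij_betwE[OF Jx(1)] y by blast+
    show "J x' y' \<in> nbrs T' v" "J x' y2' \<in> nbrs T' v" using bij_betwE[OF Jx(2)] y' by blast+
    show "J x y \<noteq> J x y2" "J x' y' \<noteq> J x' y2'" using injJ x inb inb' y y' by simp_all
    show "J x u \<in> nbrs T' (J x y2)" "J x' u' \<in> nbrs T' (J x' y2')"
      using bij_betwE[OF Jy(2)] bij_betwE[OF Jy(4)] u by blast+
    show "J x u \<noteq> v" using injJ[OF x(1) inb(4,1)] u J_root[OF x(1)] by simp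
    show "J x' u' \<noteq> v" using injJ[OF x(2) inb'(4,1)] u J_root[OF x(2)] by simp
  qed (rule that)
  define F where "F a = J_inv x' (h (J x a))" for a
  have hr: "h \<in> graph_aut T'" "h v = v" using model_group_rooted_aut[OF h(1)] by (simp_all add: rooted_aut_def)
  have hin: "h (J x a) \<in> verts T'" if "a \<in> ball2 x" for a
    using graph_aut_verts[OF hr(1) J_in[OF x(1) that]] .
  have Fx: "F x = x'"
    using J_inv_J[OF x(2) inb'(1)] J_root[OF x(1)] J_root[OF x(2)] hr by (simp add: F_def)
  have "local_act F x = h"
  proof (rule local_act_eqI[OF x(1)])
    show "h w = w" if "w \<notin> verts T'" for w using graph_aut_outside[OF hr(1) that] .
    show "h (J x a) = J (F x) (F a)" if "a \<in> ball2 x" for a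
      using J_J_inv[OF x(2) hin[OF that]] Fx by (simp add: F_def)
  qed
  then have "local_elt x F"
    using h(1) Fx x J_inv_in[OF x(2) hin] unfolding local_elt_def F_def by simp
  moreover have "F y = y'" "F y2 = y2'" "F u = u'" using h inb' x by (simp_all add: F_def)
  moreover have "F w = \<phi> w" if w: "w \<in> nbrs T y" for w
  proof -
    have "h (J x w) = J x' (\<phi> w)" using h(4) \<phi>'J[OF w] bij_betwE[OF Jy(1)] w by auto
    moreover have "\<phi> w \<in> ball2 x'" using bij_betwE[OF \<phi>(1)] w sub' by blast
    ultimately show ?thesis using x by (simp add: F_def)
  qed
  ultimately show ?thesis using that Fx by blast
qed

end

section \<open>Extending a map between lines\<close>

text \<open>A line is encoded by two rays from a common vertex of \<open>V\<^sub>0\<close> with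
  different first steps; the primed rays form the target line.\<close>

locale line_setup = semiregular_setup +
  fixes \<rho> \<tau> \<rho>' \<tau>' :: "nat \<Rightarrow> 'c" and x0 x0' :: 'c
  assumes rays: "\<rho> \<in> rays T" "\<tau> \<in> rays T" "\<rho>' \<in> rays T" "\<tau>' \<in> rays T"
    and start: "\<rho> 0 = x0" "\<tau> 0 = x0" "\<rho>' 0 = x0'" "\<tau>' 0 = x0'"
    and diverge: "\<rho> 1 \<noteq> \<tau> 1" "\<rho>' 1 \<noteq> \<tau>' 1"
    and start_V0: "x0 \<in> V\<^sub>0" "x0' \<in> V\<^sub>0"
begin

section \<open>The tree rooted at the starting vertex: levels, parents and rays\<close>

definition lev :: "'c \<Rightarrow> nat" where "lev x = gdist T x0 x"

text \<open>At \<open>x0\<close> no such neighbour exists and the value is arbitrary, hence the side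
  conditions \<open>x \<noteq> x0\<close> below.\<close>

definition par :: "'c \<Rightarrow> 'c" where "par x = (THE y. (x, y) \<in> edges T \<and> lev x = Suc (lev y))"

lemma x0_vert: "x0 \<in> verts T"
  using start_V0 V0_vert by blast

lemma relpow_parity: "(x0, x) \<in> edges T ^^ n \<Longrightarrow> x \<in> V\<^sub>0 \<longleftrightarrow> even n"
proof (induction n arbitrary: x)
  case 0
  then show ?case using start_V0 by auto
next
  case (Suc n)
  then obtain y where y: "(x0, y) \<in> edges T ^^ n" "(y, x) \<in> edges T" by auto
  then have "x \<in> V\<^sub>0 \<longleftrightarrow> y \<in> V\<^sub>1" "y \<in> verts T" using edge_V[of y x] edge_verts[OF tree, of y x] by auto
  then show ?case using Suc.IH[OF y(1)] V_disjoint[of y] V_verts by auto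
qed

lemma lev_parity: "x \<in> verts T \<Longrightarrow> x \<in> V\<^sub>0 \<longleftrightarrow> even (lev x)"
  unfolding lev_def using relpow_parity gdist_pow[OF tree x0_vert] by blast

text \<open>Adjacent levels differ by at most one, and equality would contradict the bipartition,
  which is the parity of the level.\<close>

lemma lev_edge:
  assumes "(x, y) \<in> edges T"
  shows "lev y = Suc (lev x) \<or> lev x = Suc (lev y)"
proof -
  have v: "x \<in> verts T" "y \<in> verts T" using edge_verts[OF tree] assms by auto
  have "lev b \<le> Suc (lev a)" if "(a, b) \<in> edges T" "a \<in> verts T" for a b
    unfolding lev_def using that gdist_pow[OF tree x0_vert that(2)]
    by (intro gdist_le[OF tree]) auto
  from this[OF assms v(1)] this[OF edge_sym[OF tree assms] v(2)]
  have "lev y \<le> Suc (lev x)" "lev x \<le> Suc (lev y)" .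
  moreover have "lev x \<noteq> lev y"
    using lev_parity[OF v(1)] lev_parity[OF v(2)] edge_V[OF assms] V_disjoint[of x] V_disjoint[of y] V_verts v by auto
  ultimately show ?thesis by linarith
qed

lemma par_eq: "(x, y) \<in> edges T \<Longrightarrow> lev x = Suc (lev y) \<Longrightarrow> par x = y"
  unfolding par_def using gdist_parent_unique[OF tree x0_vert, of x] by (intro the_equality) (auto simp: lev_def)

lemma lev_0: "x \<in> verts T \<Longrightarrow> lev x = 0 \<longleftrightarrow> x = x0"
  unfolding lev_def using gdist_eq_0[OF tree x0_vert] by metis

lemma par_in:
  assumes "x \<in> verts T" "x \<noteq> x0"
  shows "(x, par x) \<in> edges T" "lev x = Suc (lev (par x))"
proof -
  obtain n where n: "lev x = Suc n" using lev_0[OF assms(1)] assms(2) not0_implies_Suc by blast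
  then have "(x0, x) \<in> edges T ^^ Suc n" using gdist_pow[OF tree x0_vert assms(1)] by (simp add: lev_def)
  then obtain y where y: "(x0, y) \<in> edges T ^^ n" "(y, x) \<in> edges T" by auto
  then have "lev y \<le> n" unfolding lev_def by (intro gdist_le[OF tree])
  then have "lev x = Suc (lev y)" using lev_edge[OF y(2)] n by linarith
  moreover have e: "(x, y) \<in> edges T" using edge_sym[OF tree y(2)] .
  ultimately have "par x = y" using par_eq by blast
  then show "(x, par x) \<in> edges T" "lev x = Suc (lev (par x))" using e \<open>lev x = Suc (lev y)\<close> by auto
qed

lemma edge_par: "(x, y) \<in> edges T \<Longrightarrow> (par x = y \<and> x \<noteq> x0) \<or> (par y = x \<and> y \<noteq> x0)"
  using lev_edge[of x y] par_eq[of x y] par_eq[of y x] edge_sym[OF tree, of x y] lev_0[OF x0_vert] by auto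

text \<open>A ray that has moved away from \<open>x0\<close> can come closer only through the
  parent, the vertex it has just left. The induction therefore carries two consecutive
  levels.\<close>

lemma ray_lev:
  assumes "\<sigma> \<in> rays T" "\<sigma> 0 = x0"
  shows "lev (\<sigma> n) = n"
proof -
  have "lev (\<sigma> n) = n \<and> lev (\<sigma> (Suc n)) = Suc n"
  proof (induction n)
    case 0
    have "lev x0 = 0" using lev_0[OF x0_vert] by simp
    then show ?case using lev_edge[OF ray_edge[OF assms(1), of 0]] assms(2) by auto
  next
    case (Suc n)
    note e = ray_edge[OF assms(1), of n] ray_edge[OF assms(1), of "Suc n"]
    have "lev (\<sigma> (Suc n)) \<noteq> Suc (lev (\<sigma> (Suc (Suc n))))"
      using par_eq[OF e(2)] par_eq[OF edge_sym[OF tree e(1)]] Suc ray_inj[OF assms(1), of n "Suc (Suc n)"] by auto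
    then show ?case using lev_edge[OF e(2)] Suc by auto
  qed
  then show ?thesis by blast
qed

lemma ray_par: "\<sigma> \<in> rays T \<Longrightarrow> \<sigma> 0 = x0 \<Longrightarrow> par (\<sigma> (Suc n)) = \<sigma> n"
  using ray_lev par_eq[OF edge_sym[OF tree ray_edge]] by simp

text \<open>A common vertex has the same index on both rays, namely its level; taking parents moves
  the coincidence down to index 1, where the rays differ.\<close>

lemma rays_disjoint:
  assumes "\<rho> m = \<tau> n"
  shows "m = 0 \<and> n = 0"
proof -
  have mn: "m = n" using assms ray_lev[OF rays(1) start(1), of m] ray_lev[OF rays(2) start(2), of n] by simp
  have "\<rho> (Suc k) \<noteq> \<tau> (Suc k)" for k
  proof (induction k)
    case (Suc k)
    then show ?case using ray_par[OF rays(1) start(1)] ray_par[OF rays(2) start(2)] by metis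
  qed (use diverge in simp)
  then show ?thesis using assms mn by (cases n) auto
qed

lemma ray_V0:
  assumes "\<sigma> \<in> rays T" "\<sigma> 0 = x0"
  shows "\<sigma> n \<in> V\<^sub>0 \<longleftrightarrow> even n"
  using lev_parity[of "\<sigma> n"] ray_lev[OF assms] edge_verts[OF tree ray_edge[OF assms(1)]] by simp

section \<open>Local elements compatible with the two rays, and one step of the extension\<close>

text \<open>The condition is vacuous off the ray. Its third vertex is the next centre on the ray, so
  that the following step starts with the correct image.\<close>

definition compat1 :: "(nat \<Rightarrow> 'c) \<Rightarrow> (nat \<Rightarrow> 'c) \<Rightarrow> 'c \<Rightarrow> ('c \<Rightarrow> 'c) \<Rightarrow> bool" where
  "compat1 \<sigma> \<sigma>' x F \<longleftrightarrow> (\<forall>k. x = \<sigma> (2 * k) \<longrightarrow> F (\<sigma> (2 * k)) = \<sigma>' (2 * k) \<and>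
     F (\<sigma> (Suc (2 * k))) = \<sigma>' (Suc (2 * k)) \<and> F (\<sigma> (Suc (Suc (2 * k)))) = \<sigma>' (Suc (Suc (2 * k))))"

definition compat :: "'c \<Rightarrow> ('c \<Rightarrow> 'c) \<Rightarrow> bool" where
  "compat x F \<longleftrightarrow> compat1 \<rho> \<rho>' x F \<and> compat1 \<tau> \<tau>' x F"

lemma compat1I:
  assumes "\<sigma> \<in> rays T" "F (\<sigma> (2 * k)) = \<sigma>' (2 * k)" "F (\<sigma> (Suc (2 * k))) = \<sigma>' (Suc (2 * k))"
    "F (\<sigma> (Suc (Suc (2 * k)))) = \<sigma>' (Suc (Suc (2 * k)))"
  shows "compat1 \<sigma> \<sigma>' (\<sigma> (2 * k)) F"
  unfolding compat1_def using assms ray_inj[OF assms(1)] by auto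

lemma compat1_vacuous: "x \<notin> range \<sigma> \<Longrightarrow> compat1 \<sigma> \<sigma>' x F"
  by (auto simp: compat1_def)

lemma bij_exists_V1:
  assumes "y \<in> V\<^sub>1" "y' \<in> V\<^sub>1" "a \<in> nbrs T y" "b \<in> nbrs T y" "a \<noteq> b" "a' \<in> nbrs T y'" "b' \<in> nbrs T y'" "a' \<noteq> b'"
  obtains \<phi> where "bij_betw \<phi> (nbrs T y) (nbrs T y')" "\<phi> a = a'" "\<phi> b = b'"
proof -
  have "card (nbrs T y) = card (nbrs T y')" using card_nbrs_V1(2) assms(1,2) by simp
  from bij_with_values[OF card_nbrs_V1(1)[OF assms(1)] card_nbrs_V1(1)[OF assms(2)] this assms(3-8)] that
  show ?thesis by blast
qed

text \<open>Both rays leave the first ball: \<open>\<rho>\<close> is served by the prescribed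
  bijection on the sphere around \<open>\<rho> 1\<close>, and \<open>\<tau>\<close> by the
  additional vertex \<open>u\<close>.\<close>

lemma base_step: "\<exists>F. local_elt x0 F \<and> compat x0 F"
proof -
  note e = ray_edge[OF rays(1)] ray_edge[OF rays(2)] ray_edge[OF rays(3)] ray_edge[OF rays(4)]
  have r: "\<rho> (Suc 0) \<in> nbrs T x0" "\<tau> (Suc 0) \<in> nbrs T x0" "\<rho>' (Suc 0) \<in> nbrs T x0'" "\<tau>' (Suc 0) \<in> nbrs T x0'"
    using e[of 0] start by auto
  have rV: "\<rho> (Suc 0) \<in> V\<^sub>1" "\<rho>' (Suc 0) \<in> V\<^sub>1" using r edge_V start_V0 by auto
  have r2: "\<rho> 2 \<in> nbrs T (\<rho> (Suc 0))" "\<tau> 2 \<in> nbrs T (\<tau> (Suc 0))" "\<rho>' 2 \<in> nbrs T (\<rho>' (Suc 0))" "\<tau>' 2 \<in> nbrs T (\<tau>' (Suc 0))"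
    using e[of "Suc 0"] by (auto simp: numeral_2_eq_2)
  have n2: "x0 \<noteq> \<rho> 2" "x0' \<noteq> \<rho>' 2" "\<tau> 2 \<noteq> x0" "\<tau>' 2 \<noteq> x0'"
    using ray_inj[OF rays(1), of 0 2] ray_inj[OF rays(2), of 2 0] ray_inj[OF rays(3), of 0 2] ray_inj[OF rays(4), of 2 0] start by auto
  have b: "x0 \<in> nbrs T (\<rho> (Suc 0))" "x0' \<in> nbrs T (\<rho>' (Suc 0))" using r edge_sym[OF tree] by auto
  obtain \<phi> where \<phi>: "bij_betw \<phi> (nbrs T (\<rho> (Suc 0))) (nbrs T (\<rho>' (Suc 0)))" "\<phi> x0 = x0'" "\<phi> (\<rho> 2) = \<rho>' 2"
    using bij_exists_V1[OF rV b(1) r2(1) n2(1) b(2) r2(3) n2(2)] .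
  obtain F where F: "local_elt x0 F" "F x0 = x0'" "F (\<rho> (Suc 0)) = \<rho>' (Suc 0)" "F (\<tau> (Suc 0)) = \<tau>' (Suc 0)"
    "\<And>w. w \<in> nbrs T (\<rho> (Suc 0)) \<Longrightarrow> F w = \<phi> w" "F (\<tau> 2) = \<tau>' 2"
    by (rule local_extension[OF start_V0 r(1,2) diverge(1)[unfolded One_nat_def] r(3,4) diverge(2)[unfolded One_nat_def]
        \<phi>(1,2) r2(2) n2(3) r2(4) n2(4)]) (rule that)
  have "compat1 \<rho> \<rho>' x0 F"
    using compat1I[OF rays(1), of F 0 \<rho>'] F(2,3) F(5)[OF r2(1)] \<phi>(3) start by (simp add: numeral_2_eq_2)
  moreover have "compat1 \<tau> \<tau>' x0 F"
    using compat1I[OF rays(2), of F 0 \<tau>'] F(2,4,6) start by (simp add: numeral_2_eq_2)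
  ultimately show ?thesis using F(1) by (auto simp: compat_def)
qed

text \<open>The set in question is the intersection of the balls of radius 2 around \<open>x\<close>
  and around its grandparent.\<close>

definition extends :: "'c \<Rightarrow> ('c \<Rightarrow> 'c) \<Rightarrow> ('c \<Rightarrow> 'c) \<Rightarrow> bool" where
  "extends x E F \<longleftrightarrow> (\<forall>a\<in>insert (par x) (nbrs T (par x)). F a = E a)"

lemma grandparent:
  assumes x: "x \<in> V\<^sub>0" "x \<noteq> x0"
  shows "par x \<in> V\<^sub>1" "x \<in> nbrs T (par x)" "par x \<in> nbrs T x"
    "par (par x) \<in> V\<^sub>0" "par x \<in> nbrs T (par (par x))" "lev (par (par x)) < lev x"
proof -
  note p = par_in[OF V0_vert[OF x(1)] x(2)]
  show V1: "par x \<in> V\<^sub>1" using edge_V[OF p(1)] x by blast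
  then have "par x \<noteq> x0" using start_V0(1) V_disjoint[of x0] by metis
  note p2 = par_in[OF V1_vert[OF V1] this]
  show "x \<in> nbrs T (par x)" "par x \<in> nbrs T x" "par x \<in> nbrs T (par (par x))"
    using p(1) p2(1) edge_sym[OF tree] by auto
  show "par (par x) \<in> V\<^sub>0" using edge_V[OF p2(1)] V1 by blast
  show "lev (par (par x)) < lev x" using p(2) p2(2) by simp
qed

context
  fixes x E
  assumes x: "x \<in> V\<^sub>0" "x \<noteq> x0" and E: "local_elt (par (par x)) E"
begin

lemmas parents = grandparent[OF x]

lemma step_images: "E x \<in> V\<^sub>0" "E (par x) \<in> nbrs T (E x)"
  "bij_betw E (nbrs T (par x)) (nbrs T (E (par x)))"
proof -
  show b: "bij_betw E (nbrs T (par x)) (nbrs T (E (par x)))"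
    using local_elt_nbrs[OF parents(4) E] parents by blast
  have "E (par x) \<in> nbrs T (E (par (par x)))" using local_elt_nbrs[OF parents(4) E] parents bij_betwE by blast
  moreover have "E (par (par x)) \<in> V\<^sub>0" using E by (simp add: local_elt_def)
  ultimately have V1: "E (par x) \<in> V\<^sub>1" using edge_V by auto
  have e: "E x \<in> nbrs T (E (par x))" using bij_betwE[OF b] parents by blast
  then show "E x \<in> V\<^sub>0" using edge_V V1 by auto
  show "E (par x) \<in> nbrs T (E x)" using e edge_sym[OF tree] by auto
qed

text \<open>The prescribed bijection is \<open>E\<close> itself on the sphere around
  \<open>par x\<close>, which gives agreement on the overlap; the vertices \<open>y2\<close> and
  \<open>u\<close> remain at disposal.\<close>

lemma step_extension:
  assumes "y2 \<in> nbrs T x" "y2 \<noteq> par x" "y2' \<in> nbrs T (E x)" "y2' \<noteq> E (par x)"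
    and "u \<in> nbrs T y2" "u \<noteq> x" "u' \<in> nbrs T y2'" "u' \<noteq> E x"
  obtains F where "local_elt x F" "extends x E F" "F x = E x" "F y2 = y2'" "F u = u'"
proof -
  obtain F where F: "local_elt x F" "F x = E x" "F (par x) = E (par x)" "F y2 = y2'"
    "\<And>w. w \<in> nbrs T (par x) \<Longrightarrow> F w = E w" "F u = u'"
    by (rule local_extension[OF x(1) step_images(1) parents(3) assms(1) assms(2)[symmetric] step_images(2)
        assms(3) assms(4)[symmetric] step_images(3) refl assms(5-8)]) (rule that)
  then show ?thesis using that by (auto simp: extends_def)
qed

lemma step_on_ray:
  assumes \<sigma>: "\<sigma> \<in> rays T" "\<sigma> 0 = x0" and \<sigma>': "\<sigma>' \<in> rays T" and c: "compat1 \<sigma> \<sigma>' (par (par x)) E"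
    and xn: "x \<in> range \<sigma>"
  obtains F where "local_elt x F" "extends x E F" "compat1 \<sigma> \<sigma>' x F"
proof -
  obtain n where n: "x = \<sigma> n" using xn by blast
  then have "even n" "n \<noteq> 0" using ray_V0[OF \<sigma>, of n] x \<sigma>(2) by metis+
  \<comment> \<open>Centres on the ray have even index, and \<open>x \<noteq> x0\<close> excludes
    index 0; \<open>2 * k\<close> is the index of the grandparent.\<close>
  then obtain k where k: "n = 2 * Suc k" by (metis evenE mult_0_right not0_implies_Suc)
  have p: "par x = \<sigma> (Suc (2 * k))" "par (par x) = \<sigma> (2 * k)" using ray_par[OF \<sigma>] n k by simp_all
  have Ex: "E x = \<sigma>' (2 * Suc k)" "E (par x) = \<sigma>' (Suc (2 * k))"
    using c n k p unfolding compat1_def by simp_all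
  obtain F where F: "local_elt x F" "extends x E F" "F x = E x" "F (\<sigma> (Suc n)) = \<sigma>' (Suc n)"
    "F (\<sigma> (Suc (Suc n))) = \<sigma>' (Suc (Suc n))"
  proof (rule step_extension)
    show "\<sigma> (Suc n) \<in> nbrs T x" "\<sigma> (Suc (Suc n)) \<in> nbrs T (\<sigma> (Suc n))" using ray_edge[OF \<sigma>(1)] n by auto
    show "\<sigma>' (Suc n) \<in> nbrs T (E x)" "\<sigma>' (Suc (Suc n)) \<in> nbrs T (\<sigma>' (Suc n))" using ray_edge[OF \<sigma>'] Ex k by auto
    show "\<sigma> (Suc n) \<noteq> par x" "\<sigma> (Suc (Suc n)) \<noteq> x" using ray_inj[OF \<sigma>(1)] n k p by simp_all
    show "\<sigma>' (Suc n) \<noteq> E (par x)" "\<sigma>' (Suc (Suc n)) \<noteq> E x" using ray_inj[OF \<sigma>'] k Ex by simp_all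
  qed (rule that)
  have "compat1 \<sigma> \<sigma>' (\<sigma> (2 * Suc k)) F"
    using F(3-5) Ex(1) unfolding n k by (intro compat1I[OF \<sigma>(1)]) (simp_all only:)
  then show ?thesis using that F(1,2) n k by simp
qed

text \<open>A centre other than \<open>x0\<close> lies on at most one of the rays, so a single
  outgoing branch has to be controlled, as \<open>step_extension\<close> permits. Off both rays the
  prescribed images are arbitrary.\<close>

lemma step:
  assumes c: "compat (par (par x)) E"
  shows "\<exists>F. local_elt x F \<and> compat x F \<and> extends x E F"
proof -
  have disj: "x \<notin> range \<rho> \<or> x \<notin> range \<tau>"
  proof (rule ccontr)
    assume "\<not> ?thesis"
    then obtain m n where "x = \<rho> m" "x = \<tau> n" by blast
    then show False using rays_disjoint[of m n] x(2) start(1) by simp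
  qed
  consider "x \<in> range \<rho>" | "x \<in> range \<tau>" | "x \<notin> range \<rho>" "x \<notin> range \<tau>" by blast
  then show ?thesis
  proof cases
    case 1
    obtain F where "local_elt x F" "extends x E F" "compat1 \<rho> \<rho>' x F"
      using step_on_ray[OF rays(1) start(1) rays(3) _ 1] c unfolding compat_def by blast
    then show ?thesis using compat1_vacuous disj 1 unfolding compat_def by blast
  next
    case 2
    obtain F where "local_elt x F" "extends x E F" "compat1 \<tau> \<tau>' x F"
      using step_on_ray[OF rays(2) start(2) rays(4) _ 2] c unfolding compat_def by blast
    then show ?thesis using compat1_vacuous disj 2 unfolding compat_def by blast
  next
    case 3
    have other: "\<exists>b. b \<in> nbrs T t \<and> b \<noteq> a" if "2 \<le> card (nbrs T t)" for t a
      using two_elements[OF that] by metis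
    obtain y2 where y2: "y2 \<in> nbrs T x" "y2 \<noteq> par x" using other[of x "par x"] card_nbrs_V0(2)[OF x(1)] by auto
    obtain y2' where y2': "y2' \<in> nbrs T (E x)" "y2' \<noteq> E (par x)"
      using other[of "E x" "E (par x)"] card_nbrs_V0(2)[OF step_images(1)] by auto
    have V: "y2 \<in> V\<^sub>1" "y2' \<in> V\<^sub>1" using edge_V x(1) step_images(1) y2 y2' by auto
    obtain u where u: "u \<in> nbrs T y2" "u \<noteq> x" using other[of y2 x] card_nbrs_V1(2)[OF V(1)] d1 by auto
    obtain u' where u': "u' \<in> nbrs T y2'" "u' \<noteq> E x" using other[of y2' "E x"] card_nbrs_V1(2)[OF V(2)] d1 by auto
    obtain F where "local_elt x F" "extends x E F"
      using step_extension[OF y2 y2' u u'] by metis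
    then show ?thesis using compat1_vacuous 3 unfolding compat_def by blast
  qed
qed

end

section \<open>Recursion along the levels and gluing\<close>

text \<open>Choices are made by well-founded recursion on the level: the element at \<open>x\<close>
  depends only on the one at the grandparent.\<close>

lemma local_family:
  obtains \<Phi> where "\<And>x. x \<in> V\<^sub>0 \<Longrightarrow> local_elt x (\<Phi> x)" "\<And>x. x \<in> V\<^sub>0 \<Longrightarrow> compat x (\<Phi> x)"
    "\<And>x. x \<in> V\<^sub>0 \<Longrightarrow> x \<noteq> x0 \<Longrightarrow> extends x (\<Phi> (par (par x))) (\<Phi> x)"
proof -
  define P where "P \<Phi> x F \<longleftrightarrow> (x \<in> V\<^sub>0 \<longrightarrow> local_elt x F \<and> compat x F \<and> (x \<noteq> x0 \<longrightarrow> extends x (\<Phi> (par (par x))) F))"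
    for \<Phi> x F
  have "\<exists>\<Phi>. \<forall>x. P \<Phi> x (\<Phi> x)"
  proof (rule dependent_wf_choice[of "inv_image less_than lev"])
    show "P f x r = P g x r" if "\<And>z. (z, x) \<in> inv_image less_than lev \<Longrightarrow> f z = g z" for f g x r
      using that[of "par (par x)"] grandparent(6)[of x] unfolding in_inv_image less_than_iff P_def by metis
    show "\<exists>r. P f x r" if "\<And>y. (y, x) \<in> inv_image less_than lev \<Longrightarrow> P f y (f y)" for x f
    proof (cases "x \<in> V\<^sub>0 \<and> x \<noteq> x0")
      case True
      then have "P f (par (par x)) (f (par (par x)))" using that grandparent(6)[of x] unfolding in_inv_image less_than_iff by blast
      then have "local_elt (par (par x)) (f (par (par x)))" "compat (par (par x)) (f (par (par x)))"
        using grandparent(4) True unfolding P_def by blast+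
      then show ?thesis using step[of x "f (par (par x))"] True unfolding P_def by blast
    next
      case False
      then show ?thesis using base_step unfolding P_def by metis
    qed
  qed simp
  then show ?thesis using that unfolding P_def by metis
qed

lemma exists_global_element:
  obtains g where "g \<in> group_G T V\<^sub>0 V\<^sub>1 T' J model_group" "\<And>n. g (\<rho> n) = \<rho>' n" "\<And>n. g (\<tau> n) = \<tau>' n"
proof -
  obtain \<Phi> where \<Phi>: "\<And>x. x \<in> V\<^sub>0 \<Longrightarrow> local_elt x (\<Phi> x)" "\<And>x. x \<in> V\<^sub>0 \<Longrightarrow> compat x (\<Phi> x)"
    "\<And>x. x \<in> V\<^sub>0 \<Longrightarrow> x \<noteq> x0 \<Longrightarrow> extends x (\<Phi> (par (par x))) (\<Phi> x)" using local_family by blast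
  \<comment> \<open>A vertex of \<open>V\<^sub>0\<close> is evaluated in its own ball, one of
    \<open>V\<^sub>1\<close> in the ball around its parent; the next two facts show that every other
    ball gives the same value.\<close>
  define g where "g w = (if w \<in> V\<^sub>0 then \<Phi> w w else if w \<in> V\<^sub>1 then \<Phi> (par w) w else w)" for w
  have par_agree: "\<Phi> x u = \<Phi> (par y) u" if "x \<in> V\<^sub>0" "y \<in> nbrs T x" "u \<in> nbrs T y" for x y u
  proof (cases "par y = x")
    case False
    then have "par x = y" "x \<noteq> x0" using edge_par[of x y] that by auto
    then show ?thesis using \<Phi>(3)[OF that(1)] that(3) by (auto simp: extends_def)
  qed simp
  have agree: "g a = \<Phi> x a" if x: "x \<in> V\<^sub>0" and a: "a \<in> ball2 x" for x a
    using x a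
  proof (cases rule: ball2_cases)
    case self
    then show ?thesis using x by (simp add: g_def)
  next
    case nbr
    then have aV: "a \<in> V\<^sub>1" "a \<notin> V\<^sub>0" using edge_V[of x a] x V_disjoint by auto
    have "\<Phi> x a = \<Phi> (par a) a"
    proof (cases "par a = x")
      case False
      then have "par x = a" "x \<noteq> x0" using edge_par[of x a] nbr by auto
      then show ?thesis using \<Phi>(3)[OF x] by (auto simp: extends_def)
    qed simp
    then show ?thesis using aV by (simp add: g_def)
  next
    case (nbr2 y)
    then have aV: "a \<in> V\<^sub>0" using edge_V x by auto
    have "y \<in> nbrs T a" using nbr2 edge_sym[OF tree] by auto
    then have "\<Phi> a a = \<Phi> (par y) a" using par_agree[OF aV _ nbr2(2)] by blast
    also have "\<dots> = \<Phi> x a" using par_agree[OF x nbr2] by simp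
    finally show ?thesis using aV by (simp add: g_def)
  qed
  have elt: "local_elt x g" if "x \<in> V\<^sub>0" for x
    using local_elt_cong[OF that _ \<Phi>(1)[OF that]] agree[OF that] by metis
  \<comment> \<open>Local elements control neighbour sets at their centre and next to it; this
    covers the whole tree.\<close>
  have near: "\<exists>t\<in>V\<^sub>0. x = t \<or> x \<in> nbrs T t" if "x \<in> verts T" for x
  proof (cases "x \<in> V\<^sub>0")
    case False
    then have V1: "x \<in> V\<^sub>1" using that V_verts by blast
    then have "nbrs T x \<noteq> {}" using card_nbrs_V1(2)[OF V1] d1 by fastforce
    then obtain t where "(x, t) \<in> edges T" by auto
    then show ?thesis using edge_V(2)[of x t] V1 edge_sym[OF tree] by auto
  qed blast
  have bij: "bij_betw g (nbrs T x) (nbrs T (g x))" if x: "x \<in> verts T" for x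
    using near[OF x] local_elt_nbrs elt by blast
  have V0: "g x \<in> V\<^sub>0" if "x \<in> V\<^sub>0" for x using elt[OF that] by (simp add: local_elt_def)
  have V1: "g x \<in> V\<^sub>1" if x: "x \<in> V\<^sub>1" for x
  proof -
    obtain t where t: "t \<in> V\<^sub>0" "x \<in> nbrs T t" using near[OF V1_vert[OF x]] x V_disjoint by blast
    then have "g x \<in> nbrs T (g t)" using bij_betwE[OF bij[OF V0_vert]] by blast
    then show ?thesis using edge_V V0[OF t(1)] by auto
  qed
  have "g \<in> graph_aut T"
  proof (rule locally_bij_aut[OF tree _ bij])
    show "g x \<in> verts T" if "x \<in> verts T" for x using that V0 V1 V_verts by blast
    show "g x = x" if "x \<notin> verts T" for x using that V_verts by (auto simp: g_def)
  qed
  moreover have "g ` V\<^sub>0 = V\<^sub>0 \<and> g ` V\<^sub>1 = V\<^sub>1"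
  proof -
    have "g ` verts T = verts T" using \<open>g \<in> graph_aut T\<close> permutes_image by (auto simp: graph_aut_def)
    then have "g ` V\<^sub>0 \<union> g ` V\<^sub>1 = V\<^sub>0 \<union> V\<^sub>1" unfolding V_verts[symmetric] image_Un .
    moreover have "g ` V\<^sub>0 \<subseteq> V\<^sub>0" "g ` V\<^sub>1 \<subseteq> V\<^sub>1" "V\<^sub>0 \<inter> V\<^sub>1 = {}" using V0 V1 V_disjoint by blast+
    ultimately show ?thesis by blast
  qed
  ultimately have "g \<in> group_G T V\<^sub>0 V\<^sub>1 T' J model_group"
    using elt by (simp add: group_G_def aut_plus_def local_elt_def)
  moreover have "g (\<sigma> n) = \<sigma>' n" if \<sigma>: "\<sigma> \<in> rays T" "\<sigma> 0 = x0" and c: "\<And>x. x \<in> V\<^sub>0 \<Longrightarrow> compat1 \<sigma> \<sigma>' x (\<Phi> x)" for \<sigma> \<sigma>' n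
  proof -
    \<comment> \<open>The vertices of index \<open>2 * k\<close> and \<open>2 * k + 1\<close> both
      lie in the ball around the former.\<close>
    define k where "k = n div 2"
    have V: "\<sigma> (2 * k) \<in> V\<^sub>0" using ray_V0[OF \<sigma>] by simp
    have e: "\<Phi> (\<sigma> (2 * k)) (\<sigma> (2 * k)) = \<sigma>' (2 * k)" "\<Phi> (\<sigma> (2 * k)) (\<sigma> (Suc (2 * k))) = \<sigma>' (Suc (2 * k))"
      using c[OF V] unfolding compat1_def by blast+
    have "\<sigma> (Suc (2 * k)) \<in> ball2 (\<sigma> (2 * k))" using ball2_nbrs[OF V] ray_edge[OF \<sigma>(1), of "2 * k"] by auto
    then have "g (\<sigma> (2 * k)) = \<sigma>' (2 * k)" "g (\<sigma> (Suc (2 * k))) = \<sigma>' (Suc (2 * k))"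
      using agree[OF V] ball2_self[OF V] e by simp_all
    moreover have "n = 2 * k \<or> n = Suc (2 * k)" unfolding k_def by presburger
    ultimately show ?thesis by metis
  qed
  ultimately show ?thesis using that rays start \<Phi>(2) unfolding compat_def by blast
qed

end

section \<open>Ends\<close>

lemma equiv_cofinal: "equiv (rays T) (cofinal_rays T)"
proof (rule equivI)
  show "refl_on (rays T) (cofinal_rays T)"
    by (auto simp: refl_on_def cofinal_rays_def)
  show "sym (cofinal_rays T)"
    unfolding sym_def cofinal_rays_def by (auto; metis)
  show "trans (cofinal_rays T)"
  proof (rule transI)
    fix \<rho> \<sigma> \<tau> assume *: "(\<rho>, \<sigma>) \<in> cofinal_rays T" "(\<sigma>, \<tau>) \<in> cofinal_rays T"
    then obtain m n p q where mn: "\<And>k. \<rho> (m + k) = \<sigma> (n + k)" "\<And>k. \<sigma> (p + k) = \<tau> (q + k)"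
      by (auto simp: cofinal_rays_def)
    have "\<rho> ((m + p) + k) = \<tau> ((q + n) + k)" for k
      using mn(1)[of "p + k"] mn(2)[of "n + k"] by (simp add: ac_simps)
    then show "(\<rho>, \<tau>) \<in> cofinal_rays T" using * by (auto simp: cofinal_rays_def)
  qed
qed (auto simp: cofinal_rays_def)

lemma sym_cofinal: "sym (cofinal_rays T)" and trans_cofinal: "trans (cofinal_rays T)"
  using equiv_cofinal[of T] by (auto elim: equivE)

lemma cofinal_shift:
  assumes "\<rho> \<in> rays T"
  shows "(\<rho>, \<lambda>n. \<rho> (k + n)) \<in> cofinal_rays T"
proof -
  have "(\<lambda>n. \<rho> (k + n)) \<in> rays T" using assms by (auto simp: rays_def inj_eq intro!: injI)
  moreover have "\<exists>m n. \<forall>i. \<rho> (m + i) = \<rho> (k + (n + i))" by (metis add_0)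
  ultimately show ?thesis using assms by (simp add: cofinal_rays_def)
qed

context
  fixes T :: "'v ugraph"
  assumes tree: "tree_graph T"
begin

lemma ray_vert: "\<rho> \<in> rays T \<Longrightarrow> \<rho> n \<in> verts T"
  using ray_edge edge_verts[OF tree] by metis

text \<open>In a tree the absence of backtracking already gives injectivity, one initial segment at
  a time.\<close>

lemma rayI:
  assumes "\<And>n. (\<rho> n, \<rho> (Suc n)) \<in> edges T" "\<And>n. \<rho> n \<noteq> \<rho> (Suc (Suc n))"
  shows "\<rho> \<in> rays T"
proof -
  have "inj \<rho>"
  proof (rule injI)
    fix m n assume "\<rho> m = \<rho> n"
    moreover have "inj_on \<rho> {..max m n}" using assms by (intro nb_walk_inj[OF tree]) (simp add: nb_walk_def)
    ultimately show "m = n" by (auto simp: inj_on_def)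
  qed
  then show ?thesis using assms by (simp add: rays_def)
qed

lemma cofinal_cons:
  assumes "\<rho> \<in> rays T" "(y, \<rho> 0) \<in> edges T" "y \<noteq> \<rho> 1"
  shows "(\<rho>, case_nat y \<rho>) \<in> cofinal_rays T"
proof -
  have "case_nat y \<rho> \<in> rays T"
  proof (rule rayI)
    show "(case_nat y \<rho> n, case_nat y \<rho> (Suc n)) \<in> edges T" for n
      using assms ray_edge[OF assms(1)] by (cases n) auto
    show "case_nat y \<rho> n \<noteq> case_nat y \<rho> (Suc (Suc n))" for n
      using assms ray_inj[OF assms(1)] by (cases n) auto
  qed
  then have "(case_nat y \<rho>, \<rho>) \<in> cofinal_rays T"
    using cofinal_shift[of "case_nat y \<rho>" T 1] by simp
  then show ?thesis using symD[OF sym_cofinal] by blast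
qed

text \<open>Moving the starting point along one edge either drops the first vertex of the ray or
  prepends a new one, and both preserve the end.\<close>

lemma cofinal_ray_from:
  assumes "\<rho> \<in> rays T" "x \<in> verts T"
  obtains \<sigma> where "(\<rho>, \<sigma>) \<in> cofinal_rays T" "\<sigma> 0 = x"
proof -
  have "(\<rho> 0, x) \<in> (edges T)\<^sup>*" using connected[OF tree ray_vert[OF assms(1)] assms(2)] .
  then have "\<exists>\<sigma>. (\<rho>, \<sigma>) \<in> cofinal_rays T \<and> \<sigma> 0 = x"
  proof (induction rule: rtrancl_induct)
    case base
    then show ?case using cofinal_shift[OF assms(1), of 0] by auto
  next
    case (step y z)
    then obtain \<sigma> where \<sigma>: "(\<rho>, \<sigma>) \<in> cofinal_rays T" "\<sigma> 0 = y" by blast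
    have \<sigma>r: "\<sigma> \<in> rays T" using \<sigma>(1) by (simp add: cofinal_rays_def)
    have "\<exists>\<sigma>'. (\<sigma>, \<sigma>') \<in> cofinal_rays T \<and> \<sigma>' 0 = z"
    proof (cases "z = \<sigma> 1")
      case True
      then show ?thesis using cofinal_shift[OF \<sigma>r, of 1] by auto
    next
      case False
      then show ?thesis using cofinal_cons[OF \<sigma>r, of z] edge_sym[OF tree step(2)] \<sigma>(2) by auto
    qed
    then show ?case using transD[OF trans_cofinal \<sigma>(1)] by blast
  qed
  with that show ?thesis by blast
qed

lemma aut_ray: "g \<in> graph_aut T \<Longrightarrow> \<rho> \<in> rays T \<Longrightarrow> g \<circ> \<rho> \<in> rays T"
  using graph_aut_edge[OF tree] graph_aut_inj[of g T] by (auto simp: rays_def inj_def)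

lemma aut_cofinal: "g \<in> graph_aut T \<Longrightarrow> (\<rho>, \<sigma>) \<in> cofinal_rays T \<Longrightarrow> (g \<circ> \<rho>, g \<circ> \<sigma>) \<in> cofinal_rays T"
  using aut_ray[of g \<rho>] aut_ray[of g \<sigma>] unfolding cofinal_rays_def by auto metis

text \<open>Ends are sets of rays, so \<open>move_end\<close> must fill a whole class: a ray cofinal
  with \<open>g \<circ> \<rho>\<close> is pulled back by the inverse of \<open>g\<close>.\<close>

lemma move_end_class:
  assumes g: "g \<in> graph_aut T"
  shows "move_end g (cofinal_rays T `` {\<rho>}) = cofinal_rays T `` {g \<circ> \<rho>}"
proof
  show "move_end g (cofinal_rays T `` {\<rho>}) \<subseteq> cofinal_rays T `` {g \<circ> \<rho>}"
    using aut_cofinal[OF g] by (auto simp: move_end_def)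
  show "cofinal_rays T `` {g \<circ> \<rho>} \<subseteq> move_end g (cofinal_rays T `` {\<rho>})"
  proof
    fix \<sigma> assume \<sigma>: "\<sigma> \<in> cofinal_rays T `` {g \<circ> \<rho>}"
    obtain g' where g': "g' \<in> graph_aut T" "g' \<circ> g = id" "g \<circ> g' = id" using graph_aut_inverse[OF g] .
    have "(g' \<circ> (g \<circ> \<rho>), g' \<circ> \<sigma>) \<in> cofinal_rays T" using aut_cofinal[OF g'(1)] \<sigma> by simp
    then have "g' \<circ> \<sigma> \<in> cofinal_rays T `` {\<rho>}" using g'(2) by (simp flip: comp_assoc)
    moreover have "\<sigma> = g \<circ> (g' \<circ> \<sigma>)" using g'(3) by (simp flip: comp_assoc)
    ultimately show "\<sigma> \<in> move_end g (cofinal_rays T `` {\<rho>})" unfolding move_end_def by blast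
  qed
qed

end

section \<open>Closed subgroups of the automorphism group\<close>

lemma group_aut_group: "group (aut_group T)"
proof (rule groupI)
  fix x assume "x \<in> carrier (aut_group T)"
  then show "\<exists>y\<in>carrier (aut_group T). y \<otimes>\<^bsub>aut_group T\<^esub> x = \<one>\<^bsub>aut_group T\<^esub>"
    using graph_aut_inverse[of x T] by (auto simp: aut_group_def)
qed (auto simp: aut_group_def graph_aut_comp graph_aut_id comp_assoc)

lemma openin_agree:
  assumes "g \<in> graph_aut T" "finite K"
  shows "openin (aut_topology T) {g' \<in> graph_aut T. \<forall>k\<in>K. g' k = g k}"
proof -
  let ?U = "{g'. \<forall>k\<in>K. g' k = g k}"
  have "?U = PiE UNIV (\<lambda>i. if i \<in> K then {g i} else UNIV)" by (auto simp: PiE_def Pi_def split: if_splits)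
  moreover have "openin (product_topology (\<lambda>_. discrete_topology UNIV) UNIV) (PiE UNIV (\<lambda>i. if i \<in> K then {g i} else UNIV))"
    using assms(2) by (intro product_topology_basis) auto
  ultimately have "openin (product_topology (\<lambda>_. discrete_topology UNIV) UNIV) ?U" by simp
  then have "openin (aut_topology T) (graph_aut T \<inter> ?U)"
    unfolding aut_topology_def by (rule openin_subtopology_Int2)
  moreover have "graph_aut T \<inter> ?U = {g' \<in> graph_aut T. \<forall>k\<in>K. g' k = g k}" by auto
  ultimately show ?thesis by simp
qed

lemma topspace_aut_topology: "topspace (aut_topology T) = graph_aut T"
  by (simp add: aut_topology_def)

lemma closedin_aut_topologyI:
  assumes "G \<subseteq> graph_aut T"
    and "\<And>g. g \<in> graph_aut T \<Longrightarrow> g \<notin> G \<Longrightarrow>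
      \<exists>K. finite K \<and> (\<forall>g'\<in>graph_aut T. (\<forall>k\<in>K. g' k = g k) \<longrightarrow> g' \<notin> G)"
  shows "closedin (aut_topology T) G"
  unfolding closedin_def topspace_aut_topology
proof
  show "openin (aut_topology T) (graph_aut T - G)"
  proof (subst openin_subopen, rule ballI)
    fix g assume g: "g \<in> graph_aut T - G"
    then obtain K where K: "finite K" "\<forall>g'\<in>graph_aut T. (\<forall>k\<in>K. g' k = g k) \<longrightarrow> g' \<notin> G" using assms(2) by blast
    show "\<exists>U. openin (aut_topology T) U \<and> g \<in> U \<and> U \<subseteq> graph_aut T - G"
      using openin_agree[of g T K] g K by (intro exI[of _ "{g' \<in> graph_aut T. \<forall>k\<in>K. g' k = g k}"]) auto
  qed
qed (rule assms(1))

section \<open>The group \<open>G\<close>\<close>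

context semiregular_setup
begin

abbreviation G :: "('v \<Rightarrow> 'v) set" where "G \<equiv> group_G T V\<^sub>0 V\<^sub>1 T' J model_group"

lemma G_D:
  assumes "g \<in> G"
  shows "g \<in> graph_aut T" "g ` V\<^sub>0 = V\<^sub>0" "g ` V\<^sub>1 = V\<^sub>1" "\<And>x. x \<in> V\<^sub>0 \<Longrightarrow> local_act g x \<in> model_group"
  using assms by (auto simp: group_G_def aut_plus_def)

lemma G_I:
  "g \<in> graph_aut T \<Longrightarrow> g ` V\<^sub>0 = V\<^sub>0 \<Longrightarrow> g ` V\<^sub>1 = V\<^sub>1 \<Longrightarrow> (\<And>x. x \<in> V\<^sub>0 \<Longrightarrow> local_act g x \<in> model_group) \<Longrightarrow> g \<in> G"
  by (auto simp: group_G_def aut_plus_def)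

text \<open>The local action is a cocycle. That \<open>h\<close> is an automorphism ensures that the
  ball around \<open>x\<close> lands in the ball around \<open>h x\<close>.\<close>

lemma local_act_comp:
  assumes "h \<in> graph_aut T" "x \<in> V\<^sub>0" "h x \<in> V\<^sub>0"
  shows "local_act (g \<circ> h) x = local_act g (h x) \<circ> local_act h x"
proof (rule local_act_eqI[OF assms(2)])
  show "(local_act g (h x) \<circ> local_act h x) w = w" if "w \<notin> verts T'" for w
    using local_act_outside[OF that] by simp
  show "(local_act g (h x) \<circ> local_act h x) (J x a) = J ((g \<circ> h) x) ((g \<circ> h) a)" if a: "a \<in> ball2 x" for a
  proof -
    have "h a \<in> ball2 (h x)" using bij_betwE[OF graph_aut_gball[OF tree assms(1) V0_vert[OF assms(2)]]] a by blast
    then show ?thesis using local_act_J[OF assms(2) a] local_act_J[OF assms(3)] by simp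
  qed
qed

lemma local_act_id: "x \<in> V\<^sub>0 \<Longrightarrow> local_act id x = id"
  by (rule local_act_eqI) auto

lemma subgroup_G: "subgroup G (aut_group T)"
proof -
  interpret group "aut_group T" by (rule group_aut_group)
  show ?thesis
  proof (rule subgroupI)
    show "G \<subseteq> carrier (aut_group T)" using G_D(1) by (auto simp: aut_group_def)
    have "id \<in> G" by (rule G_I) (auto simp: graph_aut_id local_act_id model_group_id)
    then show "G \<noteq> {}" by blast
    fix g assume g: "g \<in> G"
    show "g \<otimes>\<^bsub>aut_group T\<^esub> h \<in> G" if h: "h \<in> G" for h
    proof -
      have "g \<circ> h \<in> G"
      proof (rule G_I)
        show "g \<circ> h \<in> graph_aut T" using G_D(1) g h by (intro graph_aut_comp)
        show "(g \<circ> h) ` V\<^sub>0 = V\<^sub>0" "(g \<circ> h) ` V\<^sub>1 = V\<^sub>1" unfolding image_comp[symmetric] using G_D(2,3) g h by simp_all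
        show "local_act (g \<circ> h) x \<in> model_group" if x: "x \<in> V\<^sub>0" for x
        proof -
          have hx: "h x \<in> V\<^sub>0" using G_D(2)[OF h] x by blast
          show ?thesis
            unfolding local_act_comp[OF G_D(1)[OF h] x hx]
            using model_group_comp[OF G_D(4)[OF h x] G_D(4)[OF g hx]] .
        qed
      qed
      then show ?thesis by (simp add: aut_group_def)
    qed
    obtain g' where g': "g' \<in> graph_aut T" "g' \<circ> g = id" "g \<circ> g' = id" using graph_aut_inverse[OF G_D(1)[OF g]] .
    have "inv\<^bsub>aut_group T\<^esub> g = g'"
      using g' G_D(1)[OF g] by (intro inv_equality) (auto simp: aut_group_def)
    moreover have "g' \<in> G"
    proof (rule G_I)
      have "g' ` V\<^sub>0 = (g' \<circ> g) ` V\<^sub>0" "g' ` V\<^sub>1 = (g' \<circ> g) ` V\<^sub>1"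
        unfolding image_comp[symmetric] G_D(2)[OF g] G_D(3)[OF g] by simp_all
      then show im: "g' ` V\<^sub>0 = V\<^sub>0" "g' ` V\<^sub>1 = V\<^sub>1" using g'(2) by simp_all
      show "local_act g' x \<in> model_group" if x: "x \<in> V\<^sub>0" for x
      proof -
        define t where "t = g' x"
        have t: "t \<in> V\<^sub>0" using im x by (auto simp: t_def)
        have gt: "g t = x" using g'(3) by (simp add: t_def fun_eq_iff)
        let ?h = "local_act g t"
        have h: "?h \<in> model_group" using G_D(4)[OF g t] .
        have l: "local_act g' x \<circ> ?h = id"
          using local_act_comp[OF G_D(1)[OF g] t, of g'] gt x g'(2) local_act_id[OF t] by simp
        obtain h' where h': "h' \<in> rooted_aut T' v" "h' \<circ> ?h = id" "?h \<circ> h' = id"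
          using rooted_aut_inverse[OF model_group_rooted_aut[OF h]] .
        \<comment> \<open>So far only a left inverse of \<open>?h\<close> is known; since
          \<open>?h\<close> is invertible, it must coincide with \<open>h'\<close>.\<close>
        have "local_act g' x = local_act g' x \<circ> (?h \<circ> h')" using h'(3) by simp
        also have "\<dots> = h'" unfolding comp_assoc[symmetric] l by simp
        finally show ?thesis using model_group_inverse[OF h h'] by simp
      qed
    qed (rule g'(1))
    ultimately show "inv\<^bsub>aut_group T\<^esub> g \<in> G" by simp
  qed
qed

text \<open>Failure to lie in \<open>G\<close> is visible on a finite set: one vertex sent to the
  wrong class, or one ball of radius 2 with a local action outside the model group.\<close>

lemma closed_G: "closedin (aut_topology T) G"
proof (rule closedin_aut_topologyI)
  show "G \<subseteq> graph_aut T" using G_D(1) by blast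
  fix g assume g: "g \<in> graph_aut T" "g \<notin> G"
  show "\<exists>K. finite K \<and> (\<forall>g'\<in>graph_aut T. (\<forall>k\<in>K. g' k = g k) \<longrightarrow> g' \<notin> G)"
  proof (cases "\<exists>x. (x \<in> V\<^sub>0 \<and> g x \<notin> V\<^sub>0) \<or> (x \<in> V\<^sub>1 \<and> g x \<notin> V\<^sub>1)")
    case True
    then obtain x where x: "(x \<in> V\<^sub>0 \<and> g x \<notin> V\<^sub>0) \<or> (x \<in> V\<^sub>1 \<and> g x \<notin> V\<^sub>1)" by blast
    have "g' \<notin> G" if "g' x = g x" for g'
      using x that G_D(2,3)[of g'] by (metis imageI)
    then show ?thesis by (intro exI[of _ "{x}"]) auto
  next
    case False
    have "g ` verts T = verts T" using g(1) permutes_image by (auto simp: graph_aut_def)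
    then have "g ` V\<^sub>0 \<union> g ` V\<^sub>1 = V\<^sub>0 \<union> V\<^sub>1" unfolding V_verts[symmetric] image_Un .
    moreover have "g ` V\<^sub>0 \<subseteq> V\<^sub>0" "g ` V\<^sub>1 \<subseteq> V\<^sub>1" "V\<^sub>0 \<inter> V\<^sub>1 = {}" using False V_disjoint by blast+
    ultimately have "g ` V\<^sub>0 = V\<^sub>0" "g ` V\<^sub>1 = V\<^sub>1" by blast+
    then obtain x where x: "x \<in> V\<^sub>0" "local_act g x \<notin> model_group" using G_I[of g] g by blast
    have "g' \<notin> G" if "\<forall>k\<in>ball2 x. g' k = g k" for g'
      using local_act_cong[OF x(1), of g' g] that x G_D(4)[of g' x] by auto
    moreover have "finite (ball2 x)"
      using bij_betw_finite[OF bij_J[OF x(1)]] finite_rooted_verts[OF rooted] by blast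
    ultimately show ?thesis by blast
  qed
qed

text \<open>The line joining the two ends is cut at a vertex of \<open>V\<^sub>0\<close> into two rays.\<close>

lemma line_between:
  assumes "\<rho> \<in> rays T" "\<tau> \<in> rays T" "(\<rho>, \<tau>) \<notin> cofinal_rays T"
  obtains \<rho>' \<tau>' where "(\<rho>, \<rho>') \<in> cofinal_rays T" "(\<tau>, \<tau>') \<in> cofinal_rays T"
    "\<rho>' 0 = \<tau>' 0" "\<rho>' 0 \<in> V\<^sub>0" "\<rho>' 1 \<noteq> \<tau>' 1"
proof -
  have rayD: "\<beta> \<in> rays T" if "(\<alpha>, \<beta>) \<in> cofinal_rays T" for \<alpha> \<beta> using that by (simp add: cofinal_rays_def)
  obtain \<sigma> where \<sigma>: "(\<tau>, \<sigma>) \<in> cofinal_rays T" "\<sigma> 0 = \<rho> 0"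
    using cofinal_ray_from[OF tree assms(2) ray_vert[OF tree assms(1), of 0]] .
  have "\<exists>n. \<rho> n \<noteq> \<sigma> n"
  proof (rule ccontr)
    assume "\<not> ?thesis"
    then have "\<rho> = \<sigma>" by auto
    then show False using \<sigma>(1) assms(3) symD[OF sym_cofinal] by blast
  qed
  \<comment> \<open>The rays share their first vertex, so the first disagreement has positive index
    and the line turns at the vertex before it.\<close>
  then obtain n where n: "\<rho> n \<noteq> \<sigma> n" "\<And>k. k < n \<Longrightarrow> \<rho> k = \<sigma> k"
    using exists_least_iff[of "\<lambda>n. \<rho> n \<noteq> \<sigma> n"] by blast
  obtain m where m: "n = Suc m" using n \<sigma>(2) by (cases n) auto
  define \<rho>1 where "\<rho>1 = (\<lambda>n. \<rho> (m + n))"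
  define \<sigma>1 where "\<sigma>1 = (\<lambda>n. \<sigma> (m + n))"
  have c: "(\<rho>, \<rho>1) \<in> cofinal_rays T" "(\<tau>, \<sigma>1) \<in> cofinal_rays T"
    using cofinal_shift[OF assms(1), of m] transD[OF trans_cofinal \<sigma>(1) cofinal_shift[OF rayD[OF \<sigma>(1)], of m]]
    by (simp_all add: \<rho>1_def \<sigma>1_def)
  have eq: "\<rho>1 0 = \<sigma>1 0" "\<rho>1 1 \<noteq> \<sigma>1 1" using n m by (simp_all add: \<rho>1_def \<sigma>1_def)
  show ?thesis
  proof (cases "\<rho>1 0 \<in> V\<^sub>0")
    case True
    then show ?thesis using that c eq by blast
  next
    case False
    \<comment> \<open>The turning vertex lies in \<open>V\<^sub>1\<close>, so the cut moves on to
      \<open>\<rho>1 1\<close>: this vertex is prepended to \<open>\<sigma>1\<close>, without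
      backtracking since \<open>\<rho>1 1 \<noteq> \<sigma>1 1\<close>, and \<open>\<rho>1\<close>
      loses its first vertex.\<close>
    note e = ray_edge[OF rayD[OF c(1)], of 0]
    have V0: "\<rho>1 1 \<in> V\<^sub>0" using edge_V[OF e] False V_verts edge_verts[OF tree e] by auto
    have "(\<rho>1 1, \<sigma>1 0) \<in> edges T" using edge_sym[OF tree e] eq by simp
    then have "(\<sigma>1, case_nat (\<rho>1 1) \<sigma>1) \<in> cofinal_rays T"
      using cofinal_cons[OF tree rayD[OF c(2)]] eq by blast
    then have "(\<tau>, case_nat (\<rho>1 1) \<sigma>1) \<in> cofinal_rays T" using transD[OF trans_cofinal c(2)] by blast
    moreover have "(\<rho>, \<lambda>n. \<rho>1 (1 + n)) \<in> cofinal_rays T" using transD[OF trans_cofinal c(1) cofinal_shift[OF rayD[OF c(1)]]] .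
    moreover have "\<rho>1 2 \<noteq> \<sigma>1 0" using ray_inj[OF rayD[OF c(1)], of 2 0] eq by simp
    ultimately show ?thesis using V0 by (intro that[of "\<lambda>n. \<rho>1 (1 + n)" "case_nat (\<rho>1 1) \<sigma>1"]) (auto simp: numeral_2_eq_2)
  qed
qed

lemma two_transitive_G: "two_transitive_on (ends T) G move_end"
  unfolding two_transitive_on_def
proof (intro ballI impI, elim conjE)
  let ?C = "\<lambda>\<rho>. cofinal_rays T `` {\<rho>}"
  have cls: "?C \<alpha> = ?C \<beta>" if "(\<alpha>, \<beta>) \<in> cofinal_rays T" for \<alpha> \<beta> using equiv_class_eq[OF equiv_cofinal that] .
  have pair: "\<exists>\<rho> \<tau>. \<rho> \<in> rays T \<and> \<tau> \<in> rays T \<and> a = ?C \<rho> \<and> b = ?C \<tau> \<and> \<rho> 0 = \<tau> 0 \<and> \<rho> 0 \<in> V\<^sub>0 \<and> \<rho> 1 \<noteq> \<tau> 1"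
    if ab: "a \<in> ends T" "b \<in> ends T" "a \<noteq> b" for a b
  proof -
    obtain \<rho> \<tau> where r: "\<rho> \<in> rays T" "\<tau> \<in> rays T" "a = ?C \<rho>" "b = ?C \<tau>"
      using ab by (auto simp: ends_def quotient_def)
    then have "(\<rho>, \<tau>) \<notin> cofinal_rays T" using cls ab by blast
    from line_between[OF r(1,2) this] obtain \<rho>' \<tau>' where
      l: "(\<rho>, \<rho>') \<in> cofinal_rays T" "(\<tau>, \<tau>') \<in> cofinal_rays T" "\<rho>' 0 = \<tau>' 0" "\<rho>' 0 \<in> V\<^sub>0" "\<rho>' 1 \<noteq> \<tau>' 1" .
    then have "\<rho>' \<in> rays T" "\<tau>' \<in> rays T" by (simp_all add: cofinal_rays_def)
    then show ?thesis using cls[OF l(1)] cls[OF l(2)] l r by metis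
  qed
  fix a b c d assume e: "a \<in> ends T" "b \<in> ends T" "c \<in> ends T" "d \<in> ends T" "a \<noteq> b" "c \<noteq> d"
  obtain \<rho> \<tau> where r: "\<rho> \<in> rays T" "\<tau> \<in> rays T" "a = ?C \<rho>" "b = ?C \<tau>" "\<rho> 0 = \<tau> 0" "\<rho> 0 \<in> V\<^sub>0" "\<rho> 1 \<noteq> \<tau> 1"
    using pair[OF e(1,2,5)] by blast
  obtain \<rho>' \<tau>' where r': "\<rho>' \<in> rays T" "\<tau>' \<in> rays T" "c = ?C \<rho>'" "d = ?C \<tau>'" "\<rho>' 0 = \<tau>' 0" "\<rho>' 0 \<in> V\<^sub>0" "\<rho>' 1 \<noteq> \<tau>' 1"
    using pair[OF e(3,4,6)] by blast
  \<comment> \<open>Both lines are cut at vertices of \<open>V\<^sub>0\<close>, so indices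
    correspond and no obstruction from the bipartition arises.\<close>
  interpret L: line_setup d\<^sub>1 T' v j T\<^sub>0 v\<^sub>0 j\<^sub>0 \<psi> \<alpha> T V\<^sub>0 V\<^sub>1 J \<rho> \<tau> \<rho>' \<tau>' "\<rho> 0" "\<rho>' 0"
    by unfold_locales (use r r' in auto)
  obtain g where g: "g \<in> G" "\<And>n. g (\<rho> n) = \<rho>' n" "\<And>n. g (\<tau> n) = \<tau>' n" by (rule L.exists_global_element) (rule that)
  have "g \<circ> \<rho> = \<rho>'" "g \<circ> \<tau> = \<tau>'" using g by auto
  then have "move_end g a = c \<and> move_end g b = d"
    using move_end_class[OF tree G_D(1)[OF g(1)]] r(3,4) r'(3,4) by simp
  then show "\<exists>g\<in>G. move_end g a = c \<and> move_end g b = d" using g(1) by blast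
qed

lemma G_in_H_plus: "G \<in> H_plus T V\<^sub>0 V\<^sub>1"
  using subgroup_G closed_G two_transitive_G by (auto simp: H_plus_def group_G_def)

end

theorem lemma6p2:
  fixes T :: "'v ugraph" and V\<^sub>0 V\<^sub>1 :: "'v set" and d\<^sub>1 :: nat
    and T' :: "'a ugraph" and v :: 'a and j :: "'a \<Rightarrow> nat"
    and T'\<^sub>0 :: "'b ugraph" and v\<^sub>0 :: 'b and j\<^sub>0 :: "'b \<Rightarrow> nat"
    and \<psi> :: "3^2 \<Rightarrow> 'b" and \<alpha> :: "'a \<Rightarrow> 'b" and J :: "'v \<Rightarrow> 'v \<Rightarrow> 'a"
  assumes "d\<^sub>1 \<ge> 4"
    and "semiregular_tree T V\<^sub>0 V\<^sub>1 4 d\<^sub>1"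
    and "rooted_tree_4_2 T'\<^sub>0 v\<^sub>0 3"
    and "vector_labelling T'\<^sub>0 v\<^sub>0 \<psi>"
    and "rooted_tree_4_2 T' v d\<^sub>1"
    and "legal_coloring T' v d\<^sub>1 j"
    and "legal_coloring T'\<^sub>0 v\<^sub>0 3 j\<^sub>0"
    and "j\<^sub>0 v\<^sub>0 = j v"
    and "color_map T' v j T'\<^sub>0 v\<^sub>0 j\<^sub>0 \<alpha>"
    and "\<And>x. x \<in> V\<^sub>0 \<Longrightarrow> rooted_iso (J x) (induced T (gball T x 2)) x T' v"
  shows "group_G T V\<^sub>0 V\<^sub>1 T' J
           (parity_preimage T' v j T'\<^sub>0 v\<^sub>0 j\<^sub>0 \<alpha> (SL23_image T'\<^sub>0 v\<^sub>0 \<psi>))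
         \<in> H_plus T V\<^sub>0 V\<^sub>1"
proof -
  interpret semiregular_setup d\<^sub>1 T' v j T'\<^sub>0 v\<^sub>0 j\<^sub>0 \<psi> \<alpha> T V\<^sub>0 V\<^sub>1 J
    by unfold_locales (fact assms)+
  show ?thesis using G_in_H_plus unfolding model_group_def .
qed

end
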